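(* Let $m\ge 1$ be an integer and let $\mathcal M=L(SL(\mathbb Z,2m+1))$ be the group von Neumann algebra associated with $SL(\mathbb Z,2m+1)$, the special linear group of $(2m+1)\times(2m+1)$ matrices with integer entries. Then $\mathcal G(\mathcal M)=0$. In particular, $\mathcal M$ is singly generated.
   Context: A von Neumann algebra is singly generated if it is generated, as a von Neumann algebra, by two self-adjoint elements (equivalently, by a single element). For a discrete group $G$, $L(G)$ is the von Neumann algebra on $\ell^2(G)$ generated by the left regular representation, with its canonical trace. Definition of $\mathcal G$. Let $\mathcal M$ be a diffuse von Neumann algebra (i.e. without minimal projections) with a faithful normal tracial state $\tau$. For each integer $k\ge 1$ let $\mathfrak E_k$ be the collection of all families $\{p_j\}_{j=1}^k$ of mutually orthogonal projections of $\mathcal M$ with $\tau(p_j)=1/k$ for all $j$. For $x\in\mathcal M$ and $\{p_j\}_{j=1}^k\in\mathfrak E_k$ put $\mathcal I(x;\{p_j\}_{j=1}^k)=|\{(i,j): 1\le i,j\le k,\ p_ixp_j\ne 0\}|/k^2$, and for $x_1,\dots,x_n\in\mathcal M$ put $\mathcal I(x_1,\dots,x_n;\{p_j\}_{j=1}^k)=\sum_{m=1}^n\mathcal I(x_m;\{p_j\}_{j=1}^k)$. Let $\mathcal I(x_1,\dots,x_n;k)$ be the infimum of $\mathcal I(x_1,\dots,x_n;\{p_j\}_{j=1}^k)$ over $\{p_j\}_{j=1}^k\in\mathfrak E_k$. Let $\mathcal G(\mathcal M;k)$ be the infimum of $\mathcal I(x_1,\dots,x_n;k)$ over all finite families $x_1,\dots,x_n$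 ($n\ge 1$) generating $\mathcal M$ as a von Neumann algebra, and $\mathcal G(\mathcal M;k)=\infty$ if $\mathcal M$ is not finitely generated. Finally $\mathcal G(\mathcal M)=\liminf_{k\to\infty}\mathcal G(\mathcal M;k)$. *)

theory Defs
  imports
    "HOL-Analysis.Infinite_Sum"
    "HOL-Library.FuncSet"
    "HOL-Library.Extended_Real"
    "HOL-Library.Liminf_Limsup"
    "HOL-Algebra.Group"
    "Jordan_Normal_Form.Determinant"
begin

section \<open>Bounded operators on $\ell^2(S)$\<close>

text \<open>Vectors of $\ell^2(S)$ are represented by functions that vanish off \<open>S\<close>, so that equality
  of vectors is equality of functions.\<close>

definition ell2 :: "'a set \<Rightarrow> ('a \<Rightarrow> complex) set" where
  "ell2 S = {f. (\<forall>x. x \<notin> S \<longrightarrow> f x = 0) \<and> (\<lambda>x. (cmod (f x))\<^sup>2) summable_on S}"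

definition ell2_inner :: "'a set \<Rightarrow> ('a \<Rightarrow> complex) \<Rightarrow> ('a \<Rightarrow> complex) \<Rightarrow> complex" where
  "ell2_inner S f g = (\<Sum>\<^sub>\<infinity>x\<in>S. f x * cnj (g x))"

definition ell2_norm :: "'a set \<Rightarrow> ('a \<Rightarrow> complex) \<Rightarrow> real" where
  "ell2_norm S f = sqrt (\<Sum>\<^sub>\<infinity>x\<in>S. (cmod (f x))\<^sup>2)"

type_synonym 'a operator = "('a \<Rightarrow> complex) \<Rightarrow> ('a \<Rightarrow> complex)"

text \<open>Operators are extensional functions on \<^term>\<open>ell2 S\<close>, so that equality of operators is equality of
  functions; the product of two operators is \<^term>\<open>compose (ell2 S)\<close>.\<close>

definition bounded_ops :: "'a set \<Rightarrow> 'a operator set" where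
  "bounded_ops S = {T \<in> ell2 S \<rightarrow>\<^sub>E ell2 S.
     (\<forall>f\<in>ell2 S. \<forall>g\<in>ell2 S. T (\<lambda>x. f x + g x) = (\<lambda>x. T f x + T g x)) \<and>
     (\<forall>c. \<forall>f\<in>ell2 S. T (\<lambda>x. c * f x) = (\<lambda>x. c * T f x)) \<and>
     (\<exists>C. \<forall>f\<in>ell2 S. ell2_norm S (T f) \<le> C * ell2_norm S f)}"

definition zero_op :: "'a set \<Rightarrow> 'a operator" where
  "zero_op S = (\<lambda>f\<in>ell2 S. (\<lambda>x. 0))"

definition is_adjoint :: "'a set \<Rightarrow> 'a operator \<Rightarrow> 'a operator \<Rightarrow> bool" where
  "is_adjoint S A B \<longleftrightarrow>
     (\<forall>f\<in>ell2 S. \<forall>g\<in>ell2 S. ell2_inner S (A f) g = ell2_inner S f (B g))"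

definition self_adjoint :: "'a set \<Rightarrow> 'a operator \<Rightarrow> bool" where
  "self_adjoint S A \<longleftrightarrow> A \<in> bounded_ops S \<and> is_adjoint S A A"

definition is_projection :: "'a set \<Rightarrow> 'a operator \<Rightarrow> bool" where
  "is_projection S P \<longleftrightarrow> self_adjoint S P \<and> compose (ell2 S) P P = P"

section \<open>Von Neumann algebras\<close>

definition commutant :: "'a set \<Rightarrow> 'a operator set \<Rightarrow> 'a operator set" where
  "commutant S X =
     {T \<in> bounded_ops S. \<forall>A\<in>X. compose (ell2 S) T A = compose (ell2 S) A T}"

text \<open>Every Hilbert space is isomorphic to some $\ell^2(S)$, so this covers all concrete von Neumann
  algebras up to the size of the type \<open>'a\<close>. The double commutant condition makes them
  unital subalgebras.\<close>

definition von_neumann_algebra :: "'a set \<Rightarrow> 'a operator set \<Rightarrow> bool" where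
  "von_neumann_algebra S M \<longleftrightarrow>
     M \<subseteq> bounded_ops S \<and>
     (\<forall>A\<in>M. \<exists>B\<in>M. is_adjoint S A B) \<and>
     commutant S (commutant S M) = M"

definition vN_generated :: "'a set \<Rightarrow> 'a operator set \<Rightarrow> 'a operator set" where
  "vN_generated S X = \<Inter>{N. von_neumann_algebra S N \<and> X \<subseteq> N}"

definition singly_generated :: "'a set \<Rightarrow> 'a operator set \<Rightarrow> bool" where
  "singly_generated S M \<longleftrightarrow>
     (\<exists>a\<in>M. \<exists>b\<in>M. self_adjoint S a \<and> self_adjoint S b \<and> vN_generated S {a, b} = M)"

section \<open>The invariant $\mathcal G$\<close>

text \<open>Throughout, \<open>M\<close> is meant to be a diffuse von Neumann algebra on $\ell^2(S)$ and \<open>\<tau>\<close> a faithful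
  normal tracial state on it.\<close>

definition proj_families ::
  "'a set \<Rightarrow> 'a operator set \<Rightarrow> ('a operator \<Rightarrow> complex) \<Rightarrow> nat \<Rightarrow> (nat \<Rightarrow> 'a operator) set" where
  "proj_families S M \<tau> k = {p.
     (\<forall>j\<in>{1..k}. p j \<in> M \<and> is_projection S (p j) \<and> \<tau> (p j) = 1 / of_nat k) \<and>
     (\<forall>i\<in>{1..k}. \<forall>j\<in>{1..k}. i \<noteq> j \<longrightarrow> compose (ell2 S) (p i) (p j) = zero_op S)}"

definition I_elem :: "'a set \<Rightarrow> 'a operator \<Rightarrow> (nat \<Rightarrow> 'a operator) \<Rightarrow> nat \<Rightarrow> real" where
  "I_elem S x p k =
     real (card {(i, j). i \<in> {1..k} \<and> j \<in> {1..k} \<and>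
       compose (ell2 S) (p i) (compose (ell2 S) x (p j)) \<noteq> zero_op S}) / (real k)\<^sup>2"

definition I_fam :: "'a set \<Rightarrow> 'a operator list \<Rightarrow> (nat \<Rightarrow> 'a operator) \<Rightarrow> nat \<Rightarrow> real" where
  "I_fam S xs p k = (\<Sum>x\<leftarrow>xs. I_elem S x p k)"

text \<open>The infima are taken in \<^typ>\<open>ereal\<close>, where the infimum of the empty set is \<open>\<infinity>\<close>; in particular
  \<open>G_at S M \<tau> k = \<infinity>\<close> if \<open>M\<close> is not finitely generated.\<close>

definition I_inf ::
  "'a set \<Rightarrow> 'a operator set \<Rightarrow> ('a operator \<Rightarrow> complex) \<Rightarrow> 'a operator list \<Rightarrow> nat \<Rightarrow> ereal" where
  "I_inf S M \<tau> xs k = (INF p \<in> proj_families S M \<tau> k. ereal (I_fam S xs p k))"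

definition G_at ::
  "'a set \<Rightarrow> 'a operator set \<Rightarrow> ('a operator \<Rightarrow> complex) \<Rightarrow> nat \<Rightarrow> ereal" where
  "G_at S M \<tau> k =
     (INF xs \<in> {xs. xs \<noteq> [] \<and> set xs \<subseteq> M \<and> vN_generated S (set xs) = M}. I_inf S M \<tau> xs k)"

definition G_inv :: "'a set \<Rightarrow> 'a operator set \<Rightarrow> ('a operator \<Rightarrow> complex) \<Rightarrow> ereal" where
  "G_inv S M \<tau> = liminf (\<lambda>k. G_at S M \<tau> k)"

section \<open>Group von Neumann algebras\<close>

definition left_regular :: "('a, 'b) monoid_scheme \<Rightarrow> 'a \<Rightarrow> 'a operator" where
  "left_regular G g =
     (\<lambda>f\<in>ell2 (carrier G). (\<lambda>h. if h \<in> carrier G then f (inv\<^bsub>G\<^esub> g \<otimes>\<^bsub>G\<^esub> h) else 0))"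

definition group_vna :: "('a, 'b) monoid_scheme \<Rightarrow> 'a operator set" where
  "group_vna G = vN_generated (carrier G) (left_regular G ` carrier G)"

definition canonical_trace :: "('a, 'b) monoid_scheme \<Rightarrow> 'a operator \<Rightarrow> complex" where
  "canonical_trace G x =
     (let \<delta> = (\<lambda>h. if h = \<one>\<^bsub>G\<^esub> then 1 else 0) in ell2_inner (carrier G) (x \<delta>) \<delta>)"

definition SL_int :: "nat \<Rightarrow> int mat monoid" where
  "SL_int n =
     \<lparr>carrier = {A \<in> carrier_mat n n. det A = 1}, monoid.mult = (*), one = 1\<^sub>m n\<rparr>"

lemma group_SL_int: "group (SL_int n)"
proof (rule groupI)
  fix A assume "A \<in> carrier (SL_int n)"
  then have A: "A \<in> carrier_mat n n" "det A = 1" by (auto simp: SL_int_def)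
  note adj = adj_mat[OF A(1)]
  have "1 \<cdot>\<^sub>m 1\<^sub>m n = (1\<^sub>m n :: int mat)" by (rule eq_matI) auto
  then have inv: "adj_mat A * A = 1\<^sub>m n" using adj(3) A(2) by simp
  then have "det (adj_mat A) = 1" using det_mult[OF adj(1) A(1)] A(2) by simp
  then show "\<exists>B\<in>carrier (SL_int n). B \<otimes>\<^bsub>SL_int n\<^esub> A = \<one>\<^bsub>SL_int n\<^esub>"
    using adj(1) inv by (auto simp: SL_int_def)
qed (auto simp: SL_int_def det_mult)

end

theory Submission
  imports
    Defs
    "HOL-Analysis.Weierstrass_Theorems"
    "HOL-Analysis.Equivalence_Lebesgue_Henstock_Integration"
    "HOL-Analysis.Kronecker_Approximation_Theorem"
begin

text \<open>
  Let \<open>G\<close> be the group of integral \<open>n \<times> n\<close> matrices of determinant one with \<open>n \<ge> 3\<close>, let \<open>E i j\<close> be the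
  elementary matrix with off-diagonal entry \<open>1\<close> at position \<open>(i, j)\<close>, indices counted from \<open>0\<close>, and write
  group elements also for their left translations. Put \<open>U = E 0 1\<close>, \<open>V = E 0 2\<close>, \<open>F = E 1 2\<close> and \<open>H = E 1 0\<close>.

  \<^bold>\<open>The invariant vanishes.\<close> Since \<open>U\<close> has infinite order, it generates a copy of the bounded functions on the
  circle of length one. The indicator functions of the \<open>k\<close> consecutive arcs of length \<open>1/k\<close> become projections
  \<open>p 1, \<dots>, p k\<close> of trace \<open>1/k\<close>: convolutions along \<open>U\<close> with the Fourier coefficients of the arcs. The claim is
  that the algebra has a generating family of fixed size, each member of which has only \<open>O(k)\<close> nonzero blocks with respect
  to them; see \<open>SL_G_at_le\<close>. If \<open>i \<noteq> 1\<close> and \<open>j \<noteq> 0\<close>, then \<open>E i j\<close> commutes with \<open>U\<close>, and only its diagonal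
  blocks are nonzero. Each of the other \<open>E i j\<close> is replaced by its corner \<open>(E i j) p 1\<close>, which has a single
  nonzero block column. One more operator \<open>e\<close> makes up for what the corners lose.

  To find \<open>e\<close>, note that \<open>F\<close> commutes with \<open>V\<close> and shears \<open>U\<close>: on the torus of joint spectral values of \<open>U\<close> and
  \<open>V\<close>, the power \<open>F\<^sup>r\<close> translates the first coordinate by \<open>r\<close> times the second one. Cut the second circle into
  \<open>k\<^sup>2\<close> arcs, with spectral projections \<open>Q i\<close> of \<open>V\<close>. By Dirichlet's approximation theorem there is
  \<open>1 \<le> r i \<le> k\<close> such that \<open>r i\<cdot>i/k\<^sup>2\<close> is within \<open>1/k\<close> of an integer, so that \<open>Q i F\<^bsup>r i\<^esup>\<close> moves every
  arc by at most two steps. Hence the sum \<open>e\<close> of these pieces has at most \<open>11 k\<close> nonzero blocks.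

  \<^bold>\<open>The family generates.\<close> By the double commutant condition it suffices that every bounded operator \<open>T\<close> that
  commutes with the family commutes with \<open>G\<close>. Such a \<open>T\<close> commutes with \<open>U\<close> and \<open>V\<close>, thus with \<open>P = p 1\<close>, with all
  \<open>Q i\<close> and with the powers \<open>Q i F\<^bsup>r i m\<^esup>\<close> of the pieces. The essential point is
  \<open>conv_op_section_annihilates\<close>: if the conjugates of the subgroup generated by \<open>U\<close> under group elements \<open>f m\<close>
  intersect pairwise trivially, then the ranges of the operators \<open>(f m) P\<close> span a dense subspace. Consequently, a group
  element \<open>g\<close> that commutes with all \<open>f m\<close> is already determined by its corner \<open>g P\<close>
  (\<open>commutes_from_corner\<close>). This gives \<open>F\<close>, via powers of the pieces; the row \<open>E 1 j\<close>, and in particular \<open>H\<close>,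
  via powers of \<open>F\<close>; and the column \<open>E i 0\<close> via powers of \<open>H\<close>. The elementary matrices generate \<open>G\<close>.

  \<^bold>\<open>Single generation.\<close> For odd \<open>n\<close>, the cyclic permutation matrix \<open>c\<close> lies in \<open>G\<close> and has odd order. Together
  with two commuting involutions \<open>x\<close> and \<open>y\<close> it generates \<open>G\<close>. The self-adjoint elements \<open>\<i> (c - c\<inverse>)\<close> and
  \<open>x + 2 y\<close> recover \<open>c\<close>, \<open>x\<close> and \<open>y\<close> by polynomial identities
  (\<open>singly_generated_by_odd_cycle_and_involutions\<close>).
\<close>

section \<open>Square-summable functions\<close>

definition single :: "'a \<Rightarrow> 'a \<Rightarrow> complex" where
  "single h = (\<lambda>x. if x = h then 1 else 0)"

lemma ell2_zero_off: "f \<in> ell2 S \<Longrightarrow> x \<notin> S \<Longrightarrow> f x = 0"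
  by (simp add: ell2_def)

lemma ell2_summable: "f \<in> ell2 S \<Longrightarrow> (\<lambda>x. (cmod (f x))\<^sup>2) summable_on S"
  by (simp add: ell2_def)

lemma ell2_norm_nonneg [simp]: "0 \<le> ell2_norm S f"
  by (simp add: ell2_norm_def infsum_nonneg)

lemma ell2_norm_sq: "(ell2_norm S f)\<^sup>2 = (\<Sum>\<^sub>\<infinity>x\<in>S. (cmod (f x))\<^sup>2)"
  by (simp add: ell2_norm_def infsum_nonneg)

lemma ell2_finite_sum_le:
  assumes "f \<in> ell2 S" "finite F" "F \<subseteq> S"
  shows "(\<Sum>x\<in>F. (cmod (f x))\<^sup>2) \<le> (ell2_norm S f)\<^sup>2"
  unfolding ell2_norm_sq
  by (rule finite_sum_le_infsum) (use assms ell2_summable in auto)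

lemma ell2_L2_set_le:
  assumes "f \<in> ell2 S" "finite F" "F \<subseteq> S"
  shows "L2_set (\<lambda>x. cmod (f x)) F \<le> ell2_norm S f"
proof -
  have "sqrt (\<Sum>x\<in>F. (cmod (f x))\<^sup>2) \<le> sqrt ((ell2_norm S f)\<^sup>2)"
    using ell2_finite_sum_le[OF assms] by (rule real_sqrt_le_mono)
  then show ?thesis by (simp add: L2_set_def)
qed

lemma ell2_boundedI:
  assumes off: "\<And>x. x \<notin> S \<Longrightarrow> f x = 0" and B: "0 \<le> B"
    and le: "\<And>F. finite F \<Longrightarrow> F \<subseteq> S \<Longrightarrow> L2_set (\<lambda>x. cmod (f x)) F \<le> B"
  shows "f \<in> ell2 S" and "ell2_norm S f \<le> B"
proof -
  have le2: "(\<Sum>x\<in>F. (cmod (f x))\<^sup>2) \<le> B\<^sup>2" if "finite F" "F \<subseteq> S" for F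
    using le[OF that] B by (metis L2_set_def real_sqrt_le_iff real_sqrt_unique)
  have s: "(\<lambda>x. (cmod (f x))\<^sup>2) summable_on S"
    by (rule nonneg_bdd_above_summable_on) (auto intro!: bdd_aboveI2[where M="B\<^sup>2"] le2)
  then show "f \<in> ell2 S" using off by (simp add: ell2_def)
  have "(\<Sum>\<^sub>\<infinity>x\<in>S. (cmod (f x))\<^sup>2) \<le> B\<^sup>2"
    by (rule infsum_le_finite_sums[OF s]) (use le2 in auto)
  then show "ell2_norm S f \<le> B"
    using B by (metis ell2_norm_sq power2_le_imp_le)
qed

lemma ell2_zero [simp]: "(\<lambda>x. 0) \<in> ell2 S"
  by (simp add: ell2_def)

lemma ell2_norm_zero [simp]: "ell2_norm S (\<lambda>x. 0) = 0"
  by (simp add: ell2_norm_def)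

lemma ell2_single [simp]: "h \<in> S \<Longrightarrow> single h \<in> ell2 S"
proof -
  assume h: "h \<in> S"
  have "(\<lambda>x. (cmod (single h x))\<^sup>2) summable_on {h}" by simp
  then have "(\<lambda>x. (cmod (single h x))\<^sup>2) summable_on S"
    by (rule summable_on_cong_neutral[THEN iffD1, rotated -1]) (use h in \<open>auto simp: single_def\<close>)
  then show ?thesis using h by (auto simp: ell2_def single_def)
qed

lemma ell2_add [simp]:
  assumes "f \<in> ell2 S" "g \<in> ell2 S"
  shows "(\<lambda>x. f x + g x) \<in> ell2 S"
    and ell2_norm_triangle: "ell2_norm S (\<lambda>x. f x + g x) \<le> ell2_norm S f + ell2_norm S g"
proof -
  have le: "L2_set (\<lambda>x. cmod (f x + g x)) F \<le> ell2_norm S f + ell2_norm S g"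
    if "finite F" "F \<subseteq> S" for F
  proof -
    have "L2_set (\<lambda>x. cmod (f x + g x)) F \<le> L2_set (\<lambda>x. cmod (f x) + cmod (g x)) F"
      by (rule L2_set_mono) (auto simp: norm_triangle_ineq)
    also have "\<dots> \<le> L2_set (\<lambda>x. cmod (f x)) F + L2_set (\<lambda>x. cmod (g x)) F"
      by (rule L2_set_triangle_ineq)
    also have "\<dots> \<le> ell2_norm S f + ell2_norm S g"
      using ell2_L2_set_le[OF assms(1) that] ell2_L2_set_le[OF assms(2) that] by simp
    finally show ?thesis .
  qed
  show "(\<lambda>x. f x + g x) \<in> ell2 S" "ell2_norm S (\<lambda>x. f x + g x) \<le> ell2_norm S f + ell2_norm S g"
    using ell2_boundedI[where f = "\<lambda>x. f x + g x", OF _ _ le] assms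
    by (auto simp: ell2_zero_off)
qed

lemma ell2_norm_cmult [simp]: "ell2_norm S (\<lambda>x. c * f x) = cmod c * ell2_norm S f"
  by (simp add: ell2_norm_def norm_mult power_mult_distrib infsum_cmult_right' real_sqrt_mult)

lemma ell2_cmult [simp]: "f \<in> ell2 S \<Longrightarrow> (\<lambda>x. c * f x) \<in> ell2 S"
  by (auto simp: ell2_def norm_mult power_mult_distrib intro!: summable_on_cmult_right)

lemma ell2_minus [simp]: "f \<in> ell2 S \<Longrightarrow> (\<lambda>x. - f x) \<in> ell2 S"
  by (simp add: ell2_def)

lemma ell2_diff [simp]:
  assumes "f \<in> ell2 S" "g \<in> ell2 S"
  shows "(\<lambda>x. f x - g x) \<in> ell2 S"
  using ell2_add(1)[OF assms(1) ell2_minus[OF assms(2)]] by simp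

lemma ell2_sum [simp]:
  assumes "\<And>i. i \<in> I \<Longrightarrow> f i \<in> ell2 S"
  shows "(\<lambda>x. \<Sum>i\<in>I. f i x) \<in> ell2 S"
  using assms by (induction I rule: infinite_finite_induct) auto

lemma ell2_cmod_le_norm:
  assumes "f \<in> ell2 S"
  shows "cmod (f x) \<le> ell2_norm S f"
proof (cases "x \<in> S")
  case True
  then show ?thesis using ell2_L2_set_le[OF assms, of "{x}"] by (simp add: L2_set_def)
qed (simp add: ell2_zero_off[OF assms])

text \<open>The finite Cauchy-Schwarz inequality bounds every finite partial sum of the absolute values,
  so absolute convergence and the infinite inequality come together.\<close>

lemma ell2_mult_abs_summable:
  assumes "f \<in> ell2 S" "g \<in> ell2 S"
  shows "(\<lambda>x. f x * g x) abs_summable_on S"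
    and "(\<Sum>\<^sub>\<infinity>x\<in>S. cmod (f x * g x)) \<le> ell2_norm S f * ell2_norm S g"
proof -
  have le: "(\<Sum>x\<in>F. cmod (f x * g x)) \<le> ell2_norm S f * ell2_norm S g"
    if F: "finite F" "F \<subseteq> S" for F
  proof -
    have "(\<Sum>x\<in>F. cmod (f x * g x)) = (\<Sum>x\<in>F. \<bar>cmod (f x)\<bar> * \<bar>cmod (g x)\<bar>)"
      by (simp add: norm_mult)
    also have "\<dots> \<le> L2_set (\<lambda>x. cmod (f x)) F * L2_set (\<lambda>x. cmod (g x)) F"
      by (rule L2_set_mult_ineq)
    also have "\<dots> \<le> ell2_norm S f * ell2_norm S g"
      by (intro mult_mono ell2_L2_set_le assms F) (auto simp: L2_set_nonneg)
    finally show ?thesis .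
  qed
  show s: "(\<lambda>x. f x * g x) abs_summable_on S"
    by (rule nonneg_bdd_above_summable_on) (auto intro!: bdd_aboveI2 le)
  show "(\<Sum>\<^sub>\<infinity>x\<in>S. cmod (f x * g x)) \<le> ell2_norm S f * ell2_norm S g"
    by (rule infsum_le_finite_sums[OF s]) (use le in auto)
qed

lemma ell2_cnj [simp]: "(\<lambda>x. cnj (f x)) \<in> ell2 S \<longleftrightarrow> f \<in> ell2 S"
  by (simp add: ell2_def)

lemma ell2_norm_cnj [simp]: "ell2_norm S (\<lambda>x. cnj (f x)) = ell2_norm S f"
  by (simp add: ell2_norm_def)

lemma ell2_inner_has_sum:
  assumes "f \<in> ell2 S" "g \<in> ell2 S"
  shows "((\<lambda>x. f x * cnj (g x)) has_sum ell2_inner S f g) S"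
  unfolding ell2_inner_def
  by (rule has_sum_infsum[OF abs_summable_summable[OF ell2_mult_abs_summable(1)]]) (use assms in auto)

lemma ell2_Cauchy_Schwarz:
  assumes "f \<in> ell2 S" "g \<in> ell2 S"
  shows "cmod (\<Sum>\<^sub>\<infinity>x\<in>S. f x * g x) \<le> ell2_norm S f * ell2_norm S g"
  using norm_infsum_bound[OF ell2_mult_abs_summable(1)[OF assms]] ell2_mult_abs_summable(2)[OF assms]
  by simp

lemma ell2_inner_bound:
  assumes "f \<in> ell2 S" "g \<in> ell2 S"
  shows "cmod (ell2_inner S f g) \<le> ell2_norm S f * ell2_norm S g"
  using ell2_Cauchy_Schwarz[of f S "\<lambda>x. cnj (g x)"] assms by (simp add: ell2_inner_def)

lemma ell2_inner_self:
  assumes "f \<in> ell2 S"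
  shows "ell2_inner S f f = of_real ((ell2_norm S f)\<^sup>2)"
proof -
  have "((\<lambda>x. (cmod (f x))\<^sup>2) has_sum (ell2_norm S f)\<^sup>2) S"
    unfolding ell2_norm_sq by (intro has_sum_infsum ell2_summable assms)
  then have "((\<lambda>x. of_real ((cmod (f x))\<^sup>2)) has_sum complex_of_real ((ell2_norm S f)\<^sup>2)) S"
    by (rule has_sum_of_real)
  then have "((\<lambda>x. f x * cnj (f x)) has_sum complex_of_real ((ell2_norm S f)\<^sup>2)) S"
    by (simp add: complex_norm_square del: of_real_power)
  then show ?thesis by (simp add: ell2_inner_def infsumI)
qed

section \<open>Bounded functionals and operators\<close>

text \<open>A bounded functional is determined by its values on the standard basis: truncations of
  \<open>\<xi>\<close> to finite sets converge to \<open>\<xi>\<close> in norm.\<close>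

lemma bounded_functional_has_sum:
  fixes \<phi> :: "('a \<Rightarrow> complex) \<Rightarrow> complex"
  assumes add: "\<And>f g. f \<in> ell2 S \<Longrightarrow> g \<in> ell2 S \<Longrightarrow> \<phi> (\<lambda>x. f x + g x) = \<phi> f + \<phi> g"
    and scale: "\<And>c f. f \<in> ell2 S \<Longrightarrow> \<phi> (\<lambda>x. c * f x) = c * \<phi> f"
    and bd: "\<And>f. f \<in> ell2 S \<Longrightarrow> cmod (\<phi> f) \<le> C * ell2_norm S f"
    and xi: "\<xi> \<in> ell2 S"
  shows "((\<lambda>h. \<xi> h * \<phi> (single h)) has_sum \<phi> \<xi>) S"
proof -
  define tr where "tr F = (\<lambda>x. \<Sum>h\<in>F. \<xi> h * single h x)" for F
  have tr_ell2: "tr F \<in> ell2 S" if "F \<subseteq> S" for F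
    unfolding tr_def using that by (intro ell2_sum ell2_cmult ell2_single) auto
  have phi_zero: "\<phi> (\<lambda>x. 0) = 0"
    using scale[of "\<lambda>x. 0" 0] by simp
  have phi_tr: "\<phi> (tr F) = (\<Sum>h\<in>F. \<xi> h * \<phi> (single h))" if "finite F" "F \<subseteq> S" for F
    using that
  proof (induction F rule: finite_induct)
    case empty
    then show ?case by (simp add: tr_def phi_zero)
  next
    case (insert h F)
    have "tr (insert h F) = (\<lambda>x. \<xi> h * single h x + tr F x)"
      using insert by (simp add: tr_def)
    then show ?case
      using insert add[of "\<lambda>x. \<xi> h * single h x" "tr F"] scale[of "single h" "\<xi> h"] tr_ell2[of F]
      by simp
  qed
  have tr_eval: "tr F x = (if x \<in> F then \<xi> x else 0)" if "finite F" for F x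
    using that by (simp add: tr_def single_def if_distrib[of "\<lambda>z. _ * z"] cong: if_cong)
  define e where "e F = \<bar>C\<bar> * sqrt ((\<Sum>\<^sub>\<infinity>x\<in>S. (cmod (\<xi> x))\<^sup>2) - (\<Sum>x\<in>F. (cmod (\<xi> x))\<^sup>2))" for F
  have dist: "cmod ((\<Sum>h\<in>F. \<xi> h * \<phi> (single h)) - \<phi> \<xi>) \<le> e F" if F: "finite F" "F \<subseteq> S" for F
  proof -
    define r where "r = (\<lambda>x. tr F x - \<xi> x)"
    have r: "r \<in> ell2 S" unfolding r_def by (intro ell2_diff tr_ell2 F xi)
    have "tr F = (\<lambda>x. r x + \<xi> x)" by (simp add: r_def)
    then have "\<phi> (tr F) - \<phi> \<xi> = \<phi> r" using add[OF r xi] by simp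
    moreover have "cmod (\<phi> r) \<le> \<bar>C\<bar> * ell2_norm S r"
      using bd[OF r] by (meson abs_ge_self dual_order.trans ell2_norm_nonneg mult_right_mono)
    moreover have "(ell2_norm S r)\<^sup>2 = (\<Sum>\<^sub>\<infinity>x\<in>S. (cmod (\<xi> x))\<^sup>2) - (\<Sum>x\<in>F. (cmod (\<xi> x))\<^sup>2)"
    proof -
      have "(\<Sum>\<^sub>\<infinity>x\<in>S. (cmod (r x))\<^sup>2) = (\<Sum>\<^sub>\<infinity>x\<in>S - F. (cmod (\<xi> x))\<^sup>2)"
        by (rule infsum_cong_neutral) (auto simp: r_def tr_eval F)
      also have "\<dots> = (\<Sum>\<^sub>\<infinity>x\<in>S. (cmod (\<xi> x))\<^sup>2) - (\<Sum>\<^sub>\<infinity>x\<in>F. (cmod (\<xi> x))\<^sup>2)"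
        by (rule infsum_Diff) (use F xi ell2_summable in auto)
      finally show ?thesis using F by (simp add: ell2_norm_sq)
    qed
    then have "ell2_norm S r = sqrt ((\<Sum>\<^sub>\<infinity>x\<in>S. (cmod (\<xi> x))\<^sup>2) - (\<Sum>x\<in>F. (cmod (\<xi> x))\<^sup>2))"
      by (metis ell2_norm_nonneg real_sqrt_unique)
    ultimately show ?thesis using phi_tr[OF F] by (simp add: e_def)
  qed
  have "((\<lambda>F. \<Sum>x\<in>F. (cmod (\<xi> x))\<^sup>2) \<longlongrightarrow> (\<Sum>\<^sub>\<infinity>x\<in>S. (cmod (\<xi> x))\<^sup>2)) (finite_subsets_at_top S)"
    using has_sum_infsum[OF ell2_summable[OF xi]] by (simp add: has_sum_def)
  then have "(e \<longlongrightarrow> \<bar>C\<bar> * sqrt ((\<Sum>\<^sub>\<infinity>x\<in>S. (cmod (\<xi> x))\<^sup>2) - (\<Sum>\<^sub>\<infinity>x\<in>S. (cmod (\<xi> x))\<^sup>2)))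
      (finite_subsets_at_top S)"
    unfolding e_def by (intro tendsto_intros)
  then have e0: "(e \<longlongrightarrow> 0) (finite_subsets_at_top S)" by simp
  have "((\<lambda>F. (\<Sum>h\<in>F. \<xi> h * \<phi> (single h)) - \<phi> \<xi>) \<longlongrightarrow> 0) (finite_subsets_at_top S)"
    by (rule Lim_null_comparison[OF _ e0]) (auto intro!: eventually_finite_subsets_at_top_weakI dist)
  then show ?thesis unfolding has_sum_def by (rule LIM_zero_cancel)
qed

lemma
  assumes "T \<in> bounded_ops S"
  shows bops_add: "f \<in> ell2 S \<Longrightarrow> g \<in> ell2 S \<Longrightarrow> T (\<lambda>x. f x + g x) = (\<lambda>x. T f x + T g x)"
    and bops_scale: "f \<in> ell2 S \<Longrightarrow> T (\<lambda>x. c * f x) = (\<lambda>x. c * T f x)"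
    and bops_ell2: "f \<in> ell2 S \<Longrightarrow> T f \<in> ell2 S"
    and bops_ext: "T \<in> extensional (ell2 S)"
  using assms by (auto simp: bounded_ops_def PiE_def)

lemma bops_bound:
  assumes "T \<in> bounded_ops S"
  obtains C where "0 \<le> C" "\<And>f. f \<in> ell2 S \<Longrightarrow> ell2_norm S (T f) \<le> C * ell2_norm S f"
proof -
  obtain C where C: "\<And>f. f \<in> ell2 S \<Longrightarrow> ell2_norm S (T f) \<le> C * ell2_norm S f"
    using assms unfolding bounded_ops_def by blast
  have "ell2_norm S (T f) \<le> \<bar>C\<bar> * ell2_norm S f" if "f \<in> ell2 S" for f
    using C[OF that] by (meson abs_ge_self dual_order.trans ell2_norm_nonneg mult_right_mono)
  then show ?thesis using that[of "\<bar>C\<bar>"] by simp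
qed

lemma bounded_opsI:
  assumes "\<And>f. f \<in> ell2 S \<Longrightarrow> T f \<in> ell2 S" "T \<in> extensional (ell2 S)"
    and "\<And>f g. f \<in> ell2 S \<Longrightarrow> g \<in> ell2 S \<Longrightarrow> T (\<lambda>x. f x + g x) = (\<lambda>x. T f x + T g x)"
    and "\<And>c f. f \<in> ell2 S \<Longrightarrow> T (\<lambda>x. c * f x) = (\<lambda>x. c * T f x)"
    and "\<And>f. f \<in> ell2 S \<Longrightarrow> ell2_norm S (T f) \<le> C * ell2_norm S f"
  shows "T \<in> bounded_ops S"
  unfolding bounded_ops_def PiE_def using assms(1-4) by (auto intro!: exI[of _ C] assms(5))

lemma bops_zero:
  assumes "T \<in> bounded_ops S" shows "T (\<lambda>x. 0) = (\<lambda>x. 0)"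
  using bops_scale[OF assms ell2_zero, of 0] by simp

lemma bops_minus:
  assumes "T \<in> bounded_ops S" "f \<in> ell2 S" shows "T (\<lambda>x. - f x) = (\<lambda>x. - T f x)"
  using bops_scale[OF assms, of "-1"] by simp

lemma bops_diff:
  assumes "T \<in> bounded_ops S" "f \<in> ell2 S" "g \<in> ell2 S"
  shows "T (\<lambda>x. f x - g x) = (\<lambda>x. T f x - T g x)"
  using bops_add[OF assms(1,2) ell2_minus[OF assms(3)]] bops_minus[OF assms(1,3)] by simp

lemma bops_sum:
  assumes T: "T \<in> bounded_ops S" and f: "\<And>i. i \<in> I \<Longrightarrow> f i \<in> ell2 S"
  shows "T (\<lambda>x. \<Sum>i\<in>I. f i x) = (\<lambda>x. \<Sum>i\<in>I. T (f i) x)"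
  using f
proof (induction I rule: infinite_finite_induct)
  case (insert i I)
  then show ?case using bops_add[OF T, of "f i" "\<lambda>x. \<Sum>i\<in>I. f i x"] by simp
qed (simp_all add: bops_zero[OF T])

lemma bops_has_sum:
  assumes T: "T \<in> bounded_ops S" and xi: "\<xi> \<in> ell2 S"
  shows "((\<lambda>h. \<xi> h * T (single h) x) has_sum T \<xi> x) S"
proof -
  obtain C where C: "\<And>f. f \<in> ell2 S \<Longrightarrow> ell2_norm S (T f) \<le> C * ell2_norm S f"
    using bops_bound[OF T] by blast
  show ?thesis
  proof (rule bounded_functional_has_sum[where \<phi> = "\<lambda>f. T f x" and C = C, OF _ _ _ xi])
    show "cmod (T f x) \<le> C * ell2_norm S f" if "f \<in> ell2 S" for f
      using ell2_cmod_le_norm[OF bops_ell2[OF T that], of x] C[OF that] by (rule order_trans)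
  qed (simp_all add: bops_add[OF T] bops_scale[OF T])
qed

lemma bops_eqI:
  assumes A: "A \<in> bounded_ops S" and B: "B \<in> bounded_ops S"
    and eq: "\<And>h x. h \<in> S \<Longrightarrow> x \<in> S \<Longrightarrow> A (single h) x = B (single h) x"
  shows "A = B"
proof (rule extensionalityI[OF bops_ext[OF A] bops_ext[OF B]])
  fix \<xi> assume xi: "\<xi> \<in> ell2 S"
  show "A \<xi> = B \<xi>"
  proof
    fix x
    show "A \<xi> x = B \<xi> x"
    proof (cases "x \<in> S")
      case True
      have "((\<lambda>h. \<xi> h * A (single h) x) has_sum B \<xi> x) S"
        using bops_has_sum[OF B xi, of x] by (rule has_sum_cong[THEN iffD1, rotated]) (simp add: eq True)
      then show ?thesis using bops_has_sum[OF A xi] has_sum_unique by blast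
    next
      case False
      then show ?thesis using bops_ell2[OF A xi] bops_ell2[OF B xi] by (simp add: ell2_zero_off)
    qed
  qed
qed

lemma compose_bops [simp]:
  assumes A: "A \<in> bounded_ops S" and B: "B \<in> bounded_ops S"
  shows "compose (ell2 S) A B \<in> bounded_ops S"
proof -
  obtain CA where CA: "0 \<le> CA" "\<And>f. f \<in> ell2 S \<Longrightarrow> ell2_norm S (A f) \<le> CA * ell2_norm S f"
    using bops_bound[OF A] by blast
  obtain CB where CB: "0 \<le> CB" "\<And>f. f \<in> ell2 S \<Longrightarrow> ell2_norm S (B f) \<le> CB * ell2_norm S f"
    using bops_bound[OF B] by blast
  show ?thesis
  proof (rule bounded_opsI[where C = "CA * CB"])
    fix f assume f: "f \<in> ell2 S"
    have "ell2_norm S (A (B f)) \<le> CA * ell2_norm S (B f)" by (rule CA(2)[OF bops_ell2[OF B f]])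
    also have "\<dots> \<le> CA * (CB * ell2_norm S f)" by (intro mult_left_mono CB f CA)
    finally show "ell2_norm S (compose (ell2 S) A B f) \<le> CA * CB * ell2_norm S f"
      by (simp add: compose_def f)
  qed (simp_all add: compose_def bops_add[OF A] bops_add[OF B] bops_scale[OF A] bops_scale[OF B]
      bops_ell2[OF A] bops_ell2[OF B])
qed

definition op_sum :: "'a set \<Rightarrow> 'i set \<Rightarrow> ('i \<Rightarrow> complex) \<Rightarrow> ('i \<Rightarrow> 'a operator) \<Rightarrow> 'a operator" where
  "op_sum S I c A = (\<lambda>f\<in>ell2 S. (\<lambda>x. \<Sum>i\<in>I. c i * A i f x))"

lemma op_sum_apply: "f \<in> ell2 S \<Longrightarrow> op_sum S I c A f = (\<lambda>x. \<Sum>i\<in>I. c i * A i f x)"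
  by (simp add: op_sum_def)

lemma op_sum_bops [simp]:
  assumes A: "\<And>i. i \<in> I \<Longrightarrow> A i \<in> bounded_ops S"
  shows "op_sum S I c A \<in> bounded_ops S"
proof -
  have "\<exists>C. \<forall>f\<in>ell2 S. ell2_norm S (\<lambda>x. \<Sum>i\<in>I. c i * A i f x) \<le> C * ell2_norm S f"
    using A
  proof (induction I rule: infinite_finite_induct)
    case (insert i I)
    then obtain C where C: "\<And>f. f \<in> ell2 S \<Longrightarrow> ell2_norm S (\<lambda>x. \<Sum>i\<in>I. c i * A i f x) \<le> C * ell2_norm S f"
      by auto
    obtain D where D: "0 \<le> D" "\<And>f. f \<in> ell2 S \<Longrightarrow> ell2_norm S (A i f) \<le> D * ell2_norm S f"
      using bops_bound[of "A i" S] insert.prems by blast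
    have "ell2_norm S (\<lambda>x. \<Sum>i\<in>insert i I. c i * A i f x) \<le> (cmod (c i) * D + C) * ell2_norm S f"
      if f: "f \<in> ell2 S" for f
    proof -
      have e: "A j f \<in> ell2 S" if "j \<in> insert i I" for j using bops_ell2 insert.prems that f by blast
      have "ell2_norm S (\<lambda>x. c i * A i f x + (\<Sum>i\<in>I. c i * A i f x))
          \<le> ell2_norm S (\<lambda>x. c i * A i f x) + ell2_norm S (\<lambda>x. \<Sum>i\<in>I. c i * A i f x)"
        by (intro ell2_norm_triangle ell2_cmult ell2_sum e) auto
      also have "\<dots> \<le> cmod (c i) * (D * ell2_norm S f) + C * ell2_norm S f"
        using C[OF f] D(2)[OF f] by (simp add: mult_left_mono add_mono)
      finally show ?thesis using insert.hyps by (simp add: algebra_simps)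
    qed
    then show ?case by blast
  qed (auto intro!: exI[of _ 0])
  then obtain C where C: "\<And>f. f \<in> ell2 S \<Longrightarrow> ell2_norm S (\<lambda>x. \<Sum>i\<in>I. c i * A i f x) \<le> C * ell2_norm S f"
    by blast
  show ?thesis
  proof (rule bounded_opsI[where C = C])
    fix f g d
    assume f: "f \<in> ell2 S"
    show "op_sum S I c A f \<in> ell2 S"
      unfolding op_sum_apply[OF f] by (intro ell2_sum ell2_cmult bops_ell2[OF A] f)
    show "ell2_norm S (op_sum S I c A f) \<le> C * ell2_norm S f"
      unfolding op_sum_apply[OF f] by (rule C[OF f])
    show "op_sum S I c A (\<lambda>x. d * f x) = (\<lambda>x. d * op_sum S I c A f x)"
      using f by (simp add: op_sum_apply bops_scale[OF A] sum_distrib_left mult.left_commute cong: sum.cong)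
    assume g: "g \<in> ell2 S"
    show "op_sum S I c A (\<lambda>x. f x + g x) = (\<lambda>x. op_sum S I c A f x + op_sum S I c A g x)"
      using f g by (simp add: op_sum_apply bops_add[OF A] distrib_left sum.distrib cong: sum.cong)
  qed (simp add: op_sum_def)
qed

text \<open>The composites of two operators are restricted to square-summable functions; the equation between
  their values can be rewritten with directly.\<close>

definition commutes :: "'a set \<Rightarrow> 'a operator \<Rightarrow> 'a operator \<Rightarrow> bool" where
  "commutes S T A \<longleftrightarrow> (\<forall>f\<in>ell2 S. T (A f) = A (T f))"

lemma compose_commute_iff:
  "compose (ell2 S) T A = compose (ell2 S) A T \<longleftrightarrow> commutes S T A"
proof
  assume eq: "compose (ell2 S) T A = compose (ell2 S) A T"
  have "T (A f) = A (T f)" if "f \<in> ell2 S" for f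
    using fun_cong[OF eq, of f] that by (simp add: compose_def)
  then show "commutes S T A" by (simp add: commutes_def)
next
  assume "commutes S T A"
  then show "compose (ell2 S) T A = compose (ell2 S) A T"
    unfolding compose_def commutes_def by (intro restrict_ext) auto
qed

lemma commutesD: "commutes S T A \<Longrightarrow> f \<in> ell2 S \<Longrightarrow> T (A f) = A (T f)"
  by (simp add: commutes_def)

lemma commutes_compose:
  assumes "T \<in> bounded_ops S" "A \<in> bounded_ops S" "B \<in> bounded_ops S" "commutes S T A" "commutes S T B"
  shows "commutes S T (compose (ell2 S) A B)"
  using assms by (auto simp: commutes_def compose_def bops_ell2)

lemma commutes_op_sum:
  assumes T: "T \<in> bounded_ops S" and A: "\<And>i. i \<in> I \<Longrightarrow> A i \<in> bounded_ops S"
    and c: "\<And>i. i \<in> I \<Longrightarrow> commutes S T (A i)"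
  shows "commutes S T (op_sum S I c A)"
  unfolding commutes_def
proof
  fix f assume f: "f \<in> ell2 S"
  have "T (\<lambda>x. \<Sum>i\<in>I. c i * A i f x) = (\<lambda>x. \<Sum>i\<in>I. T (\<lambda>x. c i * A i f x) x)"
    by (intro bops_sum[OF T] ell2_cmult bops_ell2[OF A] f)
  also have "\<dots> = (\<lambda>x. \<Sum>i\<in>I. c i * T (A i f) x)"
    by (intro ext sum.cong refl) (use A f in \<open>simp add: bops_scale[OF T] bops_ell2\<close>)
  also have "\<dots> = (\<lambda>x. \<Sum>i\<in>I. c i * A i (T f) x)"
    by (intro ext sum.cong refl) (simp add: commutesD[OF c f])
  finally show "T (op_sum S I c A f) = op_sum S I c A (T f)"
    by (simp add: op_sum_apply f bops_ell2[OF T])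
qed

section \<open>Projections given by kernels\<close>

lemma has_sum_sum_finite:
  fixes f :: "'i \<Rightarrow> 'b \<Rightarrow> complex"
  assumes "\<And>i. i \<in> I \<Longrightarrow> (f i has_sum s i) A"
  shows "((\<lambda>x. \<Sum>i\<in>I. f i x) has_sum (\<Sum>i\<in>I. s i)) A"
  using assms
proof (induction I rule: infinite_finite_induct)
  case (insert i I)
  then show ?case using has_sum_add[where f = "f i" and g = "\<lambda>x. \<Sum>i\<in>I. f i x"] by simp
qed simp_all

definition kernel_op :: "'a set \<Rightarrow> ('a \<Rightarrow> 'a \<Rightarrow> complex) \<Rightarrow> 'a operator" where
  "kernel_op S p = (\<lambda>f\<in>ell2 S. \<lambda>x. if x \<in> S then \<Sum>\<^sub>\<infinity>y\<in>S. p x y * f y else 0)"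

definition projection_kernel :: "'a set \<Rightarrow> ('a \<Rightarrow> 'a \<Rightarrow> complex) \<Rightarrow> bool" where
  "projection_kernel S p \<longleftrightarrow>
     (\<forall>x\<in>S. \<forall>y\<in>S. p y x = cnj (p x y)) \<and>
     (\<forall>x\<in>S. \<forall>z\<in>S. ((\<lambda>y. p x y * p y z) has_sum p x z) S)"

context
  fixes S :: "'a set" and p
  assumes pk: "projection_kernel S p"
begin

lemma kernel_herm: "x \<in> S \<Longrightarrow> y \<in> S \<Longrightarrow> p y x = cnj (p x y)"
  and kernel_idem: "x \<in> S \<Longrightarrow> z \<in> S \<Longrightarrow> ((\<lambda>y. p x y * p y z) has_sum p x z) S"
  using pk unfolding projection_kernel_def by blast+

definition kernel_row :: "'a \<Rightarrow> 'a \<Rightarrow> complex" where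
  "kernel_row x = (\<lambda>y. if y \<in> S then p x y else 0)"

lemma kernel_row_ell2: "x \<in> S \<Longrightarrow> kernel_row x \<in> ell2 S"
proof -
  assume x: "x \<in> S"
  have "((\<lambda>y. p x y * p y x) has_sum p x x) S" using kernel_idem x by blast
  then have "((\<lambda>y. complex_of_real ((cmod (kernel_row x y))\<^sup>2)) has_sum p x x) S"
  proof (rule has_sum_cong[THEN iffD1, rotated])
    fix y assume y: "y \<in> S"
    show "p x y * p y x = complex_of_real ((cmod (kernel_row x y))\<^sup>2)"
      unfolding kernel_herm[OF x y] complex_norm_square by (simp add: kernel_row_def y)
  qed
  then have "((\<lambda>y. Re (complex_of_real ((cmod (kernel_row x y))\<^sup>2))) has_sum Re (p x x)) S"
    by (rule has_sum_Re)
  then show ?thesis by (auto simp: ell2_def kernel_row_def summable_on_def)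
qed

lemma kernel_op_has_sum:
  assumes "\<xi> \<in> ell2 S" "x \<in> S"
  shows "((\<lambda>y. p x y * \<xi> y) has_sum kernel_op S p \<xi> x) S"
proof -
  have "(\<lambda>y. kernel_row x y * \<xi> y) summable_on S"
    by (rule abs_summable_summable[OF ell2_mult_abs_summable(1)]) (use assms kernel_row_ell2 in auto)
  then have "(\<lambda>y. p x y * \<xi> y) summable_on S"
    by (rule summable_on_cong[THEN iffD1, rotated]) (simp add: kernel_row_def)
  then show ?thesis using assms by (simp add: kernel_op_def has_sum_infsum)
qed

text \<open>The two kernel identities imply boundedness. For finite \<open>X\<close> the values \<open>a x\<close> of the image on \<open>X\<close>
  are pairings of \<open>\<xi>\<close> with rows; the combination \<open>w\<close> of those rows satisfies
  \<open>\<parallel>w\<parallel>\<^sup>2 \<le> \<parallel>a\<parallel> \<parallel>w\<parallel>\<close>, because the Gram matrix of the rows is the kernel itself.\<close>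

lemma kernel_op_L2_le:
  assumes xi: "\<xi> \<in> ell2 S" and X: "finite X" "X \<subseteq> S"
  shows "L2_set (\<lambda>x. cmod (kernel_op S p \<xi> x)) X \<le> ell2_norm S \<xi>"
proof -
  define a where "a = kernel_op S p \<xi>"
  define A where "A = L2_set (\<lambda>x. cmod (a x)) X"
  define w where "w y = (\<Sum>x\<in>X. cnj (a x) * kernel_row x y)" for y
  have w: "w \<in> ell2 S"
    unfolding w_def using X by (intro ell2_sum ell2_cmult kernel_row_ell2) auto
  have A0: "0 \<le> A" by (simp add: A_def L2_set_nonneg)
  have A2: "complex_of_real (A\<^sup>2) = (\<Sum>x\<in>X. cnj (a x) * a x)"
    by (simp add: A_def L2_set_def sum_nonneg complex_norm_square mult.commute del: of_real_power)
  have cnj_w: "cnj (w y) = (\<Sum>x\<in>X. a x * p y x)" if "y \<in> S" for y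
    unfolding w_def kernel_row_def using that
    by (simp add: kernel_herm[OF subsetD[OF X(2)] that] cong: sum.cong)
  have "((\<lambda>y. w y * cnj (w y)) has_sum (\<Sum>x\<in>X. cnj (a x) * cnj (w x))) S"
  proof -
    have "((\<lambda>y. \<Sum>x\<in>X. \<Sum>x'\<in>X. cnj (a x) * a x' * (p x y * p y x'))
        has_sum (\<Sum>x\<in>X. \<Sum>x'\<in>X. cnj (a x) * a x' * p x x')) S"
      by (intro has_sum_sum_finite has_sum_cmult_right kernel_idem) (use X in auto)
    moreover have "(\<Sum>x\<in>X. \<Sum>x'\<in>X. cnj (a x) * a x' * p x x') = (\<Sum>x\<in>X. cnj (a x) * cnj (w x))"
      using X by (intro sum.cong refl) (auto simp: cnj_w sum_distrib_left mult.assoc)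
    moreover have "(\<Sum>x\<in>X. \<Sum>x'\<in>X. cnj (a x) * a x' * (p x y * p y x')) = w y * cnj (w y)" if "y \<in> S" for y
      unfolding cnj_w[OF that] unfolding w_def kernel_row_def sum_product
      by (intro sum.cong refl) (simp add: that mult_ac)
    ultimately show ?thesis by (metis (mono_tags, lifting) has_sum_cong)
  qed
  then have ww: "complex_of_real ((ell2_norm S w)\<^sup>2) = (\<Sum>x\<in>X. cnj (a x) * cnj (w x))"
    using ell2_inner_self[OF w] ell2_inner_has_sum[OF w w] has_sum_unique by metis
  have "(ell2_norm S w)\<^sup>2 = cmod (\<Sum>x\<in>X. cnj (a x) * cnj (w x))"
    unfolding ww[symmetric] by (simp del: of_real_power)
  also have "\<dots> \<le> (\<Sum>x\<in>X. \<bar>cmod (a x)\<bar> * \<bar>cmod (w x)\<bar>)"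
    by (rule order_trans[OF norm_sum]) (simp add: norm_mult)
  also have "\<dots> \<le> A * L2_set (\<lambda>x. cmod (w x)) X"
    unfolding A_def by (rule L2_set_mult_ineq)
  also have "\<dots> \<le> A * ell2_norm S w"
    by (intro mult_left_mono ell2_L2_set_le w X A0)
  finally have "ell2_norm S w * ell2_norm S w \<le> A * ell2_norm S w" by (simp add: power2_eq_square)
  then have wA: "ell2_norm S w \<le> A"
    using A0 ell2_norm_nonneg[of S w] by (metis mult_right_le_imp_le order_le_less)
  have "((\<lambda>y. \<Sum>x\<in>X. cnj (a x) * (p x y * \<xi> y)) has_sum (\<Sum>x\<in>X. cnj (a x) * a x)) S"
    unfolding a_def by (intro has_sum_sum_finite has_sum_cmult_right kernel_op_has_sum xi) (use X in auto)
  then have "((\<lambda>y. w y * \<xi> y) has_sum (\<Sum>x\<in>X. cnj (a x) * a x)) S"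
    by (rule has_sum_cong[THEN iffD1, rotated])
      (simp add: w_def kernel_row_def sum_distrib_right mult.assoc)
  then have "complex_of_real (A\<^sup>2) = (\<Sum>\<^sub>\<infinity>y\<in>S. w y * \<xi> y)"
    using A2 by (simp add: infsumI del: of_real_power)
  then have "A\<^sup>2 = cmod (\<Sum>\<^sub>\<infinity>y\<in>S. w y * \<xi> y)"
    by (metis abs_power2 norm_of_real)
  also have "\<dots> \<le> ell2_norm S w * ell2_norm S \<xi>" by (rule ell2_Cauchy_Schwarz[OF w xi])
  also have "\<dots> \<le> A * ell2_norm S \<xi>" by (intro mult_right_mono wA) auto
  finally have "A * A \<le> A * ell2_norm S \<xi>" by (simp add: power2_eq_square)
  then have "A \<le> ell2_norm S \<xi>"
    using A0 ell2_norm_nonneg[of S \<xi>] by (metis mult_left_le_imp_le order_le_less)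
  then show ?thesis by (simp add: A_def a_def)
qed

lemma kernel_op_ell2: "\<xi> \<in> ell2 S \<Longrightarrow> kernel_op S p \<xi> \<in> ell2 S"
  and kernel_op_norm_le: "\<xi> \<in> ell2 S \<Longrightarrow> ell2_norm S (kernel_op S p \<xi>) \<le> ell2_norm S \<xi>"
  using ell2_boundedI[where S = S and f = "kernel_op S p \<xi>", OF _ ell2_norm_nonneg kernel_op_L2_le]
  by (auto simp: kernel_op_def)

lemma kernel_op_eqI:
  assumes "\<xi> \<in> ell2 S" "\<And>x. x \<notin> S \<Longrightarrow> v x = 0"
    and "\<And>x. x \<in> S \<Longrightarrow> ((\<lambda>y. p x y * \<xi> y) has_sum v x) S"
  shows "kernel_op S p \<xi> = v"
proof
  fix x show "kernel_op S p \<xi> x = v x"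
    using assms(2) has_sum_unique[OF kernel_op_has_sum[OF assms(1)] assms(3), of x]
    by (cases "x \<in> S") (simp_all add: kernel_op_def assms(1))
qed

lemma kernel_op_bops: "kernel_op S p \<in> bounded_ops S"
proof (rule bounded_opsI[where C = 1])
  fix f g c assume f: "f \<in> ell2 S"
  show "kernel_op S p (\<lambda>x. c * f x) = (\<lambda>x. c * kernel_op S p f x)"
    by (rule kernel_op_eqI)
      (use f has_sum_cmult_right[OF kernel_op_has_sum[OF f], where c = c] in
        \<open>auto simp: mult.left_commute kernel_op_def\<close>)
  assume g: "g \<in> ell2 S"
  show "kernel_op S p (\<lambda>x. f x + g x) = (\<lambda>x. kernel_op S p f x + kernel_op S p g x)"
    by (rule kernel_op_eqI)
      (use f g has_sum_add[OF kernel_op_has_sum[OF f] kernel_op_has_sum[OF g]] in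
        \<open>auto simp: distrib_left kernel_op_def\<close>)
qed (use kernel_op_ell2 kernel_op_norm_le in \<open>auto simp: kernel_op_def\<close>)

lemma kernel_op_single:
  assumes "h \<in> S"
  shows "kernel_op S p (single h) = (\<lambda>x. if x \<in> S then p x h else 0)"
proof (rule kernel_op_eqI)
  fix x assume "x \<in> S"
  have "((\<lambda>y. p x y * single h y) has_sum (\<Sum>y\<in>{h}. p x y * single h y)) {h}"
    by (rule has_sum_finite) simp
  then have "((\<lambda>y. p x y * single h y) has_sum p x h) {h}" by (simp add: single_def)
  then have "((\<lambda>y. p x y * single h y) has_sum p x h) S"
    by (rule has_sum_cong_neutral[THEN iffD1, rotated -1]) (use assms in \<open>auto simp: single_def\<close>)
  then show "((\<lambda>y. p x y * single h y) has_sum (if x \<in> S then p x h else 0)) S"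
    using \<open>x \<in> S\<close> by simp
qed (use assms in auto)

lemma kernel_op_self_adjoint: "is_adjoint S (kernel_op S p) (kernel_op S p)"
  unfolding is_adjoint_def
proof (intro ballI)
  fix f g assume f: "f \<in> ell2 S" and g: "g \<in> ell2 S"
  have "((\<lambda>h. f h * ell2_inner S (kernel_op S p (single h)) g) has_sum ell2_inner S (kernel_op S p f) g) S"
  proof (rule bounded_functional_has_sum[where \<phi> = "\<lambda>f. ell2_inner S (kernel_op S p f) g" and C = "ell2_norm S g", OF _ _ _ f])
    fix f' g' assume fg: "f' \<in> ell2 S" "g' \<in> ell2 S"
    show "ell2_inner S (kernel_op S p (\<lambda>x. f' x + g' x)) g
        = ell2_inner S (kernel_op S p f') g + ell2_inner S (kernel_op S p g') g"
      using has_sum_add[OF ell2_inner_has_sum[OF kernel_op_ell2[OF fg(1)] g] ell2_inner_has_sum[OF kernel_op_ell2[OF fg(2)] g]]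
      by (simp add: ell2_inner_def bops_add[OF kernel_op_bops fg] distrib_right infsumI)
  next
    fix c f' assume f': "f' \<in> ell2 S"
    show "ell2_inner S (kernel_op S p (\<lambda>x. c * f' x)) g = c * ell2_inner S (kernel_op S p f') g"
      by (simp add: ell2_inner_def bops_scale[OF kernel_op_bops f'] mult.assoc infsum_cmult_right')
  next
    fix f' assume f': "f' \<in> ell2 S"
    have "cmod (ell2_inner S (kernel_op S p f') g) \<le> ell2_norm S (kernel_op S p f') * ell2_norm S g"
      by (intro ell2_inner_bound kernel_op_ell2 f' g)
    also have "\<dots> \<le> ell2_norm S f' * ell2_norm S g"
      by (intro mult_right_mono kernel_op_norm_le f') auto
    finally show "cmod (ell2_inner S (kernel_op S p f') g) \<le> ell2_norm S g * ell2_norm S f'"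
      by (simp add: mult.commute)
  qed
  moreover have "ell2_inner S (kernel_op S p (single h)) g = cnj (kernel_op S p g h)" if h: "h \<in> S" for h
  proof -
    have "((\<lambda>y. cnj (p h y * g y)) has_sum cnj (kernel_op S p g h)) S"
      by (subst has_sum_cnj_iff) (rule kernel_op_has_sum[OF g h])
    then have "((\<lambda>y. kernel_op S p (single h) y * cnj (g y)) has_sum cnj (kernel_op S p g h)) S"
      by (rule has_sum_cong[THEN iffD1, rotated]) (simp add: kernel_op_single[OF h] kernel_herm[OF h])
    then show ?thesis by (simp add: ell2_inner_def infsumI)
  qed
  ultimately have "((\<lambda>h. f h * cnj (kernel_op S p g h)) has_sum ell2_inner S (kernel_op S p f) g) S"
    by (simp cong: has_sum_cong)
  then show "ell2_inner S (kernel_op S p f) g = ell2_inner S f (kernel_op S p g)"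
    using ell2_inner_has_sum[OF f kernel_op_ell2[OF g]] has_sum_unique by blast
qed

lemma kernel_op_projection: "is_projection S (kernel_op S p)"
proof -
  have "compose (ell2 S) (kernel_op S p) (kernel_op S p) = kernel_op S p"
  proof (rule bops_eqI)
    fix h x assume h: "h \<in> S" and x: "x \<in> S"
    have "kernel_op S p (kernel_op S p (single h)) = kernel_op S p (single h)"
    proof (rule kernel_op_eqI)
      fix x assume x: "x \<in> S"
      have "((\<lambda>y. p x y * kernel_op S p (single h) y) has_sum p x h) S"
        using kernel_idem[OF x h] by (rule has_sum_cong[THEN iffD1, rotated]) (simp add: kernel_op_single[OF h])
      then show "((\<lambda>y. p x y * kernel_op S p (single h) y) has_sum kernel_op S p (single h) x) S"
        using x by (simp add: kernel_op_single[OF h])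
    qed (auto simp: h kernel_op_ell2 ell2_zero_off[OF kernel_op_ell2[OF ell2_single[OF h]]])
    then show "compose (ell2 S) (kernel_op S p) (kernel_op S p) (single h) x = kernel_op S p (single h) x"
      using h by (simp add: compose_def)
  qed (auto simp: kernel_op_bops)
  then show ?thesis
    by (simp add: is_projection_def self_adjoint_def kernel_op_bops kernel_op_self_adjoint)
qed

end

section \<open>Generation of von Neumann algebras\<close>

text \<open>Membership and generation are phrased through the operators that commute with the generators,
  because every von Neumann algebra that contains the generators is its own double commutant.\<close>

lemma in_vN_generatedI:
  assumes A: "A \<in> bounded_ops S"
    and comm: "\<And>T. T \<in> bounded_ops S \<Longrightarrow> (\<And>X. X \<in> Xs \<Longrightarrow> commutes S T X) \<Longrightarrow> commutes S T A"
  shows "A \<in> vN_generated S Xs"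
  unfolding vN_generated_def
proof (rule InterI)
  fix N assume "N \<in> {N. von_neumann_algebra S N \<and> Xs \<subseteq> N}"
  then have N: "commutant S (commutant S N) = N" "Xs \<subseteq> N" by (auto simp: von_neumann_algebra_def)
  have "A \<in> commutant S (commutant S N)"
    unfolding commutant_def[of S "commutant S N"]
  proof (intro CollectI conjI A ballI)
    fix T assume "T \<in> commutant S N"
    then have "T \<in> bounded_ops S" "commutes S T X" if "X \<in> Xs" for X
      using N(2) that by (auto simp: commutant_def compose_commute_iff)
    moreover have "T \<in> bounded_ops S" using \<open>T \<in> commutant S N\<close> by (simp add: commutant_def)
    ultimately have "commutes S T A" using comm by blast
    then show "compose (ell2 S) A T = compose (ell2 S) T A" by (metis compose_commute_iff)
  qed
  then show "A \<in> N" using N(1) by simp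
qed

lemma vN_generated_eqI:
  assumes Y: "Y \<subseteq> bounded_ops S" and Xs: "Xs \<subseteq> vN_generated S Y"
    and comm: "\<And>T y. T \<in> bounded_ops S \<Longrightarrow> (\<And>X. X \<in> Xs \<Longrightarrow> commutes S T X) \<Longrightarrow> y \<in> Y \<Longrightarrow> commutes S T y"
  shows "vN_generated S Xs = vN_generated S Y"
proof -
  have "Y \<subseteq> vN_generated S Xs"
    by (intro subsetI in_vN_generatedI) (use Y comm in blast)+
  then show ?thesis using Xs unfolding vN_generated_def by blast
qed

text \<open>The averages of bounded vectors with pairwise disjoint supports tend to zero in norm.
  An operator that kills all the vectors \<open>c\<cdot>single h + r m\<close> therefore kills \<open>single h\<close>.\<close>

lemma disjoint_perturbations_annihilate:
  assumes D: "D \<in> bounded_ops S" and h: "h \<in> S" and c: "c \<noteq> 0"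
    and r: "\<And>m. r m \<in> ell2 S" "\<And>m. ell2_norm S (r m) \<le> B"
    and disj: "\<And>m m' x. m < m' \<Longrightarrow> r m' x \<noteq> 0 \<Longrightarrow> r m x = 0"
    and kill: "\<And>m::nat. D (\<lambda>x. c * single h x + r m x) = (\<lambda>x. 0)"
  shows "D (single h) = (\<lambda>x. 0)"
proof -
  define R where "R N = (\<lambda>x. \<Sum>m<N. r m x)" for N :: nat
  have R: "R N \<in> ell2 S" for N unfolding R_def by (intro ell2_sum r)
  have B: "0 \<le> B" using r(2)[of 0] ell2_norm_nonneg order_trans by blast
  have sq: "(cmod (R N x))\<^sup>2 = (\<Sum>m<N. (cmod (r m x))\<^sup>2)" for N x
  proof (induction N)
    case (Suc N)
    show ?case
    proof (cases "r N x = 0")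
      case True
      then show ?thesis using Suc by (simp add: R_def)
    next
      case False
      then have "R N x = 0" unfolding R_def by (intro sum.neutral) (use disj in auto)
      then show ?thesis using Suc by (simp add: R_def)
    qed
  qed (simp add: R_def)
  have norm_R: "ell2_norm S (R N) \<le> sqrt N * B" for N
  proof (rule ell2_boundedI(2))
    fix F assume F: "finite F" "F \<subseteq> S"
    have "(\<Sum>x\<in>F. (cmod (R N x))\<^sup>2) = (\<Sum>m<N. \<Sum>x\<in>F. (cmod (r m x))\<^sup>2)"
      unfolding sq by (rule sum.swap)
    also have "\<dots> \<le> (\<Sum>m<N. B\<^sup>2)"
      by (intro sum_mono order_trans[OF ell2_finite_sum_le[OF r(1) F]] power_mono r(2)) auto
    also have "\<dots> = (sqrt N * B)\<^sup>2" by (simp add: power_mult_distrib)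
    finally have "sqrt (\<Sum>x\<in>F. (cmod (R N x))\<^sup>2) \<le> sqrt ((sqrt N * B)\<^sup>2)" by (rule real_sqrt_le_mono)
    then show "L2_set (\<lambda>x. cmod (R N x)) F \<le> sqrt N * B" using B by (simp add: L2_set_def)
  qed (use B in \<open>auto simp: ell2_zero_off[OF R]\<close>)
  obtain C where C: "0 \<le> C" "\<And>f. f \<in> ell2 S \<Longrightarrow> ell2_norm S (D f) \<le> C * ell2_norm S f"
    using bops_bound[OF D] by blast
  define d where "d = ell2_norm S (D (single h))"
  have DR: "D (R N) = (\<lambda>x. - (of_nat N * c) * D (single h) x)" for N
  proof -
    have Dr: "D (r m) = (\<lambda>x. - c * D (single h) x)" for m
    proof -
      have "(\<lambda>x. c * D (single h) x + D (r m) x) = (\<lambda>x. 0)"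
        using kill[of m] bops_add[OF D _ r(1), of "\<lambda>x. c * single h x" m] bops_scale[OF D, of "single h" c] h
        by simp
      then show ?thesis by (auto simp: fun_eq_iff add_eq_0_iff)
    qed
    show ?thesis unfolding R_def by (subst bops_sum[OF D]) (auto simp: r Dr)
  qed
  \<comment> \<open>The image of the sum of \<open>N\<close> perturbations under \<open>D\<close> grows like \<open>N\<close>, the sum itself only like \<open>sqrt N\<close>.\<close>
  have bd: "sqrt N * (cmod c * d) \<le> C * B" if N: "N > 0" for N :: nat
  proof -
    have "real N * cmod c * d = ell2_norm S (D (R N))"
      unfolding DR ell2_norm_cmult d_def by (simp add: norm_mult)
    also have "\<dots> \<le> C * ell2_norm S (R N)" by (rule C(2)[OF R])
    also have "\<dots> \<le> C * (sqrt N * B)" by (intro mult_left_mono norm_R C)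
    finally have "(sqrt N * sqrt N) * (cmod c * d) \<le> sqrt N * (C * B)"
      by (simp add: algebra_simps)
    then have "sqrt N * (sqrt N * (cmod c * d)) \<le> sqrt N * (C * B)"
      by (simp only: mult.assoc)
    then show ?thesis using N by (simp add: mult_le_cancel_left)
  qed
  have "d = 0"
  proof (rule ccontr)
    assume "d \<noteq> 0"
    then have pos: "cmod c * d > 0" using c by (simp add: d_def order_less_le)
    obtain N :: nat where N: "((C * B) / (cmod c * d) + 1)\<^sup>2 < real N" using reals_Archimedean2 by blast
    have CB: "0 \<le> C * B / (cmod c * d)" using C B pos by simp
    have "(C * B) / (cmod c * d) + 1 < sqrt N"
      using N CB by (meson real_less_rsqrt)
    then have "C * B / (cmod c * d) < sqrt N" by simp
    then have "C * B < sqrt N * (cmod c * d)" using pos by (simp add: pos_divide_less_eq)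
    moreover have "N > 0" using N by (metis not_gr_zero of_nat_0 not_less zero_le_power2)
    ultimately show False using bd[of N] by simp
  qed
  then show ?thesis
    using ell2_cmod_le_norm[OF bops_ell2[OF D ell2_single[OF h]]] by (auto simp: d_def fun_eq_iff)
qed

section \<open>Convolution projections in the algebra of a group\<close>

lemma zero_op_bops [simp]: "zero_op S \<in> bounded_ops S"
  by (rule bounded_opsI[where C = 0]) (auto simp: zero_op_def)

text \<open>The coefficients of a projection in the algebra of the group of integers: a self-adjoint idempotent
  for convolution.\<close>

definition proj_seq :: "(int \<Rightarrow> complex) \<Rightarrow> bool" where
  "proj_seq c \<longleftrightarrow> (\<forall>l. c (- l) = cnj (c l)) \<and> (\<forall>n. ((\<lambda>l. c l * c (n - l)) has_sum c n) UNIV)"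

context group
begin

lemma left_regular_apply:
  "f \<in> ell2 (carrier G) \<Longrightarrow>
    left_regular G g f = (\<lambda>h. if h \<in> carrier G then f (inv g \<otimes> h) else 0)"
  by (simp add: left_regular_def)

lemma
  assumes g: "g \<in> carrier G" and f: "f \<in> ell2 (carrier G)"
  shows left_regular_ell2: "left_regular G g f \<in> ell2 (carrier G)"
    and left_regular_norm_le: "ell2_norm (carrier G) (left_regular G g f) \<le> ell2_norm (carrier G) f"
proof -
  have le: "L2_set (\<lambda>x. cmod (left_regular G g f x)) F \<le> ell2_norm (carrier G) f"
    if F: "finite F" "F \<subseteq> carrier G" for F
  proof -
    have inj: "inj_on (\<lambda>x. inv g \<otimes> x) F"
      using g F by (intro inj_onI) (metis Units_eq Units_l_cancel inv_closed subsetD)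
    have "L2_set (\<lambda>x. cmod (left_regular G g f x)) F = L2_set (\<lambda>x. cmod (f (inv g \<otimes> x))) F"
      by (rule L2_set_cong) (use F f in \<open>auto simp: left_regular_apply\<close>)
    also have "\<dots> = L2_set (\<lambda>x. cmod (f x)) ((\<lambda>x. inv g \<otimes> x) ` F)"
      by (simp add: L2_set_def sum.reindex[OF inj])
    also have "\<dots> \<le> ell2_norm (carrier G) f"
      by (rule ell2_L2_set_le[OF f]) (use F g in auto)
    finally show ?thesis .
  qed
  show "left_regular G g f \<in> ell2 (carrier G)"
    "ell2_norm (carrier G) (left_regular G g f) \<le> ell2_norm (carrier G) f"
    using ell2_boundedI[where S = "carrier G" and f = "left_regular G g f", OF _ ell2_norm_nonneg le] f
    by (auto simp: left_regular_apply)
qed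

lemma left_regular_bops [simp]:
  assumes g: "g \<in> carrier G" shows "left_regular G g \<in> bounded_ops (carrier G)"
proof (rule bounded_opsI[where C = 1])
  show "left_regular G g \<in> extensional (ell2 (carrier G))" by (simp add: left_regular_def)
qed (use left_regular_ell2[OF g] left_regular_norm_le[OF g] in \<open>auto simp: left_regular_apply\<close>)

lemma left_regular_mult:
  assumes "g \<in> carrier G" "h \<in> carrier G" "f \<in> ell2 (carrier G)"
  shows "left_regular G g (left_regular G h f) = left_regular G (g \<otimes> h) f"
proof
  fix x
  show "left_regular G g (left_regular G h f) x = left_regular G (g \<otimes> h) f x"
    unfolding left_regular_apply[OF left_regular_ell2[OF assms(2,3)]] unfolding left_regular_apply[OF assms(3)]
    using assms by (simp add: inv_mult_group m_assoc)
qed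

lemma left_regular_one: "f \<in> ell2 (carrier G) \<Longrightarrow> left_regular G \<one> f = f"
  by (auto simp: left_regular_apply fun_eq_iff ell2_zero_off)

lemma left_regular_single:
  assumes "g \<in> carrier G" "h \<in> carrier G"
  shows "left_regular G g (single h) = single (g \<otimes> h)"
proof
  fix x
  have "inv g \<otimes> x = h \<longleftrightarrow> x = g \<otimes> h" if "x \<in> carrier G"
    using assms that by (metis inv_solve_left)
  then show "left_regular G g (single h) x = single (g \<otimes> h) x"
    unfolding left_regular_apply[OF ell2_single[OF assms(2)]] using assms by (auto simp: single_def)
qed

lemma commutes_left_regular_mult:
  assumes "T \<in> bounded_ops (carrier G)" "g \<in> carrier G" "h \<in> carrier G"
    "commutes (carrier G) T (left_regular G g)" "commutes (carrier G) T (left_regular G h)"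
  shows "commutes (carrier G) T (left_regular G (g \<otimes> h))"
  unfolding commutes_def
proof
  fix f assume f: "f \<in> ell2 (carrier G)"
  have "T (left_regular G (g \<otimes> h) f) = T (left_regular G g (left_regular G h f))"
    using assms f by (simp add: left_regular_mult)
  also have "\<dots> = left_regular G g (left_regular G h (T f))"
    using assms f by (simp add: commutesD left_regular_ell2)
  finally show "T (left_regular G (g \<otimes> h) f) = left_regular G (g \<otimes> h) (T f)"
    using assms f by (simp add: left_regular_mult bops_ell2)
qed

lemma commutes_left_regular_inv:
  assumes T: "T \<in> bounded_ops (carrier G)" and g: "g \<in> carrier G"
    and c: "commutes (carrier G) T (left_regular G g)"
  shows "commutes (carrier G) T (left_regular G (inv g))"
  unfolding commutes_def
proof
  fix f assume f: "f \<in> ell2 (carrier G)"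
  define f' where "f' = left_regular G (inv g) f"
  have f': "f' \<in> ell2 (carrier G)" using f g by (simp add: f'_def left_regular_ell2)
  have "left_regular G (inv g) (T (left_regular G g f')) = left_regular G (inv g) (left_regular G g (T f'))"
    using commutesD[OF c f'] by simp
  also have "\<dots> = T f'"
    using f' T g by (simp add: left_regular_mult left_regular_one bops_ell2)
  also have "left_regular G g f' = f"
    using f g by (simp add: f'_def left_regular_mult left_regular_one)
  finally show "T (left_regular G (inv g) f) = left_regular G (inv g) (T f)" by (simp add: f'_def)
qed

lemma commutes_left_regular_one:
  "T \<in> bounded_ops (carrier G) \<Longrightarrow> commutes (carrier G) T (left_regular G \<one>)"
  by (simp add: commutes_def left_regular_one bops_ell2)

text \<open>Homomorphisms from the integers replace the powers of a single group element: conjugates and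
  powers of such a subgroup are again described by an explicit function.\<close>

definition one_param :: "(int \<Rightarrow> 'a) \<Rightarrow> bool" where
  "one_param U \<longleftrightarrow> (\<forall>i. U i \<in> carrier G) \<and> (\<forall>i j. U (i + j) = U i \<otimes> U j)"

lemma one_param_closed [simp]: "one_param U \<Longrightarrow> U i \<in> carrier G"
  and one_param_add: "one_param U \<Longrightarrow> U (i + j) = U i \<otimes> U j"
  by (auto simp: one_param_def)

lemma one_param_zero: "one_param U \<Longrightarrow> U 0 = \<one>"
  using one_param_add[of U 0 0] by (simp add: one_param_def)

lemma one_param_minus: "one_param U \<Longrightarrow> U (- i) = inv (U i)"
  using one_param_add[of U "- i" i] by (simp add: one_param_zero inv_equality)

lemma one_param_cancel:
  assumes "one_param U" "x \<in> carrier G"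
  shows "U (- i) \<otimes> (U i \<otimes> x) = x" "U i \<otimes> (U (- i) \<otimes> x) = x"
  using assms one_param_add[of U "- i" i] one_param_add[of U i "- i"]
  by (simp_all add: m_assoc[symmetric] one_param_zero)

lemma commutes_one_param:
  assumes T: "T \<in> bounded_ops (carrier G)" and U: "one_param U"
    and c: "commutes (carrier G) T (left_regular G (U 1))"
  shows "commutes (carrier G) T (left_regular G (U l))"
proof (cases l rule: int_cases2)
  have *: "commutes (carrier G) T (left_regular G (U (int n)))" for n
  proof (induction n)
    case (Suc n)
    have "U (int (Suc n)) = U (int n) \<otimes> U 1"
      using one_param_add[OF U, of "int n" 1] by (simp add: add.commute)
    then show ?case using commutes_left_regular_mult[OF T _ _ Suc c] U by simp
  qed (use U T in \<open>simp add: one_param_zero commutes_left_regular_one\<close>)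
  {
    case (nonneg n)
    then show ?thesis using * by simp
  next
    case (nonpos n)
    then show ?thesis using commutes_left_regular_inv[OF T _ *[of n]] U by (simp add: one_param_minus)
  }
qed

text \<open>The matrix of the formal series \<open>\<Sum>l. c l \<cdot> U l\<close>. The Fourier coefficients of a proper arc are not absolutely
  summable, so the operator is defined by its matrix and not as a norm convergent series.\<close>

definition conv_kernel :: "(int \<Rightarrow> 'a) \<Rightarrow> (int \<Rightarrow> complex) \<Rightarrow> 'a \<Rightarrow> 'a \<Rightarrow> complex" where
  "conv_kernel U c x y = (if \<exists>l. x = U l \<otimes> y then c (THE l. x = U l \<otimes> y) else 0)"

definition conv_op :: "(int \<Rightarrow> 'a) \<Rightarrow> (int \<Rightarrow> complex) \<Rightarrow> 'a operator" where
  "conv_op U c = kernel_op (carrier G) (conv_kernel U c)"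

context
  fixes U :: "int \<Rightarrow> 'a"
  assumes U: "one_param U" and inj_U: "inj U"
begin

lemma orbit_inj: "y \<in> carrier G \<Longrightarrow> U l \<otimes> y = U l' \<otimes> y \<longleftrightarrow> l = l'"
  using U inj_U by (auto dest: injD)

lemma conv_kernel_eq [simp]: "y \<in> carrier G \<Longrightarrow> conv_kernel U c (U l \<otimes> y) y = c l"
  by (auto simp: conv_kernel_def orbit_inj)

lemma conv_kernel_zero: "(\<And>l. x \<noteq> U l \<otimes> y) \<Longrightarrow> conv_kernel U c x y = 0"
  by (auto simp: conv_kernel_def)

lemma conv_kernel_column_has_sum:
  assumes y: "y \<in> carrier G"
  shows "((\<lambda>x. conv_kernel U c x y * f x) has_sum s) (carrier G) \<longleftrightarrow>
    ((\<lambda>l. c l * f (U l \<otimes> y)) has_sum s) UNIV"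
proof -
  have "((\<lambda>x. conv_kernel U c x y * f x) has_sum s) (carrier G) \<longleftrightarrow>
      ((\<lambda>x. conv_kernel U c x y * f x) has_sum s) (range (\<lambda>l. U l \<otimes> y))"
    by (rule has_sum_cong_neutral) (use y U in \<open>auto simp: conv_kernel_def\<close>)
  also have "\<dots> \<longleftrightarrow> ((\<lambda>x. conv_kernel U c x y * f x) \<circ> (\<lambda>l. U l \<otimes> y) has_sum s) UNIV"
    by (rule has_sum_reindex) (use y in \<open>auto intro!: injI simp: orbit_inj\<close>)
  finally show ?thesis using y by (simp add: o_def)
qed

lemma conv_kernel_row_has_sum:
  assumes x: "x \<in> carrier G"
  shows "((\<lambda>y. conv_kernel U c x y * f y) has_sum s) (carrier G) \<longleftrightarrow>
    ((\<lambda>l. c l * f (U (- l) \<otimes> x)) has_sum s) UNIV"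
proof -
  have orbit: "x = U l \<otimes> y \<longleftrightarrow> y = U (- l) \<otimes> x" if "y \<in> carrier G" for l y
    using x U that one_param_cancel by metis
  have ker: "conv_kernel U c x (U (- l) \<otimes> x) = c l" for l
    using conv_kernel_eq[of "U (- l) \<otimes> x" c l] x U by (simp add: one_param_cancel)
  have "((\<lambda>y. conv_kernel U c x y * f y) has_sum s) (carrier G) \<longleftrightarrow>
      ((\<lambda>y. conv_kernel U c x y * f y) has_sum s) (range (\<lambda>l. U (- l) \<otimes> x))"
    by (rule has_sum_cong_neutral) (use x U orbit in \<open>auto intro!: conv_kernel_zero\<close>)
  also have "\<dots> \<longleftrightarrow> ((\<lambda>y. conv_kernel U c x y * f y) \<circ> (\<lambda>l. U (- l) \<otimes> x) has_sum s) UNIV"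
    by (rule has_sum_reindex) (use x in \<open>auto intro!: injI simp: orbit_inj\<close>)
  finally show ?thesis by (simp add: o_def ker)
qed

lemma conv_kernel_mult_has_sum:
  assumes cd: "\<And>n. ((\<lambda>l. c l * d (n - l)) has_sum e n) UNIV"
    and x: "x \<in> carrier G" and z: "z \<in> carrier G"
  shows "((\<lambda>y. conv_kernel U c x y * conv_kernel U d y z) has_sum conv_kernel U e x z) (carrier G)"
proof (cases "\<exists>n. x = U n \<otimes> z")
  case True
  then obtain n where n: "x = U n \<otimes> z" by blast
  have "U (- l) \<otimes> x = U (n - l) \<otimes> z" for l
    using one_param_add[OF U, of "- l" n] U z by (simp add: n m_assoc)
  then show ?thesis
    unfolding conv_kernel_row_has_sum[OF x] using cd[of n] z n by simp
next
  case False
  have "conv_kernel U d (U (- l) \<otimes> x) z = 0" for l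
  proof (rule conv_kernel_zero)
    fix l'
    show "U (- l) \<otimes> x \<noteq> U l' \<otimes> z"
    proof
      assume "U (- l) \<otimes> x = U l' \<otimes> z"
      then have "U l \<otimes> (U (- l) \<otimes> x) = U l \<otimes> (U l' \<otimes> z)" by simp
      then have "x = U (l + l') \<otimes> z"
        using U x z by (simp add: one_param_cancel one_param_add m_assoc)
      then show False using False by blast
    qed
  qed
  then show ?thesis
    unfolding conv_kernel_row_has_sum[OF x] using False by (simp add: conv_kernel_zero)
qed

lemma conv_kernel_projection:
  assumes c: "proj_seq c"
  shows "projection_kernel (carrier G) (conv_kernel U c)"
  unfolding projection_kernel_def
proof (intro conjI ballI)
  fix x y assume x: "x \<in> carrier G" and y: "y \<in> carrier G"
  show "conv_kernel U c y x = cnj (conv_kernel U c x y)"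
  proof (cases "\<exists>l. x = U l \<otimes> y")
    case True
    then obtain l where l: "x = U l \<otimes> y" by blast
    then have "y = U (- l) \<otimes> x" using U y by (simp add: one_param_cancel)
    then show ?thesis using conv_kernel_eq[OF x, of c "- l"] conv_kernel_eq[OF y, of c l] l c
      by (simp add: proj_seq_def)
  next
    case False
    moreover have "y \<noteq> U l \<otimes> x" for l
      using False[unfolded not_ex, rule_format, of "- l"] U x by (auto simp: one_param_cancel)
    ultimately show ?thesis by (simp add: conv_kernel_zero)
  qed
  show "((\<lambda>z. conv_kernel U c x z * conv_kernel U c z y) has_sum conv_kernel U c x y) (carrier G)"
    by (rule conv_kernel_mult_has_sum) (use c x y in \<open>auto simp: proj_seq_def\<close>)
qed

lemma conv_op_bops [simp]: "proj_seq c \<Longrightarrow> conv_op U c \<in> bounded_ops (carrier G)"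
  unfolding conv_op_def by (intro kernel_op_bops conv_kernel_projection)

lemma conv_op_projection: "proj_seq c \<Longrightarrow> is_projection (carrier G) (conv_op U c)"
  unfolding conv_op_def by (intro kernel_op_projection conv_kernel_projection)

lemma conv_op_norm_le:
  "proj_seq c \<Longrightarrow> f \<in> ell2 (carrier G) \<Longrightarrow> ell2_norm (carrier G) (conv_op U c f) \<le> ell2_norm (carrier G) f"
  unfolding conv_op_def by (intro kernel_op_norm_le conv_kernel_projection)

lemma conv_op_single:
  "proj_seq c \<Longrightarrow> h \<in> carrier G \<Longrightarrow>
    conv_op U c (single h) = (\<lambda>x. if x \<in> carrier G then conv_kernel U c x h else 0)"
  unfolding conv_op_def by (intro kernel_op_single conv_kernel_projection)

lemma conv_op_has_sum:
  assumes "proj_seq c" "f \<in> ell2 (carrier G)" "x \<in> carrier G"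
  shows "((\<lambda>l. c l * f (U (- l) \<otimes> x)) has_sum conv_op U c f x) UNIV"
  using kernel_op_has_sum[OF conv_kernel_projection[OF assms(1)] assms(2,3)]
  by (simp add: conv_kernel_row_has_sum[OF assms(3)] conv_op_def)

lemma conv_op_trace: "proj_seq c \<Longrightarrow> canonical_trace G (conv_op U c) = c 0"
proof -
  assume c: "proj_seq c"
  have "((\<lambda>x. conv_op U c (single \<one>) x * cnj (single \<one> x)) has_sum c 0) {\<one>}"
    using conv_kernel_eq[of \<one> c 0] U
    by (intro has_sum_finiteI) (simp_all add: conv_op_single[OF c] one_param_zero, simp add: single_def one_param_zero)
  then have "((\<lambda>x. conv_op U c (single \<one>) x * cnj (single \<one> x)) has_sum c 0) (carrier G)"
    by (rule has_sum_cong_neutral[THEN iffD1, rotated -1]) (auto simp: single_def)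
  then show ?thesis
    by (simp add: canonical_trace_def ell2_inner_def single_def[symmetric] infsumI)
qed

text \<open>Both composites have the entries \<open>\<Sum>l. c l \<cdot> T (single h) (U (- l) \<otimes> x)\<close>. The comparison of single entries
  replaces an appeal to weak limits of the partial sums.\<close>

lemma commutes_conv_op:
  assumes T: "T \<in> bounded_ops (carrier G)" and c: "proj_seq c"
    and comm: "\<And>l. commutes (carrier G) T (left_regular G (U l))"
  shows "commutes (carrier G) T (conv_op U c)"
  unfolding compose_commute_iff[symmetric]
proof (rule bops_eqI)
  fix h x assume h: "h \<in> carrier G" and x: "x \<in> carrier G"
  have "((\<lambda>y. conv_op U c (single h) y * T (single y) x) has_sum T (conv_op U c (single h)) x) (carrier G)"
    by (rule bops_has_sum[OF T bops_ell2[OF conv_op_bops[OF c] ell2_single[OF h]]])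
  then have "((\<lambda>y. conv_kernel U c y h * T (single y) x) has_sum T (conv_op U c (single h)) x) (carrier G)"
    by (rule has_sum_cong[THEN iffD1, rotated]) (use h in \<open>simp add: conv_op_single[OF c]\<close>)
  then have "((\<lambda>l. c l * T (single (U l \<otimes> h)) x) has_sum T (conv_op U c (single h)) x) UNIV"
    unfolding conv_kernel_column_has_sum[OF h] .
  moreover have "T (single (U l \<otimes> h)) x = T (single h) (U (- l) \<otimes> x)" for l
  proof -
    have "T (single (U l \<otimes> h)) = T (left_regular G (U l) (single h))"
      using U h by (simp add: left_regular_single)
    also have "\<dots> = left_regular G (U l) (T (single h))"
      by (rule commutesD[OF comm]) (use h in auto)
    finally show ?thesis
      using h x U T by (simp add: left_regular_apply bops_ell2 one_param_minus)
  qed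
  ultimately have "((\<lambda>l. c l * T (single h) (U (- l) \<otimes> x)) has_sum T (conv_op U c (single h)) x) UNIV"
    by simp
  moreover have "((\<lambda>l. c l * T (single h) (U (- l) \<otimes> x)) has_sum conv_op U c (T (single h)) x) UNIV"
    by (rule conv_op_has_sum[OF c bops_ell2[OF T ell2_single[OF h]] x])
  ultimately show "compose (ell2 (carrier G)) T (conv_op U c) (single h) x
      = compose (ell2 (carrier G)) (conv_op U c) T (single h) x"
    using h has_sum_unique by (fastforce simp: compose_def)
qed (use T c in auto)

lemma conv_op_mult_zero:
  assumes c: "proj_seq c" and d: "proj_seq d" and cd: "\<And>n. ((\<lambda>l. c l * d (n - l)) has_sum 0) UNIV"
  shows "compose (ell2 (carrier G)) (conv_op U c) (conv_op U d) = zero_op (carrier G)"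
proof (rule bops_eqI)
  fix h x assume h: "h \<in> carrier G" and x: "x \<in> carrier G"
  have "((\<lambda>l. c l * conv_op U d (single h) (U (- l) \<otimes> x)) has_sum conv_op U c (conv_op U d (single h)) x) UNIV"
    by (rule conv_op_has_sum[OF c bops_ell2[OF conv_op_bops[OF d] ell2_single[OF h]] x])
  then have "((\<lambda>l. c l * conv_kernel U d (U (- l) \<otimes> x) h) has_sum conv_op U c (conv_op U d (single h)) x) UNIV"
    using U x h by (simp add: conv_op_single[OF d])
  moreover have "((\<lambda>l. c l * conv_kernel U d (U (- l) \<otimes> x) h) has_sum conv_kernel U (\<lambda>_. 0) x h) UNIV"
    using conv_kernel_mult_has_sum[OF cd x h] unfolding conv_kernel_row_has_sum[OF x] .
  moreover have "conv_kernel U (\<lambda>_. 0) x h = 0" by (simp add: conv_kernel_def)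
  ultimately show "compose (ell2 (carrier G)) (conv_op U c) (conv_op U d) (single h) x = zero_op (carrier G) (single h) x"
    using h has_sum_unique by (fastforce simp: compose_def zero_op_def)
qed (use c d in auto)

lemma conv_op_sum_eq_id:
  assumes c: "\<And>i. i \<in> I \<Longrightarrow> proj_seq (c i)"
    and sum: "\<And>l. (\<Sum>i\<in>I. c i l) = (if l = 0 then 1 else 0)"
    and f: "f \<in> ell2 (carrier G)"
  shows "(\<lambda>x. \<Sum>i\<in>I. conv_op U (c i) f x) = f"
proof -
  have "op_sum (carrier G) I (\<lambda>_. 1) (\<lambda>i. conv_op U (c i)) = left_regular G \<one>"
  proof (rule bops_eqI)
    fix h x assume h: "h \<in> carrier G" and x: "x \<in> carrier G"
    have "(\<Sum>i\<in>I. conv_op U (c i) (single h) x) = (\<Sum>i\<in>I. conv_kernel U (c i) x h)"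
      by (rule sum.cong) (use c h x in \<open>auto simp: conv_op_single\<close>)
    also have "\<dots> = single h x"
    proof (cases "\<exists>l. x = U l \<otimes> h")
      case True
      then obtain l where l: "x = U l \<otimes> h" by blast
      have "x = h \<longleftrightarrow> l = 0"
        using orbit_inj[OF h, of l 0] U h l by (simp add: one_param_zero)
      then show ?thesis using sum[of l] h l by (simp add: single_def)
    next
      case False
      then have "x \<noteq> h" using U h one_param_zero by (metis l_one)
      then show ?thesis using False by (simp add: conv_kernel_zero single_def)
    qed
    finally show "op_sum (carrier G) I (\<lambda>_. 1) (\<lambda>i. conv_op U (c i)) (single h) x = left_regular G \<one> (single h) x"
      using h by (simp add: op_sum_apply left_regular_one)
  qed (use c in auto)
  then have "op_sum (carrier G) I (\<lambda>_. 1) (\<lambda>i. conv_op U (c i)) f = f"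
    using left_regular_one[OF f] by simp
  then show ?thesis by (simp add: op_sum_apply[OF f])
qed

end

end

section \<open>Commutation passes along commuting pairs\<close>

lemma ell2_norm_single: "h \<in> S \<Longrightarrow> ell2_norm S (single h) = 1"
proof -
  assume h: "h \<in> S"
  have "((\<lambda>x. (cmod (single h x))\<^sup>2) has_sum 1) {h}" by (rule has_sum_finiteI) (auto simp: single_def)
  then have "((\<lambda>x. (cmod (single h x))\<^sup>2) has_sum 1) S"
    by (rule has_sum_cong_neutral[THEN iffD1, rotated -1]) (use h in \<open>auto simp: single_def\<close>)
  then show ?thesis by (simp add: ell2_norm_def infsumI)
qed

context group
begin

text \<open>Let \<open>P\<close> be the projection \<open>conv_op U c\<close>. The vectors \<open>f\<^sub>m P f\<^sub>m\<inverse> \<delta>\<^sub>h\<close> have the form \<open>c\<^sub>0 \<delta>\<^sub>h + r\<^sub>m\<close>, where \<open>r\<^sub>m\<close> is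
  supported on the translate by \<open>h\<close> of the nontrivial elements of the conjugate of \<open>U\<close> under \<open>f\<^sub>m\<close>.
  The supports for different \<open>m\<close> are disjoint, so \<open>\<delta>\<^sub>h\<close> is a limit of combinations of these vectors.\<close>

lemma conv_op_section_annihilates:
  assumes U: "one_param U" and inj_U: "inj U" and c: "proj_seq c" and c0: "c 0 \<noteq> 0"
    and f: "\<And>m::nat. f m \<in> carrier G"
    and disj: "\<And>m m' l l'. m < m' \<Longrightarrow> f m \<otimes> U l \<otimes> inv (f m) = f m' \<otimes> U l' \<otimes> inv (f m') \<Longrightarrow> l' = 0"
    and B: "B \<in> bounded_ops (carrier G)"
    and kill: "\<And>m \<zeta>. \<zeta> \<in> ell2 (carrier G) \<Longrightarrow> B (left_regular G (f m) (conv_op U c \<zeta>)) = (\<lambda>x. 0)"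
  shows "B = zero_op (carrier G)"
proof (rule bops_eqI[OF B zero_op_bops])
  fix h x assume h: "h \<in> carrier G"
  define v where "v m = left_regular G (f m) (conv_op U c (single (inv (f m) \<otimes> h)))" for m
  define r where "r m = (\<lambda>x. v m x - c 0 * single h x)" for m
  have fh: "inv (f m) \<otimes> h \<in> carrier G" for m using f h by simp
  have w: "conv_op U c (single (inv (f m) \<otimes> h)) \<in> ell2 (carrier G)" for m
    by (rule bops_ell2[OF conv_op_bops[OF U inj_U c] ell2_single[OF fh]])
  have v: "v m \<in> ell2 (carrier G)" for m
    unfolding v_def by (rule left_regular_ell2[OF f w])
  have norm_v: "ell2_norm (carrier G) (v m) \<le> 1" for m
    unfolding v_def ell2_norm_single[OF fh, of m, symmetric]
    by (rule order_trans[OF left_regular_norm_le[OF f w] conv_op_norm_le[OF U inj_U c ell2_single[OF fh]]])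
  have v_eq: "v m x = conv_kernel U c (inv (f m) \<otimes> x) (inv (f m) \<otimes> h)" if "x \<in> carrier G" for m x
    unfolding v_def left_regular_apply[OF w] using that f
    by (simp add: conv_op_single[OF U inj_U c fh])
  have supp: "\<exists>l. l \<noteq> 0 \<and> x = f m \<otimes> U l \<otimes> inv (f m) \<otimes> h" if nz: "r m x \<noteq> 0" for m x
  proof -
    have x: "x \<in> carrier G"
      using nz h ell2_zero_off[OF v, of x m] by (cases "x = h") (auto simp: r_def single_def)
    have conj0: "f m \<otimes> U 0 \<otimes> inv (f m) \<otimes> h = h"
      using U f h by (simp add: one_param_zero)
    show ?thesis
    proof (cases "\<exists>l. inv (f m) \<otimes> x = U l \<otimes> (inv (f m) \<otimes> h)")
      case True
      then obtain l where l: "inv (f m) \<otimes> x = U l \<otimes> (inv (f m) \<otimes> h)" by blast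
      then have "f m \<otimes> (inv (f m) \<otimes> x) = f m \<otimes> (U l \<otimes> (inv (f m) \<otimes> h))" by simp
      then have xl: "x = f m \<otimes> U l \<otimes> inv (f m) \<otimes> h"
        using x f h U by (simp add: m_assoc[symmetric])
      have "l \<noteq> 0"
      proof
        assume "l = 0"
        then have "x = h" "v m x = c 0"
          using xl conj0 v_eq[OF x, of m] unfolding l by (simp_all add: conv_kernel_eq[OF U inj_U fh])
        then show False using nz by (simp add: r_def single_def)
      qed
      then show ?thesis using xl by blast
    next
      case False
      then have "v m x = 0" using v_eq[OF x] by (simp add: conv_kernel_def)
      moreover have "x \<noteq> h"
        using False U fh[of m] one_param_zero[OF U] by (metis l_one)
      ultimately show ?thesis using nz by (simp add: r_def single_def)
    qed
  qed
  have "B (single h) = (\<lambda>x. 0)"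
  proof (rule disjoint_perturbations_annihilate[OF B h c0])
    show "r m \<in> ell2 (carrier G)" for m
      unfolding r_def by (intro ell2_diff v ell2_cmult ell2_single h)
    show "ell2_norm (carrier G) (r m) \<le> 1 + cmod (c 0)" for m
    proof -
      have "ell2_norm (carrier G) (\<lambda>x. v m x + (- c 0) * single h x)
          \<le> ell2_norm (carrier G) (v m) + ell2_norm (carrier G) (\<lambda>x. (- c 0) * single h x)"
        by (intro ell2_norm_triangle v ell2_cmult ell2_single h)
      also have "\<dots> \<le> 1 + cmod (c 0)"
        using norm_v[of m] h unfolding ell2_norm_cmult by (simp add: ell2_norm_single)
      finally show ?thesis by (simp add: r_def)
    qed
    show "r m x = 0" if mm: "m < m'" and nz: "r m' x \<noteq> 0" for m m' x
    proof (rule ccontr)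
      assume "r m x \<noteq> 0"
      then obtain l where l: "x = f m \<otimes> U l \<otimes> inv (f m) \<otimes> h" using supp by blast
      obtain l' where l': "l' \<noteq> 0" "x = f m' \<otimes> U l' \<otimes> inv (f m') \<otimes> h" using supp[OF nz] by blast
      have "f m \<otimes> U l \<otimes> inv (f m) = f m' \<otimes> U l' \<otimes> inv (f m')"
        using l l'(2) right_cancel[of h] h f U by simp
      then show False using disj[OF mm] l'(1) by blast
    qed
    show "B (\<lambda>x. c 0 * single h x + r m x) = (\<lambda>x. 0)" for m
      using kill[OF ell2_single[OF fh], of m m] by (simp add: r_def v_def)
  qed
  then show "B (single h) x = zero_op (carrier G) (single h) x"
    using h by (simp add: zero_op_def)
qed

text \<open>If \<open>g\<close> commutes with all \<open>f m\<close>, then the commutator of \<open>T\<close> with \<open>g\<close> vanishes on the ranges of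
  the operators \<open>Q f\<^sub>m P\<close>, where \<open>P\<close> is the projection \<open>conv_op U c\<close>. By the preceding lemma these ranges
  span a dense subspace of the range of \<open>Q\<close>. Hence a corner \<open>g P\<close> suffices to recover \<open>g\<close>.\<close>

lemma commutes_from_corner:
  assumes U: "one_param U" and inj_U: "inj U" and c: "proj_seq c" and c0: "c 0 \<noteq> 0"
    and f: "\<And>m::nat. f m \<in> carrier G"
    and disj: "\<And>m m' l l'. m < m' \<Longrightarrow> f m \<otimes> U l \<otimes> inv (f m) = f m' \<otimes> U l' \<otimes> inv (f m') \<Longrightarrow> l' = 0"
    and g: "g \<in> carrier G" and gf: "\<And>m. g \<otimes> f m = f m \<otimes> g"
    and Q: "Q \<in> bounded_ops (carrier G)" and Qg: "commutes (carrier G) Q (left_regular G g)"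
    and T: "T \<in> bounded_ops (carrier G)"
    and TP: "commutes (carrier G) T (conv_op U c)"
    and TgP: "commutes (carrier G) T (compose (ell2 (carrier G)) (left_regular G g) (conv_op U c))"
    and TQf: "\<And>m. commutes (carrier G) T (compose (ell2 (carrier G)) Q (left_regular G (f m)))"
    and xi: "\<xi> \<in> ell2 (carrier G)"
  shows "T (left_regular G g (Q \<xi>)) = left_regular G g (T (Q \<xi>))"
proof -
  let ?S = "carrier G" and ?l = "left_regular G"
  \<comment> \<open>The commutator of \<open>T\<close> and \<open>g\<close>, composed with \<open>Q\<close>.\<close>
  define B where "B = op_sum ?S (UNIV :: bool set) (\<lambda>b. if b then 1 else - 1)
    (\<lambda>b. if b then compose (ell2 ?S) T (compose (ell2 ?S) (?l g) Q)
          else compose (ell2 ?S) (?l g) (compose (ell2 ?S) T Q))"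
  have B: "B \<in> bounded_ops ?S"
    unfolding B_def using T g Q by auto
  have B_eq: "B \<zeta> = (\<lambda>x. T (?l g (Q \<zeta>)) x - ?l g (T (Q \<zeta>)) x)" if "\<zeta> \<in> ell2 ?S" for \<zeta>
    using that by (simp add: B_def op_sum_apply UNIV_bool compose_def)
  have "B = zero_op ?S"
  proof (rule conv_op_section_annihilates[OF U inj_U c c0 f disj B])
    fix m \<zeta> assume z: "\<zeta> \<in> ell2 ?S"
    define P where "P = conv_op U c"
    have Pz: "P \<xi> \<in> ell2 ?S" if "\<xi> \<in> ell2 ?S" for \<xi>
      unfolding P_def using that by (rule bops_ell2[OF conv_op_bops[OF U inj_U c]])
    have Tz: "T \<zeta> \<in> ell2 ?S" by (rule bops_ell2[OF T z])
    have gQf: "?l g (Q (?l (f m) \<xi>)) = Q (?l (f m) (?l g \<xi>))" if xi: "\<xi> \<in> ell2 ?S" for \<xi>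
    proof -
      have "?l g (Q (?l (f m) \<xi>)) = Q (?l g (?l (f m) \<xi>))"
        using commutesD[OF Qg left_regular_ell2[OF f xi]] by simp
      also have "?l g (?l (f m) \<xi>) = ?l (f m) (?l g \<xi>)"
        using xi f g gf by (simp add: left_regular_mult)
      finally show ?thesis .
    qed
    have TQ: "T (Q (?l (f m) \<xi>)) = Q (?l (f m) (T \<xi>))" if "\<xi> \<in> ell2 ?S" for \<xi>
      using commutesD[OF TQf[of m] that] that bops_ell2[OF T that] by (simp add: compose_def)
    have "T (?l g (Q (?l (f m) (P \<zeta>)))) = T (Q (?l (f m) (?l g (P \<zeta>))))"
      using gQf[OF Pz[OF z]] by simp
    also have "\<dots> = Q (?l (f m) (T (?l g (P \<zeta>))))"
      by (rule TQ[OF left_regular_ell2[OF g Pz[OF z]]])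
    also have "T (?l g (P \<zeta>)) = ?l g (P (T \<zeta>))"
      using commutesD[OF TgP z] z Tz by (simp add: compose_def P_def)
    also have "Q (?l (f m) (?l g (P (T \<zeta>)))) = ?l g (Q (?l (f m) (P (T \<zeta>))))"
      using gQf[OF Pz[OF Tz]] by simp
    also have "P (T \<zeta>) = T (P \<zeta>)"
      using commutesD[OF TP z] by (simp add: P_def)
    also have "Q (?l (f m) (T (P \<zeta>))) = T (Q (?l (f m) (P \<zeta>)))"
      using TQ[OF Pz[OF z]] by simp
    finally show "B (?l (f m) (conv_op U c \<zeta>)) = (\<lambda>x. 0)"
      using B_eq[OF left_regular_ell2[OF f Pz[OF z]]] by (simp add: P_def)
  qed
  then have "B \<xi> = (\<lambda>x. 0)" using xi by (simp add: zero_op_def)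
  then show ?thesis using B_eq[OF xi] by (auto simp: fun_eq_iff)
qed

section \<open>Vanishing of a triple product\<close>

text \<open>Applied to \<open>\<delta>\<^sub>h\<close>, the product is supported on the points \<open>W j i = V j \<otimes> t \<otimes> U i \<otimes> h\<close>, and multiplication by
  \<open>U l\<close> shifts \<open>(j, i)\<close> by \<open>(n l, l)\<close>. The coefficient at \<open>W j i\<close> is therefore the series that is assumed
  to vanish.\<close>

lemma conv_op_triple_product_zero:
  assumes U: "one_param U" and V: "one_param V" and t: "t \<in> carrier G"
    and UV: "\<And>i j. U i \<otimes> V j = V j \<otimes> U i"
    and Vt: "\<And>j. V j \<otimes> t = t \<otimes> V j"
    and Ut: "\<And>l. U l \<otimes> t = t \<otimes> U l \<otimes> V (n * l)"
    and inj: "\<And>i j i' j'. V j \<otimes> U i = V j' \<otimes> U i' \<Longrightarrow> j = j' \<and> i = i'"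
    and a: "proj_seq a" and b: "proj_seq b" and q: "proj_seq q"
    and zero: "\<And>i j. ((\<lambda>l. b l * (a (i - l) * q (j - n * l))) has_sum 0) UNIV"
    and f: "f \<in> ell2 (carrier G)"
  shows "conv_op U b (conv_op V q (left_regular G t (conv_op U a f))) = (\<lambda>x. 0)"
proof -
  let ?S = "carrier G" and ?l = "left_regular G"
  have injU: "inj U" using inj[of 0 _ 0] by (auto intro!: injI)
  have injV: "inj V" using inj[of _ 0 _ 0] by (auto intro!: injI)
  note Pa = conv_op_bops[OF U injU a] and Pb = conv_op_bops[OF U injU b] and Pq = conv_op_bops[OF V injV q]
  have cU [simp]: "U i \<in> ?S" and cV [simp]: "V i \<in> ?S" for i using U V by simp_all
  note t [simp]
  let ?A = "compose (ell2 ?S) (conv_op U b) (compose (ell2 ?S) (conv_op V q)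
      (compose (ell2 ?S) (?l t) (conv_op U a)))"
  have "?A = zero_op ?S"
  proof (rule bops_eqI)
    fix h x assume h [simp]: "h \<in> ?S" and x [simp]: "x \<in> ?S"
    define W where "W j i = V j \<otimes> (t \<otimes> (U i \<otimes> h))" for j i
    have W [simp]: "W j i \<in> ?S" for j i by (simp add: W_def)
    have UV': "U i \<otimes> (V j \<otimes> z) = V j \<otimes> (U i \<otimes> z)" if "z \<in> ?S" for i j z
      using UV[of i j] that by (metis cU cV m_assoc)
    have Vt': "V j \<otimes> (t \<otimes> z) = t \<otimes> (V j \<otimes> z)" if "z \<in> ?S" for j z
      using Vt[of j] that by (metis t cV m_assoc)
    have Ut': "U l \<otimes> (t \<otimes> z) = t \<otimes> (U l \<otimes> (V (n * l) \<otimes> z))" if "z \<in> ?S" for l z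
      using Ut[of l] that by (metis t cV cU m_assoc m_closed)
    have VV': "V j \<otimes> (V j' \<otimes> z) = V (j + j') \<otimes> z" if "z \<in> ?S" for j j' z
      using that by (simp add: one_param_add[OF V] m_assoc)
    have UU': "U j \<otimes> (U j' \<otimes> z) = U (j + j') \<otimes> z" if "z \<in> ?S" for j j' z
      using that by (simp add: one_param_add[OF U] m_assoc)
    have V0: "V 0 \<otimes> z = z" if "z \<in> ?S" for z
      using that by (simp add: one_param_zero[OF V])
    have inv_t: "inv t \<otimes> (t \<otimes> z) = z" "t \<otimes> (inv t \<otimes> z) = z" if "z \<in> ?S" for z
      using that by (simp_all add: m_assoc[symmetric])
    have VW: "V j' \<otimes> W j i = W (j' + j) i" for j' j i
      unfolding W_def by (rule VV') simp
    have UW: "U l \<otimes> W j i = W (j + n * l) (i + l)" for l j i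
    proof -
      have "U l \<otimes> W j i = V j \<otimes> (t \<otimes> (U l \<otimes> (V (n * l) \<otimes> (U i \<otimes> h))))"
        unfolding W_def by (subst UV', simp, subst Ut', simp_all)
      also have "\<dots> = V j \<otimes> (V (n * l) \<otimes> (t \<otimes> (U (l + i) \<otimes> h)))"
        by (subst UV', simp, subst Vt', simp_all add: UU')
      finally show ?thesis by (simp add: W_def VV' add.commute)
    qed
    have W_inj: "j = j' \<and> i = i'" if eq: "W j i = W j' i'" for j i j' i'
    proof -
      have "t \<otimes> (V j \<otimes> (U i \<otimes> h)) = t \<otimes> (V j' \<otimes> (U i' \<otimes> h))"
        using eq unfolding W_def by (simp only: Vt' m_closed cU h)
      then have "V j \<otimes> (U i \<otimes> h) = V j' \<otimes> (U i' \<otimes> h)" by (metis inv_t(1) cU cV h m_closed)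
      then have "(V j \<otimes> U i) \<otimes> h = (V j' \<otimes> U i') \<otimes> h" by (simp only: m_assoc cU cV h)
      then have "V j \<otimes> U i = V j' \<otimes> U i'" by simp
      then show ?thesis by (rule inj)
    qed
    define \<rho> where "\<rho> = ?l t (conv_op U a (single h))"
    define \<eta> where "\<eta> = conv_op V q \<rho>"
    have Ph: "conv_op U a (single h) \<in> ell2 ?S" by (rule bops_ell2[OF Pa ell2_single[OF h]])
    have rho: "\<rho> \<in> ell2 ?S" unfolding \<rho>_def by (rule left_regular_ell2[OF t Ph])
    have eta: "\<eta> \<in> ell2 ?S" unfolding \<eta>_def by (rule bops_ell2[OF Pq rho])
    have rho_eq: "\<rho> y = conv_kernel U a (inv t \<otimes> y) h" if "y \<in> ?S" for y
      unfolding \<rho>_def left_regular_apply[OF Ph] using that by (simp add: conv_op_single[OF U injU a h])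
    have rho_W: "\<rho> (W j i) = (if j = 0 then a i else 0)" for j i
    proof (cases "j = 0")
      case True
      have "inv t \<otimes> W 0 i = U i \<otimes> h"
        by (simp add: W_def V0 inv_t)
      then show ?thesis using True by (simp add: rho_eq conv_kernel_eq[OF U injU])
    next
      case False
      have "inv t \<otimes> W j i \<noteq> U i' \<otimes> h" for i'
      proof
        assume "inv t \<otimes> W j i = U i' \<otimes> h"
        then have "t \<otimes> (inv t \<otimes> W j i) = t \<otimes> (U i' \<otimes> h)" by simp
        then have "W j i = W 0 i'"
          using inv_t(2)[OF W, of j i] by (simp add: V0 W_def[of 0])
        then show False using W_inj False by blast
      qed
      then show ?thesis using False by (simp add: rho_eq conv_kernel_zero[OF U injU])
    qed
    have rho_off: "\<rho> y = 0" if y: "y \<in> ?S" "\<And>i. y \<noteq> W 0 i" for y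
    proof -
      have "inv t \<otimes> y \<noteq> U i \<otimes> h" for i
      proof
        assume "inv t \<otimes> y = U i \<otimes> h"
        then have "t \<otimes> (inv t \<otimes> y) = t \<otimes> (U i \<otimes> h)" by simp
        then have "y = W 0 i"
          using inv_t(2)[OF y(1)] by (simp add: V0 W_def)
        then show False using y(2) by blast
      qed
      then show ?thesis using y by (simp add: rho_eq conv_kernel_zero[OF U injU])
    qed
    have eta_W: "\<eta> (W j i) = q j * a i" for j i
    proof -
      have "((\<lambda>k. q k * \<rho> (V (- k) \<otimes> W j i)) has_sum \<eta> (W j i)) UNIV"
        unfolding \<eta>_def by (rule conv_op_has_sum[OF V injV q rho W])
      then have "((\<lambda>k. if k = j then q j * a i else 0) has_sum \<eta> (W j i)) UNIV"
        by (rule has_sum_cong[THEN iffD1, rotated]) (auto simp: VW rho_W)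
      moreover have "((\<lambda>k. if k = j then q j * a i else 0) has_sum (q j * a i)) UNIV"
        by (rule has_sum_finite_neutralI[of "{j}"]) auto
      ultimately show ?thesis using has_sum_unique by blast
    qed
    have eta_off: "\<eta> y = 0" if y: "y \<in> ?S" "\<And>j i. y \<noteq> W j i" for y
    proof -
      have "\<rho> (V (- k) \<otimes> y) = 0" for k
      proof (rule rho_off)
        fix i
        show "V (- k) \<otimes> y \<noteq> W 0 i"
        proof
          assume "V (- k) \<otimes> y = W 0 i"
          then have "V k \<otimes> (V (- k) \<otimes> y) = W k i" by (simp add: VW)
          then have "y = W k i" using one_param_cancel(2)[OF V y(1), of k] by simp
          then show False using y(2) by blast
        qed
      qed (rule m_closed[OF cV y(1)])
      then have "((\<lambda>k::int. 0) has_sum \<eta> y) UNIV"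
        using conv_op_has_sum[OF V injV q rho y(1), folded \<eta>_def] by simp
      from infsumI[OF this] show ?thesis by simp
    qed
    have s: "((\<lambda>l. b l * \<eta> (U (- l) \<otimes> x)) has_sum conv_op U b \<eta> x) UNIV"
      by (rule conv_op_has_sum[OF U injU b eta x])
    have "conv_op U b \<eta> x = 0"
    proof (cases "\<exists>j i. x = W j i")
      case True
      then obtain j i where x': "x = W j i" by blast
      have "\<eta> (U (- l) \<otimes> x) = a (i - l) * q (j - n * l)" for l
        by (simp add: x' UW eta_W)
      then have "((\<lambda>l. b l * (a (i - l) * q (j - n * l))) has_sum conv_op U b \<eta> x) UNIV" using s by simp
      then show ?thesis using zero[of i j] by (rule has_sum_unique)
    next
      case False
      have "\<eta> (U (- l) \<otimes> x) = 0" for l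
      proof (rule eta_off)
        fix j i
        show "U (- l) \<otimes> x \<noteq> W j i"
        proof
          assume "U (- l) \<otimes> x = W j i"
          then have "U l \<otimes> (U (- l) \<otimes> x) = W (j + n * l) (i + l)" by (simp add: UW)
          then have "x = W (j + n * l) (i + l)" using one_param_cancel(2)[OF U x, of l] by simp
          then show False using False by blast
        qed
      qed (rule m_closed[OF cU x])
      then have "((\<lambda>l::int. 0) has_sum conv_op U b \<eta> x) UNIV" using s by simp
      from infsumI[OF this] show ?thesis by simp
    qed
    then show "?A (single h) x = zero_op ?S (single h) x"
      by (simp add: compose_def zero_op_def \<eta>_def \<rho>_def)
  qed (use Pa Pb Pq in auto)
  then have "?A f = zero_op ?S f" by simp
  then show ?thesis using f by (simp add: compose_def zero_op_def)
qed

end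

section \<open>Two self-adjoint generators from elements of finite order\<close>

lemma is_adjoint_op_sum:
  assumes A: "\<And>i. i \<in> I \<Longrightarrow> A i \<in> bounded_ops S" and B: "\<And>i. i \<in> I \<Longrightarrow> B i \<in> bounded_ops S"
    and adj: "\<And>i. i \<in> I \<Longrightarrow> is_adjoint S (A i) (B i)"
  shows "is_adjoint S (op_sum S I c A) (op_sum S I (\<lambda>i. cnj (c i)) B)"
  unfolding is_adjoint_def
proof (intro ballI)
  fix f g assume f: "f \<in> ell2 S" and g: "g \<in> ell2 S"
  have "((\<lambda>x. \<Sum>i\<in>I. c i * (A i f x * cnj (g x))) has_sum (\<Sum>i\<in>I. c i * ell2_inner S (A i f) g)) S"
    by (intro has_sum_sum_finite has_sum_cmult_right ell2_inner_has_sum bops_ell2[OF A] f g)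
  then have 1: "ell2_inner S (op_sum S I c A f) g = (\<Sum>i\<in>I. c i * ell2_inner S (A i f) g)"
    by (simp add: ell2_inner_def op_sum_apply[OF f] sum_distrib_right mult.assoc infsumI)
  have "((\<lambda>x. \<Sum>i\<in>I. c i * (f x * cnj (B i g x))) has_sum (\<Sum>i\<in>I. c i * ell2_inner S f (B i g))) S"
    by (intro has_sum_sum_finite has_sum_cmult_right ell2_inner_has_sum bops_ell2[OF B] f g)
  then have 2: "ell2_inner S f (op_sum S I (\<lambda>i. cnj (c i)) B g) = (\<Sum>i\<in>I. c i * ell2_inner S f (B i g))"
    by (simp add: ell2_inner_def op_sum_apply[OF g] sum_distrib_left mult.left_commute infsumI)
  show "ell2_inner S (op_sum S I c A f) g = ell2_inner S f (op_sum S I (\<lambda>i. cnj (c i)) B g)"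
    unfolding 1 2 using adj f g by (intro sum.cong refl) (simp add: is_adjoint_def)
qed

context group
begin

lemma left_regular_adjoint:
  assumes g: "g \<in> carrier G"
  shows "is_adjoint (carrier G) (left_regular G g) (left_regular G (inv g))"
  unfolding is_adjoint_def
proof (intro ballI)
  fix f h assume f: "f \<in> ell2 (carrier G)" and h: "h \<in> ell2 (carrier G)"
  have bij: "bij_betw (\<lambda>x. g \<otimes> x) (carrier G) (carrier G)"
    by (rule bij_betw_byWitness[where f' = "\<lambda>x. inv g \<otimes> x"]) (use g in \<open>auto simp: m_assoc[symmetric]\<close>)
  have "ell2_inner (carrier G) (left_regular G g f) h
      = (\<Sum>\<^sub>\<infinity>x\<in>carrier G. f (inv g \<otimes> x) * cnj (h x))"
    unfolding ell2_inner_def by (rule infsum_cong) (simp add: left_regular_apply f)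
  also have "\<dots> = (\<Sum>\<^sub>\<infinity>x\<in>carrier G. f (inv g \<otimes> (g \<otimes> x)) * cnj (h (g \<otimes> x)))"
    by (rule infsum_reindex_bij_betw[OF bij, symmetric])
  also have "\<dots> = ell2_inner (carrier G) f (left_regular G (inv g) h)"
    unfolding ell2_inner_def
    by (rule infsum_cong) (use g in \<open>simp add: left_regular_apply[OF h] m_assoc[symmetric]\<close>)
  finally show "ell2_inner (carrier G) (left_regular G g f) h = ell2_inner (carrier G) f (left_regular G (inv g) h)" .
qed

lemma commuting_subgroup:
  assumes T: "T \<in> bounded_ops (carrier G)"
  shows "subgroup {g \<in> carrier G. commutes (carrier G) T (left_regular G g)} G"
  by (rule subgroup.intro)
    (use T in \<open>auto intro: commutes_left_regular_mult commutes_left_regular_inv commutes_left_regular_one\<close>)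

lemma in_group_vnaI:
  assumes "A \<in> bounded_ops (carrier G)"
    and "\<And>T. T \<in> bounded_ops (carrier G) \<Longrightarrow>
      (\<And>g. g \<in> carrier G \<Longrightarrow> commutes (carrier G) T (left_regular G g)) \<Longrightarrow> commutes (carrier G) T A"
  shows "A \<in> group_vna G"
  unfolding group_vna_def by (rule in_vN_generatedI) (use assms in auto)

lemma group_vna_generatedI:
  assumes "Xs \<subseteq> group_vna G"
    and "\<And>T g. T \<in> bounded_ops (carrier G) \<Longrightarrow> (\<And>X. X \<in> Xs \<Longrightarrow> commutes (carrier G) T X) \<Longrightarrow>
      g \<in> carrier G \<Longrightarrow> commutes (carrier G) T (left_regular G g)"
  shows "vN_generated (carrier G) Xs = group_vna G"
  unfolding group_vna_def
  by (rule vN_generated_eqI) (use assms in \<open>auto simp: group_vna_def\<close>)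

text \<open>For a unitary \<open>c\<close> put \<open>s = c - c\<inverse>\<close>. The elements \<open>c\<^sup>k + (-1)\<^sup>k c\<^sup>-\<^sup>k\<close> are polynomials in \<open>s\<close>, by
  the recursion \<open>X\<^bsub>k+2\<^esub> = s X\<^bsub>k+1\<^esub> + X\<^bsub>k\<^esub>\<close>. If \<open>c\<close> has odd order \<open>n\<close>, then \<open>X\<^bsub>n-1\<^esub> = c\<inverse> + c\<close>, so that \<open>c\<close>
  itself is a polynomial in \<open>s\<close>.\<close>

lemma odd_order_commutes:
  assumes C: "one_param C" and n: "C (int n) = \<one>" "odd n"
    and T: "T \<in> bounded_ops (carrier G)"
    and comm: "\<And>f. f \<in> ell2 (carrier G) \<Longrightarrow>
      T (\<lambda>x. left_regular G (C 1) f x - left_regular G (C (- 1)) f x) =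
      (\<lambda>x. left_regular G (C 1) (T f) x - left_regular G (C (- 1)) (T f) x)"
  shows "commutes (carrier G) T (left_regular G (C 1))"
proof -
  let ?S = "carrier G" and ?l = "\<lambda>k. left_regular G (C k)"
  have cC [simp]: "C k \<in> ?S" for k using C by simp
  have l_ell2: "?l k f \<in> ell2 ?S" if "f \<in> ell2 ?S" for k f by (rule left_regular_ell2[OF cC that])
  have l_l: "?l j (?l k f) = ?l (j + k) f" if "f \<in> ell2 ?S" for j k f
    using that by (simp add: left_regular_mult one_param_add[OF C])
  have l_lin: "?l j (\<lambda>x. f x + d * g x) = (\<lambda>x. ?l j f x + d * ?l j g x)"
    if "f \<in> ell2 ?S" "g \<in> ell2 ?S" for j f d g
    using bops_add[OF left_regular_bops[OF cC] that(1) ell2_cmult[OF that(2)]]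
      bops_scale[OF left_regular_bops[OF cC] that(2)] by simp
  define D where "D f = (\<lambda>x. ?l 1 f x - ?l (- 1) f x)" for f
  define X where "X k f = (\<lambda>x. ?l (int k) f x + (- 1) ^ k * ?l (- int k) f x)" for k f
  have D_ell2: "D f \<in> ell2 ?S" if "f \<in> ell2 ?S" for f
    unfolding D_def by (intro ell2_diff l_ell2 that)
  have X_ell2: "X k f \<in> ell2 ?S" if "f \<in> ell2 ?S" for k f
    unfolding X_def by (intro ell2_add(1) ell2_cmult l_ell2 that)
  have TD: "T (D f) = D (T f)" if "f \<in> ell2 ?S" for f
    using comm[OF that] by (simp add: D_def)
  have rec: "X (Suc (Suc k)) f = (\<lambda>x. D (X (Suc k) f) x + X k f x)" if f: "f \<in> ell2 ?S" for k f
  proof -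
    have lX: "?l j (X (Suc k) f) = (\<lambda>x. ?l (j + int (Suc k)) f x + (- 1) ^ Suc k * ?l (j + - int (Suc k)) f x)" for j
      unfolding X_def l_lin[OF l_ell2[OF f] l_ell2[OF f]] l_l[OF f] ..
    have ar: "1 + int (Suc k) = int (Suc (Suc k))" "1 + - int (Suc k) = - int k"
      "- 1 + int (Suc k) = int k" "- 1 + - int (Suc k) = - int (Suc (Suc k))"
      by simp_all
    show ?thesis
      unfolding D_def lX ar unfolding X_def by (simp add: fun_eq_iff)
  qed
  have TX: "T (X k f) = X k (T f)" if f: "f \<in> ell2 ?S" for k f
    using f
  proof (induction k arbitrary: f rule: induct_nat_012)
    case 0
    have "X 0 g = (\<lambda>x. 2 * g x)" if "g \<in> ell2 ?S" for g
      using that by (simp add: X_def one_param_zero[OF C] left_regular_one)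
    then show ?case using bops_scale[OF T 0] bops_ell2[OF T 0] 0 by simp
  next
    case 1
    have "X (Suc 0) g = D g" for g by (simp add: X_def D_def)
    then show ?case using TD[OF 1] by simp
  next
    case (ge2 k)
    have "T (X (Suc (Suc k)) f) = (\<lambda>x. T (D (X (Suc k) f)) x + T (X k f) x)"
      unfolding rec[OF ge2.prems] by (rule bops_add[OF T D_ell2[OF X_ell2[OF ge2.prems]] X_ell2[OF ge2.prems]])
    also have "\<dots> = (\<lambda>x. D (X (Suc k) (T f)) x + X k (T f) x)"
      using ge2 TD[OF X_ell2[OF ge2.prems]] by simp
    finally show ?case using rec[OF bops_ell2[OF T ge2.prems]] by simp
  qed
  have last: "X (n - 1) f = (\<lambda>x. ?l (- 1) f x + ?l 1 f x)" for f
  proof -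
    have n1: "int (n - 1) = int n + (- 1)" using n(2) by (cases n) auto
    have "C (int (n - 1)) = C (- 1)" unfolding n1 one_param_add[OF C] n(1) by simp
    moreover have "C (- int (n - 1)) = C 1"
    proof -
      have "C (- int (n - 1)) = C (1 + - int n)" unfolding n1 by simp
      also have "\<dots> = C 1" unfolding one_param_add[OF C] one_param_minus[OF C] n(1) by simp
      finally show ?thesis .
    qed
    moreover have "even (n - 1)" using n(2) by simp
    ultimately show ?thesis by (simp add: X_def)
  qed
  show ?thesis
    unfolding commutes_def
  proof
    fix f assume f: "f \<in> ell2 ?S"
    have half: "?l 1 g = (\<lambda>x. (1 / 2) * (D g x + X (n - 1) g x))" for g
      unfolding last D_def by simp
    have "T (?l 1 f) = (\<lambda>x. (1 / 2) * T (\<lambda>x. D f x + X (n - 1) f x) x)"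
      unfolding half by (rule bops_scale[OF T]) (intro ell2_add(1) D_ell2 X_ell2 f)
    also have "T (\<lambda>x. D f x + X (n - 1) f x) = (\<lambda>x. D (T f) x + X (n - 1) (T f) x)"
      by (simp add: bops_add[OF T D_ell2[OF f] X_ell2[OF f]] TD[OF f] TX[OF f])
    also have "(\<lambda>x. (1 / 2) * (D (T f) x + X (n - 1) (T f) x)) = ?l 1 (T f)"
      by (rule half[symmetric])
    finally show "T (?l 1 f) = ?l 1 (T f)" .
  qed
qed

text \<open>For commuting involutions \<open>x\<close>, \<open>y\<close> put \<open>b = x + 2 y\<close>. Then \<open>b\<^sup>2 = 5 + 4 x y\<close> recovers \<open>x y\<close>, and
  \<open>b x y = y + 2 x\<close> together with \<open>b\<close> recovers \<open>x\<close> and \<open>y\<close>.\<close>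

lemma commuting_involutions_commutes:
  assumes x: "x \<in> carrier G" "x \<otimes> x = \<one>" and y: "y \<in> carrier G" "y \<otimes> y = \<one>"
    and xy: "x \<otimes> y = y \<otimes> x" and T: "T \<in> bounded_ops (carrier G)"
    and comm: "\<And>f. f \<in> ell2 (carrier G) \<Longrightarrow>
      T (\<lambda>z. left_regular G x f z + 2 * left_regular G y f z) =
      (\<lambda>z. left_regular G x (T f) z + 2 * left_regular G y (T f) z)"
  shows "commutes (carrier G) T (left_regular G x)" "commutes (carrier G) T (left_regular G y)"
proof -
  let ?S = "carrier G" and ?l = "left_regular G"
  define b where "b f = (\<lambda>z. ?l x f z + 2 * ?l y f z)" for f
  define w where "w = ?l (x \<otimes> y)"
  have l_ell2: "?l g f \<in> ell2 ?S" if "g \<in> ?S" "f \<in> ell2 ?S" for g f by (rule left_regular_ell2[OF that])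
  have b_ell2: "b f \<in> ell2 ?S" if "f \<in> ell2 ?S" for f
    unfolding b_def by (intro ell2_add(1) ell2_cmult l_ell2 x y that)
  have w_ell2: "w f \<in> ell2 ?S" if "f \<in> ell2 ?S" for f
    unfolding w_def by (intro l_ell2 m_closed x y that)
  have Tb: "T (b f) = b (T f)" if "f \<in> ell2 ?S" for f
    using comm[OF that] by (simp add: b_def)
  have l_b: "?l g (b f) = (\<lambda>z. ?l (g \<otimes> x) f z + 2 * ?l (g \<otimes> y) f z)" if "g \<in> ?S" "f \<in> ell2 ?S" for g f
  proof -
    have "?l g (b f) = (\<lambda>z. ?l g (?l x f) z + 2 * ?l g (?l y f) z)"
      unfolding b_def
      using bops_add[OF left_regular_bops[OF that(1)] l_ell2[OF x(1) that(2)] ell2_cmult[OF l_ell2[OF y(1) that(2)]]]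
        bops_scale[OF left_regular_bops[OF that(1)] l_ell2[OF y(1) that(2)]] by simp
    then show ?thesis using that x y by (simp add: left_regular_mult)
  qed
  have bb: "b (b f) = (\<lambda>z. 5 * f z + 4 * w f z)" if f: "f \<in> ell2 ?S" for f
  proof -
    have "b (b f) = (\<lambda>z. ?l x (b f) z + 2 * ?l y (b f) z)" by (simp add: b_def)
    also have "\<dots> = (\<lambda>z. 5 * f z + 4 * w f z)"
      unfolding l_b[OF x(1) f] l_b[OF y(1) f] x(2) y(2) xy[symmetric] w_def left_regular_one[OF f]
      by (simp add: algebra_simps)
    finally show ?thesis .
  qed
  have Tw: "T (w f) = w (T f)" if f: "f \<in> ell2 ?S" for f
  proof -
    have w_eq: "w g = (\<lambda>z. (1 / 4) * (b (b g) z - 5 * g z))" if "g \<in> ell2 ?S" for g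
      by (simp add: bb[OF that])
    have "T (w f) = (\<lambda>z. (1 / 4) * T (\<lambda>z. b (b f) z - 5 * f z) z)"
      unfolding w_eq[OF f] by (rule bops_scale[OF T]) (intro ell2_diff b_ell2 ell2_cmult f)
    also have "T (\<lambda>z. b (b f) z - 5 * f z) = (\<lambda>z. b (b (T f)) z - 5 * T f z)"
      by (simp add: bops_diff[OF T b_ell2[OF b_ell2[OF f]] ell2_cmult[OF f]] bops_scale[OF T f]
          Tb[OF b_ell2[OF f]] Tb[OF f])
    finally show ?thesis by (simp add: w_eq[OF bops_ell2[OF T f]])
  qed
  have bw: "b (w f) = (\<lambda>z. ?l y f z + 2 * ?l x f z)" if f: "f \<in> ell2 ?S" for f
  proof -
    have "x \<otimes> (x \<otimes> y) = y" using x y by (simp add: m_assoc[symmetric])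
    moreover have "y \<otimes> (x \<otimes> y) = x" unfolding xy using x y by (simp add: m_assoc[symmetric])
    ultimately show ?thesis using f x y by (simp add: b_def w_def left_regular_mult)
  qed
  have x_eq: "?l x f = (\<lambda>z. (2 / 3) * b (w f) z - (1 / 3) * b f z)" if "f \<in> ell2 ?S" for f
    unfolding bw[OF that] by (simp add: b_def field_simps)
  have y_eq: "?l y f = (\<lambda>z. (2 / 3) * b f z - (1 / 3) * b (w f) z)" if "f \<in> ell2 ?S" for f
    unfolding bw[OF that] by (simp add: b_def field_simps)
  have Tlin: "T (\<lambda>z. p * b f z - q * b (w f) z) = (\<lambda>z. p * b (T f) z - q * b (w (T f)) z)"
    "T (\<lambda>z. p * b (w f) z - q * b f z) = (\<lambda>z. p * b (w (T f)) z - q * b (T f) z)"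
    if f: "f \<in> ell2 ?S" for f p q
    using f by (simp_all add: bops_diff[OF T] bops_scale[OF T] b_ell2 w_ell2 Tb Tw)
  show "commutes ?S T (?l x)"
    unfolding commutes_def
  proof
    fix f assume f: "f \<in> ell2 ?S"
    show "T (?l x f) = ?l x (T f)"
      unfolding x_eq[OF f] x_eq[OF bops_ell2[OF T f]] by (rule Tlin(2)[OF f])
  qed
  show "commutes ?S T (?l y)"
    unfolding commutes_def
  proof
    fix f assume f: "f \<in> ell2 ?S"
    show "T (?l y f) = ?l y (T f)"
      unfolding y_eq[OF f] y_eq[OF bops_ell2[OF T f]] by (rule Tlin(1)[OF f])
  qed
qed

lemma singly_generated_by_odd_cycle_and_involutions:
  assumes C: "one_param C" and n: "C (int n) = \<one>" "odd n"
    and x: "x \<in> carrier G" "x \<otimes> x = \<one>" and y: "y \<in> carrier G" "y \<otimes> y = \<one>"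
    and xy: "x \<otimes> y = y \<otimes> x"
    and gen: "\<And>K. subgroup K G \<Longrightarrow> C 1 \<in> K \<Longrightarrow> x \<in> K \<Longrightarrow> y \<in> K \<Longrightarrow> K = carrier G"
  shows "singly_generated (carrier G) (group_vna G)"
proof -
  let ?S = "carrier G" and ?l = "left_regular G"
  have cC [simp]: "C k \<in> ?S" for k using C by simp
  define a where "a = op_sum ?S {1, - 1 :: int} (\<lambda>k. \<i> * of_int k) (\<lambda>k. ?l (C k))"
  define b where "b = op_sum ?S (UNIV :: bool set) (\<lambda>t. if t then 1 else 2) (\<lambda>t. if t then ?l x else ?l y)"
  have a_bops: "a \<in> bounded_ops ?S" unfolding a_def by (intro op_sum_bops left_regular_bops cC)
  have b_bops: "b \<in> bounded_ops ?S" unfolding b_def by (intro op_sum_bops) (simp add: x(1) y(1))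
  have a_apply: "a f = (\<lambda>z. \<i> * (?l (C 1) f z - ?l (C (- 1)) f z))" if "f \<in> ell2 ?S" for f
    unfolding a_def op_sum_apply[OF that] by (simp add: right_diff_distrib)
  have b_apply: "b f = (\<lambda>z. ?l x f z + 2 * ?l y f z)" if "f \<in> ell2 ?S" for f
    unfolding b_def op_sum_apply[OF that] UNIV_bool by (simp add: add.commute)
  have a_adj: "is_adjoint ?S a (op_sum ?S {1, - 1 :: int} (\<lambda>k. cnj (\<i> * of_int k)) (\<lambda>k. ?l (C (- k))))"
    unfolding a_def
    by (intro is_adjoint_op_sum left_regular_bops cC) (simp add: one_param_minus[OF C] left_regular_adjoint[OF cC])
  have a_eq: "op_sum ?S {1, - 1 :: int} (\<lambda>k. cnj (\<i> * of_int k)) (\<lambda>k. ?l (C (- k))) = a"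
    unfolding op_sum_def a_def by (intro restrict_ext ext) simp
  have a_sa: "self_adjoint ?S a" using a_bops a_adj unfolding a_eq self_adjoint_def by blast
  have inv_xy: "inv x = x" "inv y = y" by (rule inv_equality; fact)+
  have b_adj: "is_adjoint ?S b (op_sum ?S (UNIV :: bool set) (\<lambda>t. cnj (if t then 1 else 2)) (\<lambda>t. if t then ?l x else ?l y))"
    unfolding b_def
    by (rule is_adjoint_op_sum)
      (use left_regular_adjoint[OF x(1)] left_regular_adjoint[OF y(1)] in \<open>simp_all add: inv_xy x(1) y(1)\<close>)
  have b_eq: "op_sum ?S (UNIV :: bool set) (\<lambda>t. cnj (if t then 1 else 2)) (\<lambda>t. if t then ?l x else ?l y) = b"
    unfolding op_sum_def b_def UNIV_bool by (intro restrict_ext ext) simp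
  have b_sa: "self_adjoint ?S b" using b_bops b_adj unfolding b_eq self_adjoint_def by blast
  have a_in: "a \<in> group_vna G"
  proof (rule in_group_vnaI[OF a_bops])
    fix T assume "T \<in> bounded_ops ?S" "\<And>g. g \<in> ?S \<Longrightarrow> commutes ?S T (?l g)"
    then show "commutes ?S T a" unfolding a_def by (intro commutes_op_sum left_regular_bops cC) (simp_all only: cC)
  qed
  have b_in: "b \<in> group_vna G"
  proof (rule in_group_vnaI[OF b_bops])
    fix T assume "T \<in> bounded_ops ?S" "\<And>g. g \<in> ?S \<Longrightarrow> commutes ?S T (?l g)"
    then show "commutes ?S T b" unfolding b_def by (intro commutes_op_sum) (simp_all add: x(1) y(1))
  qed
  have "vN_generated ?S {a, b} = group_vna G"
  proof (rule group_vna_generatedI)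
    fix T g assume T: "T \<in> bounded_ops ?S" and comm: "\<And>X. X \<in> {a, b} \<Longrightarrow> commutes ?S T X" and g: "g \<in> ?S"
    define K where "K = {g \<in> ?S. commutes ?S T (?l g)}"
    have K: "subgroup K G" unfolding K_def by (rule commuting_subgroup[OF T])
    have ca: "commutes ?S T a" and cb: "commutes ?S T b" by (simp_all add: comm)
    have TC: "commutes ?S T (?l (C 1))"
    proof (rule odd_order_commutes[OF C n T])
      fix f assume f: "f \<in> ell2 ?S"
      have d: "(\<lambda>x. ?l (C 1) f x - ?l (C (- 1)) f x) \<in> ell2 ?S" by (intro ell2_diff left_regular_ell2 cC f)
      have "T (\<lambda>x. \<i> * (?l (C 1) f x - ?l (C (- 1)) f x)) = a (T f)"
        unfolding a_apply[OF f, symmetric] by (rule commutesD[OF ca f])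
      then have "(\<lambda>x. \<i> * T (\<lambda>x. ?l (C 1) f x - ?l (C (- 1)) f x) x) =
          (\<lambda>z. \<i> * (?l (C 1) (T f) z - ?l (C (- 1)) (T f) z))"
        unfolding bops_scale[OF T d] a_apply[OF bops_ell2[OF T f]] .
      then show "T (\<lambda>x. ?l (C 1) f x - ?l (C (- 1)) f x) = (\<lambda>x. ?l (C 1) (T f) x - ?l (C (- 1)) (T f) x)"
        by (simp add: fun_eq_iff)
    qed
    have Tb: "T (\<lambda>z. ?l x f z + 2 * ?l y f z) = (\<lambda>z. ?l x (T f) z + 2 * ?l y (T f) z)" if f: "f \<in> ell2 ?S" for f
      unfolding b_apply[OF f, symmetric] b_apply[OF bops_ell2[OF T f], symmetric]
      by (rule commutesD[OF cb f])
    have Tx: "commutes ?S T (?l x)"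
      by (rule commuting_involutions_commutes(1)[OF x(1) x(2) y(1) y(2) xy T]) (rule Tb)
    have Ty: "commutes ?S T (?l y)"
      by (rule commuting_involutions_commutes(2)[OF x(1) x(2) y(1) y(2) xy T]) (rule Tb)
    have "K = ?S" by (intro gen K) (simp_all add: K_def x(1) y(1) TC Tx Ty)
    then show "commutes ?S T (?l g)" using g unfolding K_def by blast
  qed (use a_in b_in in auto)
  then show ?thesis
    unfolding singly_generated_def by (intro bexI[of _ a] bexI[of _ b] conjI a_in b_in a_sa b_sa)
qed

end

section \<open>Fourier coefficients of arcs\<close>

definition circ :: "int \<Rightarrow> real \<Rightarrow> complex" where
  "circ l x = cis (2 * pi * of_int l * x)"

lemma circ_zero [simp]: "circ 0 x = 1"
  and circ_mult: "circ l x * circ l' x = circ (l + l') x"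
  and cnj_circ: "cnj (circ l x) = circ (- l) x"
  and norm_circ [simp]: "cmod (circ l x) = 1"
  and circ_add_arg: "circ l (x + y) = circ l x * circ l y"
  by (simp_all add: circ_def cis_mult cis_cnj algebra_simps)

lemma circ_of_int [simp]: "circ l (of_int m) = 1"
proof -
  have "circ l (of_int m) = cis (2 * pi * of_int (l * m))" by (simp add: circ_def mult.assoc)
  also have "\<dots> = 1" by (rule cis_multiple_2pi) simp
  finally show ?thesis .
qed

lemma continuous_circ [continuous_intros]: "continuous_on A (circ l)"
  unfolding circ_def cis_conv_exp by (intro continuous_intros)

lemma circ_borel [measurable]: "circ l \<in> borel_measurable borel"
  by (rule borel_measurable_continuous_onI) (rule continuous_circ)

text \<open>The \<open>l\<close>-th Fourier coefficient of the indicator function of the arc from \<open>\<alpha>\<close> to \<open>\<beta>\<close> on the circle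
  of length 1, in closed form.\<close>

definition arc_coeff :: "real \<Rightarrow> real \<Rightarrow> int \<Rightarrow> complex" where
  "arc_coeff \<alpha> \<beta> l = (if l = 0 then of_real (\<beta> - \<alpha>)
     else (circ (- l) \<alpha> - circ (- l) \<beta>) / (2 * pi * \<i> * of_int l))"

lemma arc_coeff_zero [simp]: "arc_coeff \<alpha> \<beta> 0 = of_real (\<beta> - \<alpha>)"
  by (simp add: arc_coeff_def)

lemma arc_coeff_minus: "arc_coeff \<alpha> \<beta> (- l) = cnj (arc_coeff \<alpha> \<beta> l)"
  by (auto simp: arc_coeff_def cnj_circ divide_simps)

lemma arc_coeff_shift: "arc_coeff (\<alpha> + \<tau>) (\<beta> + \<tau>) l = circ (- l) \<tau> * arc_coeff \<alpha> \<beta> l"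
  by (simp add: arc_coeff_def circ_add_arg algebra_simps diff_divide_distrib)

lemma arc_coeff_shift_int: "arc_coeff (\<alpha> + of_int m) (\<beta> + of_int m) l = arc_coeff \<alpha> \<beta> l"
  by (simp add: arc_coeff_shift)

lemma arc_coeff_add: "arc_coeff \<alpha> \<beta> l + arc_coeff \<beta> \<gamma> l = arc_coeff \<alpha> \<gamma> l"
  by (simp add: arc_coeff_def diff_divide_distrib)

lemma arc_coeff_sum: "(\<Sum>j<k. arc_coeff (t j) (t (Suc j)) l) = arc_coeff (t 0) (t k) l"
proof (induction k)
  case 0
  then show ?case by (simp add: arc_coeff_def)
qed (simp add: arc_coeff_add)

lemma arc_coeff_full: "arc_coeff 0 1 l = (if l = 0 then 1 else 0)"
  using circ_of_int[of "- l" 0] circ_of_int[of "- l" 1] by (simp add: arc_coeff_def)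

lemma integral_circ:
  assumes "\<alpha> \<le> \<beta>"
  shows "(\<integral>x. indicator {\<alpha>..\<beta>} x *\<^sub>R circ (- l) x \<partial>lborel) = arc_coeff \<alpha> \<beta> l"
proof (cases "l = 0")
  case True
  then show ?thesis using assms by (simp add: scaleR_conv_of_real)
next
  case False
  define F where "F x = - (1 / (2 * pi * \<i> * of_int l)) * circ (- l) x" for x
  have "(F has_vector_derivative circ (- l) x) (at x within {\<alpha>..\<beta>})" for x
  proof -
    have "((\<lambda>x. exp (\<i> * of_real (2 * pi * of_int (- l) * x))) has_vector_derivative
        \<i> * of_real (2 * pi * of_int (- l)) * exp (\<i> * of_real (2 * pi * of_int (- l) * x))) (at x within {\<alpha>..\<beta>})"
      by (auto intro!: derivative_eq_intros has_vector_derivative_real_field simp: field_simps)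
    then have "((\<lambda>x. circ (- l) x) has_vector_derivative \<i> * of_real (2 * pi * of_int (- l)) * circ (- l) x)
        (at x within {\<alpha>..\<beta>})"
      by (simp add: circ_def cis_conv_exp mult.assoc)
    then have "(F has_vector_derivative - (1 / (2 * pi * \<i> * of_int l)) * (\<i> * of_real (2 * pi * of_int (- l)) * circ (- l) x))
        (at x within {\<alpha>..\<beta>})"
      unfolding F_def by (rule has_vector_derivative_mult_right)
    then show ?thesis using False by (simp add: field_simps)
  qed
  then have "(\<integral>x. indicator {\<alpha>..\<beta>} x *\<^sub>R circ (- l) x \<partial>lborel) = F \<beta> - F \<alpha>"
    by (intro integral_FTC_Icc assms continuous_circ)
  then show ?thesis using False by (simp add: F_def arc_coeff_def field_simps)
qed

section \<open>Parseval's identity on a window of length one\<close>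

text \<open>Bounded Borel functions are integrable on every window and closed under the algebraic operations, so that
  the inner products below are defined by convergent integrals.\<close>

definition bdd_borel :: "(real \<Rightarrow> complex) \<Rightarrow> bool" where
  "bdd_borel f \<longleftrightarrow> f \<in> borel_measurable borel \<and> (\<exists>B. \<forall>x. cmod (f x) \<le> B)"

lemma bdd_borel_circ [simp]: "bdd_borel (circ l)"
  by (auto simp: bdd_borel_def intro!: exI[of _ 1])

lemma bdd_borel_const [simp]: "bdd_borel (\<lambda>x. c)"
  by (auto simp: bdd_borel_def)

lemma bdd_borel_indicator [simp]: "bdd_borel (\<lambda>x. indicator {\<alpha>..\<beta>} x)"
  by (auto simp: bdd_borel_def indicator_def intro!: exI[of _ 1])

lemma bdd_borel_add [intro!, simp]: "bdd_borel f \<Longrightarrow> bdd_borel g \<Longrightarrow> bdd_borel (\<lambda>x. f x + g x)"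
proof -
  assume "bdd_borel f" "bdd_borel g"
  then obtain B C where m: "f \<in> borel_measurable borel" "g \<in> borel_measurable borel"
    and B: "\<And>x. cmod (f x) \<le> B" and C: "\<And>x. cmod (g x) \<le> C"
    by (auto simp: bdd_borel_def)
  have "cmod (f x + g x) \<le> B + C" for x by (rule norm_triangle_le) (simp add: B C add_mono)
  then show ?thesis using m by (auto simp: bdd_borel_def)
qed

lemma bdd_borel_mult [intro!, simp]: "bdd_borel f \<Longrightarrow> bdd_borel g \<Longrightarrow> bdd_borel (\<lambda>x. f x * g x)"
proof -
  assume "bdd_borel f" "bdd_borel g"
  then obtain B C where m: "f \<in> borel_measurable borel" "g \<in> borel_measurable borel"
    and B: "\<And>x. cmod (f x) \<le> B" and C: "\<And>x. cmod (g x) \<le> C"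
    by (auto simp: bdd_borel_def)
  have "0 \<le> B" using B[of 0] norm_ge_zero order_trans by blast
  then have "cmod (f x * g x) \<le> B * C" for x unfolding norm_mult by (intro mult_mono B C) auto
  then show ?thesis using m by (auto simp: bdd_borel_def)
qed

lemma bdd_borel_cnj [intro!, simp]: "bdd_borel f \<Longrightarrow> bdd_borel (\<lambda>x. cnj (f x))"
  unfolding bdd_borel_def
  by (auto intro!: borel_measurable_continuous_on[where f = cnj] continuous_intros)

lemma bdd_borel_sum [intro!, simp]: "(\<And>i. i \<in> I \<Longrightarrow> bdd_borel (f i)) \<Longrightarrow> bdd_borel (\<lambda>x. \<Sum>i\<in>I. f i x)"
  by (induction I rule: infinite_finite_induct) auto

lemma bdd_borel_diff [intro!, simp]: "bdd_borel f \<Longrightarrow> bdd_borel g \<Longrightarrow> bdd_borel (\<lambda>x. f x - g x)"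
  using bdd_borel_add[OF _ bdd_borel_mult[OF bdd_borel_const[of "- 1"]], of f g] by simp

text \<open>The circle is represented by an interval of length one with a variable left endpoint. An arc that starts
  at this endpoint does not wrap around.\<close>

definition window :: "real \<Rightarrow> real measure" where
  "window w = restrict_space lborel {w..w + 1}"

lemma finite_window: "finite_measure (window w)"
  by (rule finite_measureI) (simp add: window_def emeasure_restrict_space)

lemma measurable_window: "f \<in> borel_measurable borel \<Longrightarrow> f \<in> borel_measurable (window w)"
  unfolding window_def by (rule measurable_restrict_space1) simp

lemma measure_window: "measure (window w) (space (window w)) = 1"
  by (simp add: window_def measure_restrict_space)

lemma integrable_window [simp]: "bdd_borel f \<Longrightarrow> integrable (window w) f"
  using finite_measure.integrable_const_bound[OF finite_window] measurable_window
  unfolding bdd_borel_def by blast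

definition win_inner :: "real \<Rightarrow> (real \<Rightarrow> complex) \<Rightarrow> (real \<Rightarrow> complex) \<Rightarrow> complex" where
  "win_inner w f g = (\<integral>x. f x * cnj (g x) \<partial>window w)"

lemma integral_window: "(\<integral>x. f x \<partial>window w) = (\<integral>x. indicator {w..w + 1} x *\<^sub>R f x \<partial>lborel)"
  for f :: "real \<Rightarrow> complex"
  unfolding window_def by (rule integral_restrict_space) simp

lemma win_inner_circ: "win_inner w (circ l) (circ l') = (if l = l' then 1 else 0)"
proof -
  have "win_inner w (circ l) (circ l') = (\<integral>x. circ (- (l' - l)) x \<partial>window w)"
    by (simp add: win_inner_def cnj_circ circ_mult)
  also have "\<dots> = arc_coeff w (w + 1) (l' - l)"
    unfolding integral_window by (rule integral_circ) simp
  also have "\<dots> = arc_coeff (0 + w) (1 + w) (l' - l)" by (simp add: add.commute)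
  also have "\<dots> = (if l = l' then 1 else 0)"
    unfolding arc_coeff_shift arc_coeff_full by simp
  finally show ?thesis .
qed

lemma win_inner_cnj: "win_inner w g f = cnj (win_inner w f g)"
  unfolding win_inner_def by (subst Bochner_Integration.integral_cnj[symmetric]) (simp add: mult.commute)

lemma win_inner_diff_left:
  assumes "bdd_borel f" "bdd_borel g" "bdd_borel h"
  shows "win_inner w (\<lambda>x. f x - g x) h = win_inner w f h - win_inner w g h"
  using assms by (simp add: win_inner_def left_diff_distrib)

lemma win_inner_sum_left:
  assumes "\<And>i. i \<in> I \<Longrightarrow> bdd_borel (f i)" "bdd_borel h"
  shows "win_inner w (\<lambda>x. \<Sum>i\<in>I. c i * f i x) h = (\<Sum>i\<in>I. c i * win_inner w (f i) h)"
proof -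
  have "win_inner w (\<lambda>x. \<Sum>i\<in>I. c i * f i x) h = (\<integral>x. (\<Sum>i\<in>I. c i * (f i x * cnj (h x))) \<partial>window w)"
    by (simp add: win_inner_def sum_distrib_right mult.assoc)
  also have "\<dots> = (\<Sum>i\<in>I. \<integral>x. c i * (f i x * cnj (h x)) \<partial>window w)"
    by (rule Bochner_Integration.integral_sum) (use assms in auto)
  finally show ?thesis by (simp add: win_inner_def)
qed

text \<open>Among all trigonometric polynomials with frequencies in \<open>F\<close>, the partial Fourier sum is closest.\<close>

lemma win_dist_trig_poly:
  assumes f: "bdd_borel f" and F: "finite F"
  shows "win_inner w (\<lambda>x. f x - (\<Sum>l\<in>F. b l * circ l x)) (\<lambda>x. f x - (\<Sum>l\<in>F. b l * circ l x)) =
    win_inner w f f + of_real (\<Sum>l\<in>F. (cmod (b l - win_inner w f (circ l)))\<^sup>2 - (cmod (win_inner w f (circ l)))\<^sup>2)"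
proof -
  define S where "S x = (\<Sum>l\<in>F. b l * circ l x)" for x
  have S: "bdd_borel S" unfolding S_def by auto
  have Sh: "win_inner w S h = (\<Sum>l\<in>F. b l * win_inner w (circ l) h)" if "bdd_borel h" for h
    unfolding S_def using that by (intro win_inner_sum_left) auto
  have hS: "win_inner w h S = (\<Sum>l\<in>F. cnj (b l) * win_inner w h (circ l))" if "bdd_borel h" for h
  proof -
    have "win_inner w h S = cnj (\<Sum>l\<in>F. b l * win_inner w (circ l) h)"
      unfolding Sh[OF that, symmetric] by (rule win_inner_cnj)
    also have "\<dots> = (\<Sum>l\<in>F. cnj (b l) * cnj (win_inner w (circ l) h))" by simp
    also have "\<dots> = (\<Sum>l\<in>F. cnj (b l) * win_inner w h (circ l))"
      by (intro sum.cong refl) (metis win_inner_cnj)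
    finally show ?thesis .
  qed
  have SS: "win_inner w S S = (\<Sum>l\<in>F. b l * cnj (b l))"
  proof -
    have "win_inner w (circ l) S = cnj (b l)" if "l \<in> F" for l
      using F that by (simp add: hS win_inner_circ if_distrib[of "\<lambda>z. _ * z"] cong: if_cong)
    then show ?thesis by (simp add: Sh S)
  qed
  have "win_inner w (\<lambda>x. f x - S x) (\<lambda>x. f x - S x) =
      win_inner w f (\<lambda>x. f x - S x) - win_inner w S (\<lambda>x. f x - S x)"
    by (rule win_inner_diff_left) (use f S in auto)
  also have "win_inner w f (\<lambda>x. f x - S x) = win_inner w f f - win_inner w f S"
  proof -
    have "win_inner w f (\<lambda>x. f x - S x) = cnj (win_inner w f f - win_inner w S f)"
      unfolding win_inner_diff_left[OF f S f, symmetric] by (rule win_inner_cnj)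
    then show ?thesis using win_inner_cnj[of w f f] win_inner_cnj[of w f S] by simp
  qed
  also have "win_inner w S (\<lambda>x. f x - S x) = win_inner w S f - win_inner w S S"
  proof -
    have "win_inner w S (\<lambda>x. f x - S x) = cnj (win_inner w f S - win_inner w S S)"
      unfolding win_inner_diff_left[OF f S S, symmetric] by (rule win_inner_cnj)
    then show ?thesis using win_inner_cnj[of w S S] win_inner_cnj[of w S f] by simp
  qed
  also have "win_inner w f S = (\<Sum>l\<in>F. cnj (b l) * win_inner w f (circ l))" by (rule hS[OF f])
  also have "win_inner w S f = (\<Sum>l\<in>F. b l * cnj (win_inner w f (circ l)))"
    unfolding Sh[OF f] by (intro sum.cong refl) (metis win_inner_cnj)
  also have "win_inner w f f - (\<Sum>l\<in>F. cnj (b l) * win_inner w f (circ l))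
      - ((\<Sum>l\<in>F. b l * cnj (win_inner w f (circ l))) - win_inner w S S)
    = win_inner w f f + of_real (\<Sum>l\<in>F. (cmod (b l - win_inner w f (circ l)))\<^sup>2 - (cmod (win_inner w f (circ l)))\<^sup>2)"
    unfolding SS
    by (simp add: complex_norm_square sum.distrib sum_subtractf algebra_simps del: of_real_power)
  finally show ?thesis unfolding S_def .
qed

text \<open>The Cauchy-Schwarz inequality in the form given by \<open>2 a b \<le> a\<^sup>2/t + t b\<^sup>2\<close>.\<close>

lemma win_inner_bound:
  assumes u: "bdd_borel u" and g: "bdd_borel g" and B: "\<And>x. cmod (g x) \<le> B" and t: "t > 0"
  shows "cmod (win_inner w u g) \<le> (Re (win_inner w u u) / t + t * B\<^sup>2) / 2"
proof -
  have uu: "u x * cnj (u x) = of_real ((cmod (u x))\<^sup>2)" for x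
    by (simp add: complex_norm_square del: of_real_power)
  have int: "integrable (window w) (\<lambda>x. of_real ((cmod (u x))\<^sup>2) :: complex)"
    using integrable_window[OF bdd_borel_mult[OF u bdd_borel_cnj[OF u]]] by (simp only: uu)
  then have int': "integrable (window w) (\<lambda>x. (cmod (u x))\<^sup>2)"
    using integrable_Re[OF int] by (simp del: of_real_power)
  have "cmod (win_inner w u g) \<le> (\<integral>x. cmod (u x * cnj (g x)) \<partial>window w)"
    unfolding win_inner_def by (rule integral_norm_bound)
  also have "\<dots> \<le> (\<integral>x. ((cmod (u x))\<^sup>2 / t + t * B\<^sup>2) / 2 \<partial>window w)"
  proof (rule integral_mono)
    show "integrable (window w) (\<lambda>x. cmod (u x * cnj (g x)))"
      using u g by (intro integrable_norm integrable_window) auto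
    show "integrable (window w) (\<lambda>x. ((cmod (u x))\<^sup>2 / t + t * B\<^sup>2) / 2)"
      by (intro integrable_divide Bochner_Integration.integrable_add int' finite_measure.integrable_const[OF finite_window])
    fix x
    have "0 \<le> (cmod (u x) - t * cmod (g x))\<^sup>2" by simp
    then have "2 * t * (cmod (u x) * cmod (g x)) \<le> (cmod (u x))\<^sup>2 + t\<^sup>2 * (cmod (g x))\<^sup>2"
      by (simp add: power2_eq_square algebra_simps)
    then have "cmod (u x) * cmod (g x) \<le> ((cmod (u x))\<^sup>2 / t + t * (cmod (g x))\<^sup>2) / 2"
      using t by (simp add: field_simps power2_eq_square)
    also have "\<dots> \<le> ((cmod (u x))\<^sup>2 / t + t * B\<^sup>2) / 2"
      using t B[of x] by (intro divide_right_mono add_left_mono mult_left_mono power_mono) auto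
    finally show "cmod (u x * cnj (g x)) \<le> ((cmod (u x))\<^sup>2 / t + t * B\<^sup>2) / 2"
      by (simp add: norm_mult)
  qed
  also have "\<dots> = ((\<integral>x. (cmod (u x))\<^sup>2 \<partial>window w) / t + t * B\<^sup>2) / 2"
    by (simp add: Bochner_Integration.integral_add[OF integrable_divide[OF int'] finite_measure.integrable_const[OF finite_window]] measure_window)
  also have "(\<integral>x. (cmod (u x))\<^sup>2 \<partial>window w) = Re (win_inner w u u)"
    unfolding win_inner_def uu by (simp del: of_real_power)
  finally show ?thesis .
qed

text \<open>If some trigonometric polynomial with frequencies in \<open>F\<^sub>0\<close> is close to \<open>f\<close> in mean square, then so is the partial Fourier sum
  over every finite set that contains \<open>F\<^sub>0\<close>.\<close>

lemma Parseval_window: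
  assumes f: "bdd_borel f" and g: "bdd_borel g"
    and approx: "\<And>e. e > 0 \<Longrightarrow> \<exists>F b. finite F \<and>
      Re (win_inner w (\<lambda>x. f x - (\<Sum>l\<in>F. b l * circ l x)) (\<lambda>x. f x - (\<Sum>l\<in>F. b l * circ l x))) < e"
  shows "((\<lambda>l. win_inner w f (circ l) * cnj (win_inner w g (circ l))) has_sum win_inner w f g) UNIV"
proof -
  obtain B where B: "\<And>x. cmod (g x) \<le> B" using g by (auto simp: bdd_borel_def)
  define s where "s l = win_inner w f (circ l)" for l
  define S where "S F x = (\<Sum>l\<in>F. s l * circ l x)" for F x
  show ?thesis
    unfolding has_sum_def tendsto_iff
  proof (intro allI impI)
    fix e :: real assume e: "e > 0"
    define t where "t = e / (1 + B\<^sup>2)"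
    have t: "t > 0" using e by (simp add: t_def add_pos_nonneg)
    obtain F0 b where F0: "finite F0"
      and b: "Re (win_inner w (\<lambda>x. f x - (\<Sum>l\<in>F0. b l * circ l x)) (\<lambda>x. f x - (\<Sum>l\<in>F0. b l * circ l x))) < t\<^sup>2"
      using approx[of "t\<^sup>2"] t by auto
    have "dist (\<Sum>l\<in>F. s l * cnj (win_inner w g (circ l))) (win_inner w f g) < e"
      if F: "finite F" "F0 \<subseteq> F" for F
    proof -
      define u where "u x = f x - S F x" for x
      define b' where "b' l = (if l \<in> F0 then b l else 0)" for l
      have SF: "bdd_borel (S F)" unfolding S_def by auto
      have u: "bdd_borel u" unfolding u_def using f SF by auto
      have "Re (win_inner w u u) \<le> Re (win_inner w (\<lambda>x. f x - (\<Sum>l\<in>F. b' l * circ l x)) (\<lambda>x. f x - (\<Sum>l\<in>F. b' l * circ l x)))"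
        unfolding u_def S_def win_dist_trig_poly[OF f F(1)]
        by (auto simp: s_def intro!: sum_mono)
      also have "(\<lambda>x. \<Sum>l\<in>F. b' l * circ l x) = (\<lambda>x. \<Sum>l\<in>F0. b l * circ l x)"
        by (intro ext sum.mono_neutral_cong_right) (use F in \<open>auto simp: b'_def\<close>)
      then have "(\<lambda>x. f x - (\<Sum>l\<in>F. b' l * circ l x)) = (\<lambda>x. f x - (\<Sum>l\<in>F0. b l * circ l x))"
        by metis
      also note b
      finally have uu: "Re (win_inner w u u) < t\<^sup>2" .
      have "win_inner w (S F) g = (\<Sum>l\<in>F. s l * cnj (win_inner w g (circ l)))"
        unfolding S_def using g by (subst win_inner_sum_left) (auto intro!: sum.cong win_inner_cnj)
      then have "win_inner w f g - (\<Sum>l\<in>F. s l * cnj (win_inner w g (circ l))) = win_inner w u g"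
        using win_inner_diff_left[OF f SF g, of w] by (simp add: u_def[abs_def])
      moreover have "cmod (win_inner w u g) \<le> (Re (win_inner w u u) / t + t * B\<^sup>2) / 2"
        by (rule win_inner_bound[OF u g B t])
      moreover have "(Re (win_inner w u u) / t + t * B\<^sup>2) / 2 < e"
      proof -
        have "Re (win_inner w u u) / t \<le> t" using uu t by (simp add: field_simps power2_eq_square)
        then have "Re (win_inner w u u) / t + t * B\<^sup>2 \<le> t * (1 + B\<^sup>2)" by (simp add: algebra_simps)
        also have "\<dots> = e" by (simp add: t_def add_nonneg_eq_0_iff)
        finally show ?thesis using e by simp
      qed
      ultimately show ?thesis by (simp add: dist_norm norm_minus_commute)
    qed
    then show "\<forall>\<^sub>F F in finite_subsets_at_top UNIV.
        dist (\<Sum>l\<in>F. win_inner w f (circ l) * cnj (win_inner w g (circ l))) (win_inner w f g) < e"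
      unfolding eventually_finite_subsets_at_top s_def using F0 by blast
  qed
qed

section \<open>Approximation of arcs by trigonometric polynomials\<close>

definition trig_poly :: "(real \<Rightarrow> complex) \<Rightarrow> bool" where
  "trig_poly f \<longleftrightarrow> (\<exists>F b. finite F \<and> f = (\<lambda>x. \<Sum>l\<in>F. b l * circ l x))"

lemma trig_poly_monom: "trig_poly (\<lambda>x. c * circ l x)"
  unfolding trig_poly_def by (rule exI[of _ "{l}"], rule exI[of _ "\<lambda>_. c"]) simp

lemma trig_poly_add: "trig_poly f \<Longrightarrow> trig_poly g \<Longrightarrow> trig_poly (\<lambda>x. f x + g x)"
proof -
  assume "trig_poly f" "trig_poly g"
  then obtain F b H d where F: "finite F" "f = (\<lambda>x. \<Sum>l\<in>F. b l * circ l x)"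
    and H: "finite H" "g = (\<lambda>x. \<Sum>l\<in>H. d l * circ l x)" by (auto simp: trig_poly_def)
  define b' d' where "b' l = (if l \<in> F then b l else 0)" and "d' l = (if l \<in> H then d l else 0)" for l
  have "f x = (\<Sum>l\<in>F \<union> H. b' l * circ l x)" "g x = (\<Sum>l\<in>F \<union> H. d' l * circ l x)" for x
    unfolding F(2) H(2) by (rule sum.mono_neutral_cong_left; use F(1) H(1) in \<open>auto simp: b'_def d'_def\<close>)+
  then have "(\<lambda>x. f x + g x) = (\<lambda>x. \<Sum>l\<in>F \<union> H. (b' l + d' l) * circ l x)"
    by (simp add: sum.distrib distrib_right)
  then show ?thesis unfolding trig_poly_def using F H by (intro exI[of _ "F \<union> H"]) auto
qed

lemma trig_poly_sum: "(\<And>i. i \<in> I \<Longrightarrow> trig_poly (f i)) \<Longrightarrow> trig_poly (\<lambda>x. \<Sum>i\<in>I. f i x)"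
proof (induction I rule: infinite_finite_induct)
  case (insert i I)
  then show ?case using trig_poly_add[of "f i" "\<lambda>x. \<Sum>i\<in>I. f i x"] by simp
qed (use trig_poly_monom[of 0 0] in simp_all)

lemma trig_poly_mult: "trig_poly f \<Longrightarrow> trig_poly g \<Longrightarrow> trig_poly (\<lambda>x. f x * g x)"
proof -
  assume "trig_poly f" "trig_poly g"
  then obtain F b H d where F: "f = (\<lambda>x. \<Sum>l\<in>F. b l * circ l x)"
    and H: "g = (\<lambda>x. \<Sum>l\<in>H. d l * circ l x)" by (auto simp: trig_poly_def)
  have "(\<lambda>x. f x * g x) = (\<lambda>x. \<Sum>l\<in>F. \<Sum>l'\<in>H. (b l * d l') * circ (l + l') x)"
    unfolding F H sum_product circ_mult[symmetric] by (simp add: mult_ac)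
  moreover have "trig_poly (\<lambda>x. \<Sum>l\<in>F. \<Sum>l'\<in>H. (b l * d l') * circ (l + l') x)"
    by (intro trig_poly_sum trig_poly_monom)
  ultimately show ?thesis by simp
qed

text \<open>A real polynomial in the coordinates of the plane restricts to a trigonometric polynomial on the
  unit circle; Stone--Weierstrass then gives density.\<close>

lemma trig_poly_real_polynomial:
  fixes p :: "complex \<Rightarrow> real"
  assumes "real_polynomial_function p"
  shows "trig_poly (\<lambda>x. of_real (p (circ 1 x)))"
  using assms
proof (induction p rule: real_polynomial_function.induct)
  case (linear p)
  have pz: "complex_of_real (p z) = (p 1 - \<i> * p \<i>) / 2 * z + (p 1 + \<i> * p \<i>) / 2 * cnj z" for z
  proof -
    have "z = Re z *\<^sub>R 1 + Im z *\<^sub>R \<i>" by (simp add: complex_eq_iff)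
    then have "p z = p (Re z *\<^sub>R 1 + Im z *\<^sub>R \<i>)" by (rule arg_cong)
    also have "\<dots> = Re z * p 1 + Im z * p \<i>"
      unfolding linear_add[OF bounded_linear.linear[OF linear]] linear_scale[OF bounded_linear.linear[OF linear]]
      by simp
    finally have "p z = Re z * p 1 + Im z * p \<i>" .
    then show ?thesis unfolding complex_eq_iff by (simp add: field_simps)
  qed
  have eq: "(\<lambda>x. complex_of_real (p (circ 1 x))) =
      (\<lambda>x. (p 1 - \<i> * p \<i>) / 2 * circ 1 x + (p 1 + \<i> * p \<i>) / 2 * circ (- 1) x)"
    by (intro ext) (subst pz, simp only: cnj_circ)
  show ?case unfolding eq by (intro trig_poly_add trig_poly_monom)
next
  case (const c)
  then show ?case using trig_poly_monom[of c 0] by simp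
next
  case (add f g)
  then show ?case unfolding of_real_add by (intro trig_poly_add)
next
  case (mult f g)
  then show ?case unfolding of_real_mult by (intro trig_poly_mult)
qed

text \<open>The endpoints \<open>\<alpha>\<close> and \<open>\<alpha> + 1\<close> are excluded because they are the same point of the circle.\<close>

lemma circ_on_arc_iff:
  assumes ab: "\<alpha> \<le> \<beta>" "\<beta> \<le> \<alpha> + 1" and x: "\<alpha> < x" "x < \<alpha> + 1"
  shows "circ 1 x \<in> circ 1 ` {\<alpha>..\<beta>} \<longleftrightarrow> x \<in> {\<alpha>..\<beta>}"
proof
  assume "circ 1 x \<in> circ 1 ` {\<alpha>..\<beta>}"
  then obtain y where y: "\<alpha> \<le> y" "y \<le> \<beta>" "circ 1 x = circ 1 y" by auto
  have "circ 1 (x - y) = circ 1 x * circ 1 (- y)" using circ_add_arg[of 1 x "- y"] by simp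
  also have "circ 1 (- y) = circ (- 1) y" by (simp add: circ_def)
  also have "circ 1 x * circ (- 1) y = 1" unfolding y(3) circ_mult by simp
  finally have "cos (2 * pi * (x - y)) = 1" by (simp add: circ_def complex_eq_iff)
  then obtain n :: int where "2 * pi * (x - y) = of_int n * 2 * pi"
    unfolding cos_one_2pi_int by blast
  then have n: "x - y = of_int n" by simp
  have "- 1 < x - y" "x - y < 1" using x y ab by linarith+
  then have "- 1 < n" "n < 1" using n by linarith+
  then have "n = 0" by simp
  then show "x \<in> {\<alpha>..\<beta>}" using n y by simp
qed auto

text \<open>On the circle, the functions \<open>max 0 (1 - N \<cdot> dist)\<close> of the distance to the arc decrease to its indicator
  function, and each of them is a uniform limit of polynomials.\<close>

lemma arc_trig_approx:
  assumes ab: "\<alpha> \<le> \<beta>" "\<beta> \<le> \<alpha> + 1" and e: "e > 0"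
  shows "\<exists>F b. finite F \<and>
      Re (win_inner \<alpha> (\<lambda>x. indicator {\<alpha>..\<beta>} x - (\<Sum>l\<in>F. b l * circ l x))
        (\<lambda>x. indicator {\<alpha>..\<beta>} x - (\<Sum>l\<in>F. b l * circ l x))) < e"
proof -
  define A where "A = circ 1 ` {\<alpha>..\<beta>}"
  have A: "closed A" "A \<noteq> {}"
    unfolding A_def using ab by (auto intro!: compact_imp_closed compact_continuous_image continuous_circ)
  define bump where "bump N z = max 0 (1 - real N * infdist z A)" for N z
  define I where "I x = (indicator {\<alpha>..\<beta>} x :: real)" for x
  have bump_cont: "continuous_on S (bump N)" for S N
    unfolding bump_def by (intro continuous_intros)
  have bump_bound: "0 \<le> bump N z" "bump N z \<le> 1" for N z
    unfolding bump_def by (auto simp: infdist_nonneg)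
  have bump_lim: "(\<lambda>N. (bump N z - (if z \<in> A then 1 else 0))\<^sup>2) \<longlonglongrightarrow> 0" for z
  proof (cases "z \<in> A")
    case True
    then show ?thesis by (simp add: bump_def)
  next
    case False
    then have d: "infdist z A > 0"
      using A in_closed_iff_infdist_zero infdist_nonneg by (metis order_le_less)
    obtain N0 :: nat where N0: "1 / infdist z A < real N0" using reals_Archimedean2 by blast
    have "bump N z = 0" if "N \<ge> N0" for N
    proof -
      have "1 / infdist z A \<le> real N" using N0 that by linarith
      then have "1 \<le> real N * infdist z A" using d by (simp add: field_simps)
      then show ?thesis by (simp add: bump_def)
    qed
    then have "\<forall>\<^sub>F N in sequentially. (bump N z - (if z \<in> A then 1 else 0))\<^sup>2 = 0"
      using False by (auto simp: eventually_sequentially)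
    then show ?thesis by (rule tendsto_eventually)
  qed
  have bump_meas: "(\<lambda>x. bump N (circ 1 x)) \<in> borel_measurable borel" for N
    by (intro borel_measurable_continuous_onI continuous_on_compose2[OF bump_cont[of UNIV] continuous_circ]) auto
  have I_meas: "I \<in> borel_measurable borel" unfolding I_def by simp
  have "(\<lambda>N. \<integral>x. (bump N (circ 1 x) - I x)\<^sup>2 \<partial>window \<alpha>) \<longlonglongrightarrow> (\<integral>x. 0 \<partial>window \<alpha>)"
  proof (rule integral_dominated_convergence[where w = "\<lambda>_. 1"])
    show "(\<lambda>x. (bump N (circ 1 x) - I x)\<^sup>2) \<in> borel_measurable (window \<alpha>)" for N
      using bump_meas I_meas by (intro measurable_window) simp
    show "integrable (window \<alpha>) (\<lambda>_. 1 :: real)" by (rule finite_measure.integrable_const[OF finite_window])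
    show "AE x in window \<alpha>. norm ((bump N (circ 1 x) - I x)\<^sup>2) \<le> 1" for N
    proof (rule AE_I2)
      fix x
      have "\<bar>bump N (circ 1 x) - I x\<bar> \<le> 1"
        using bump_bound[of N "circ 1 x"] by (auto simp: I_def indicator_def)
      then show "norm ((bump N (circ 1 x) - I x)\<^sup>2) \<le> 1" by (simp add: abs_square_le_1)
    qed
    have "AE x in lborel. x \<in> {\<alpha>..\<alpha> + 1} \<longrightarrow> (\<lambda>N. (bump N (circ 1 x) - I x)\<^sup>2) \<longlonglongrightarrow> 0"
      using AE_lborel_singleton[of \<alpha>] AE_lborel_singleton[of "\<alpha> + 1"]
    proof eventually_elim
      case (elim x)
      show ?case
      proof
        assume "x \<in> {\<alpha>..\<alpha> + 1}"
        then have "I x = (if circ 1 x \<in> A then 1 else 0)"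
          using elim circ_on_arc_iff[OF ab, of x] by (auto simp: A_def I_def indicator_def)
        then show "(\<lambda>N. (bump N (circ 1 x) - I x)\<^sup>2) \<longlonglongrightarrow> 0" using bump_lim[of "circ 1 x"] by simp
      qed
    qed
    then show "AE x in window \<alpha>. (\<lambda>N. (bump N (circ 1 x) - I x)\<^sup>2) \<longlonglongrightarrow> 0"
      unfolding window_def by (subst AE_restrict_space_iff) auto
  qed simp
  then have lim0: "(\<lambda>N. \<integral>x. (bump N (circ 1 x) - I x)\<^sup>2 \<partial>window \<alpha>) \<longlonglongrightarrow> 0" by simp
  have "\<forall>\<^sub>F N in sequentially. (\<integral>x. (bump N (circ 1 x) - I x)\<^sup>2 \<partial>window \<alpha>) < e / 4"
    using order_tendstoD(2)[OF lim0, of "e / 4"] e by simp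
  then obtain N where N: "(\<integral>x. (bump N (circ 1 x) - I x)\<^sup>2 \<partial>window \<alpha>) < e / 4"
    by (auto simp: eventually_sequentially)
  obtain p where p: "real_polynomial_function p"
    and pd: "\<And>z. z \<in> sphere 0 1 \<Longrightarrow> \<bar>bump N z - p z\<bar> < sqrt (e / 8)"
    using Stone_Weierstrass_real_polynomial_function[OF compact_sphere bump_cont, of "sqrt (e / 8)" 0 1 N] e by auto
  obtain F b where F: "finite F" and Fb: "(\<lambda>x. complex_of_real (p (circ 1 x))) = (\<lambda>x. \<Sum>l\<in>F. b l * circ l x)"
    using trig_poly_real_polynomial[OF p] by (auto simp: trig_poly_def)
  have p_meas: "(\<lambda>x. p (circ 1 x)) \<in> borel_measurable borel"
    using p by (intro borel_measurable_continuous_onI continuous_on_compose2[OF _ continuous_circ[of UNIV 1], of UNIV])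
      (auto simp: real_polynomial_function_eq intro: continuous_on_polymonial_function)
  have pw: "(I x - p (circ 1 x))\<^sup>2 \<le> 2 * (bump N (circ 1 x) - I x)\<^sup>2 + e / 4" for x
  proof -
    have "\<bar>bump N (circ 1 x) - p (circ 1 x)\<bar> \<le> sqrt (e / 8)"
      using pd[of "circ 1 x"] by simp
    then have "(bump N (circ 1 x) - p (circ 1 x))\<^sup>2 \<le> e / 8"
      using e by (metis abs_ge_zero power2_abs power_mono real_sqrt_pow2 less_eq_real_def divide_pos_pos zero_less_numeral)
    moreover have "(I x - p (circ 1 x))\<^sup>2 \<le>
        2 * (bump N (circ 1 x) - I x)\<^sup>2 + 2 * (bump N (circ 1 x) - p (circ 1 x))\<^sup>2"
      using zero_le_power2[of "(bump N (circ 1 x) - I x) + (bump N (circ 1 x) - p (circ 1 x))"]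
      by (simp add: power2_eq_square algebra_simps)
    ultimately show ?thesis by linarith
  qed
  have bI: "integrable (window \<alpha>) (\<lambda>x. (bump N (circ 1 x) - I x)\<^sup>2)"
  proof (rule finite_measure.integrable_const_bound[OF finite_window, where B = 1])
    have "\<bar>bump N (circ 1 x) - I x\<bar> \<le> 1" for x
      using bump_bound[of N "circ 1 x"] by (auto simp: I_def indicator_def)
    then show "AE x in window \<alpha>. norm ((bump N (circ 1 x) - I x)\<^sup>2) \<le> 1"
      by (auto simp: abs_square_le_1)
    show "(\<lambda>x. (bump N (circ 1 x) - I x)\<^sup>2) \<in> borel_measurable (window \<alpha>)"
      using bump_meas I_meas by (intro measurable_window) simp
  qed
  have "(\<integral>x. (I x - p (circ 1 x))\<^sup>2 \<partial>window \<alpha>) \<le>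
      (\<integral>x. 2 * (bump N (circ 1 x) - I x)\<^sup>2 + e / 4 \<partial>window \<alpha>)"
  proof (rule integral_mono')
    show "integrable (window \<alpha>) (\<lambda>x. 2 * (bump N (circ 1 x) - I x)\<^sup>2 + e / 4)"
      by (intro Bochner_Integration.integrable_add integrable_mult_right bI finite_measure.integrable_const[OF finite_window])
  qed (use pw e in auto)
  also have "\<dots> = 2 * (\<integral>x. (bump N (circ 1 x) - I x)\<^sup>2 \<partial>window \<alpha>) + e / 4"
    by (simp add: Bochner_Integration.integral_add[OF integrable_mult_right[OF bI] finite_measure.integrable_const[OF finite_window]] measure_window)
  also have "\<dots> < e" using N e by linarith
  finally have lt: "(\<integral>x. (I x - p (circ 1 x))\<^sup>2 \<partial>window \<alpha>) < e" .
  have diff: "(indicator {\<alpha>..\<beta>} x - (\<Sum>l\<in>F. b l * circ l x)) = complex_of_real (I x - p (circ 1 x))" for x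
    using fun_cong[OF Fb, of x] by (simp add: I_def indicator_def)
  have "win_inner \<alpha> (\<lambda>x. indicator {\<alpha>..\<beta>} x - (\<Sum>l\<in>F. b l * circ l x))
      (\<lambda>x. indicator {\<alpha>..\<beta>} x - (\<Sum>l\<in>F. b l * circ l x)) = of_real (\<integral>x. (I x - p (circ 1 x))\<^sup>2 \<partial>window \<alpha>)"
    unfolding win_inner_def diff
    by (simp only: complex_cnj_complex_of_real of_real_mult[symmetric] power2_eq_square integral_complex_of_real)
  then show ?thesis using lt F by (intro exI[of _ F] exI[of _ b]) simp
qed

section \<open>Convolution identities for arcs\<close>

lemma win_inner_arc_circ:
  assumes "w \<le> \<alpha>" "\<alpha> \<le> \<beta>" "\<beta> \<le> w + 1"
  shows "win_inner w (\<lambda>x. indicator {\<alpha>..\<beta>} x * circ n x) (circ l) = arc_coeff \<alpha> \<beta> (l - n)"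
proof -
  have "win_inner w (\<lambda>x. indicator {\<alpha>..\<beta>} x * circ n x) (circ l)
      = (\<integral>x. indicator {w..w + 1} x *\<^sub>R (indicator {\<alpha>..\<beta>} x * circ (- (l - n)) x) \<partial>lborel)"
    unfolding win_inner_def integral_window by (simp add: cnj_circ mult.assoc circ_mult)
  also have "\<dots> = (\<integral>x. indicator {\<alpha>..\<beta>} x *\<^sub>R circ (- (l - n)) x \<partial>lborel)"
    by (rule Bochner_Integration.integral_cong) (use assms in \<open>auto simp: indicator_def\<close>)
  also have "\<dots> = arc_coeff \<alpha> \<beta> (l - n)" by (rule integral_circ[OF assms(2)])
  finally show ?thesis .
qed

text \<open>Parseval's identity for the indicator functions of two arcs, the second one multiplied by a character.\<close>

lemma arc_coeff_convolution:
  assumes ab: "\<alpha> \<le> \<beta>" "\<beta> \<le> \<alpha> + 1" and cd: "\<alpha> \<le> \<gamma>" "\<gamma> \<le> \<delta>" "\<delta> \<le> \<alpha> + 1"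
  shows "((\<lambda>l. arc_coeff \<alpha> \<beta> l * arc_coeff \<gamma> \<delta> (n - l)) has_sum
    win_inner \<alpha> (\<lambda>x. indicator {\<alpha>..\<beta>} x) (\<lambda>x. indicator {\<gamma>..\<delta>} x * circ n x)) UNIV"
proof -
  have "((\<lambda>l. win_inner \<alpha> (\<lambda>x. indicator {\<alpha>..\<beta>} x) (circ l) *
      cnj (win_inner \<alpha> (\<lambda>x. indicator {\<gamma>..\<delta>} x * circ n x) (circ l))) has_sum
    win_inner \<alpha> (\<lambda>x. indicator {\<alpha>..\<beta>} x) (\<lambda>x. indicator {\<gamma>..\<delta>} x * circ n x)) UNIV"
    by (rule Parseval_window) (use arc_trig_approx[OF ab] in auto)
  moreover have "win_inner \<alpha> (\<lambda>x. indicator {\<alpha>..\<beta>} x) (circ l) = arc_coeff \<alpha> \<beta> l" for l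
    using win_inner_arc_circ[of \<alpha> \<alpha> \<beta> 0 l] ab by simp
  moreover have "cnj (win_inner \<alpha> (\<lambda>x. indicator {\<gamma>..\<delta>} x * circ n x) (circ l)) = arc_coeff \<gamma> \<delta> (n - l)" for l
    unfolding win_inner_arc_circ[OF cd] arc_coeff_minus[symmetric] by simp
  ultimately show ?thesis by simp
qed

lemma arc_coeff_idempotent:
  assumes ab: "\<alpha> \<le> \<beta>" "\<beta> \<le> \<alpha> + 1"
  shows "((\<lambda>l. arc_coeff \<alpha> \<beta> l * arc_coeff \<alpha> \<beta> (n - l)) has_sum arc_coeff \<alpha> \<beta> n) UNIV"
proof -
  have "win_inner \<alpha> (\<lambda>x. indicator {\<alpha>..\<beta>} x) (\<lambda>x. indicator {\<alpha>..\<beta>} x * circ n x)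
      = win_inner \<alpha> (\<lambda>x. indicator {\<alpha>..\<beta>} x * circ 0 x) (circ n)"
    unfolding win_inner_def by (rule Bochner_Integration.integral_cong) (auto simp: indicator_def)
  also have "\<dots> = arc_coeff \<alpha> \<beta> n" using win_inner_arc_circ[of \<alpha> \<alpha> \<beta> 0 n] ab by simp
  finally show ?thesis using arc_coeff_convolution[OF ab _ ab, of n] by simp
qed

lemma arc_proj_seq: "\<alpha> \<le> \<beta> \<Longrightarrow> \<beta> \<le> \<alpha> + 1 \<Longrightarrow> proj_seq (arc_coeff \<alpha> \<beta>)"
  by (simp add: proj_seq_def arc_coeff_minus arc_coeff_idempotent)

text \<open>The integer \<open>m\<close> moves the second arc into the window that starts at \<open>\<alpha>\<close>; there the two arcs have at
  most the point \<open>\<beta>\<close> in common.\<close>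

lemma arc_coeff_orthogonal:
  assumes ab: "\<alpha> \<le> \<beta>" and cd: "\<gamma> \<le> \<delta>"
    and disj: "\<beta> \<le> \<gamma> + of_int m" "\<delta> + of_int m \<le> \<alpha> + 1"
  shows "((\<lambda>l. arc_coeff \<alpha> \<beta> l * arc_coeff \<gamma> \<delta> (n - l)) has_sum 0) UNIV"
proof -
  have "win_inner \<alpha> (\<lambda>x. indicator {\<alpha>..\<beta>} x) (\<lambda>x. indicator {\<gamma> + of_int m..\<delta> + of_int m} x * circ n x)
      = (\<integral>x. indicator {\<alpha>..\<alpha> + 1} x *\<^sub>R (indicator {\<alpha>..\<beta>} x * cnj (indicator {\<gamma> + of_int m..\<delta> + of_int m} x * circ n x)) \<partial>lborel)"
    unfolding win_inner_def integral_window ..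
  also have "\<dots> = 0"
  proof (rule integral_eq_zero_AE)
    show "AE x in lborel. indicator {\<alpha>..\<alpha> + 1} x *\<^sub>R (indicator {\<alpha>..\<beta>} x * cnj (indicator {\<gamma> + of_int m..\<delta> + of_int m} x * circ n x)) = (0 :: complex)"
      using AE_lborel_singleton[of \<beta>]
      by eventually_elim (use disj in \<open>auto simp: indicator_def\<close>)
  qed
  finally have "win_inner \<alpha> (\<lambda>x. indicator {\<alpha>..\<beta>} x) (\<lambda>x. indicator {\<gamma> + of_int m..\<delta> + of_int m} x * circ n x) = 0" .
  then show ?thesis
    using arc_coeff_convolution[of \<alpha> \<beta> "\<gamma> + of_int m" "\<delta> + of_int m" n] ab cd disj
    by (simp add: arc_coeff_shift_int)
qed

lemma arc_coeff_sq_summable: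
  assumes "\<alpha> \<le> \<beta>" "\<beta> \<le> \<alpha> + 1"
  shows "(\<lambda>l. (cmod (arc_coeff \<alpha> \<beta> l))\<^sup>2) summable_on UNIV"
proof -
  have "((\<lambda>l. Re (arc_coeff \<alpha> \<beta> l * arc_coeff \<alpha> \<beta> (0 - l))) has_sum Re (arc_coeff \<alpha> \<beta> 0)) UNIV"
    by (intro has_sum_Re arc_coeff_idempotent assms)
  moreover have "Re (arc_coeff \<alpha> \<beta> l * arc_coeff \<alpha> \<beta> (0 - l)) = (cmod (arc_coeff \<alpha> \<beta> l))\<^sup>2" for l
    by (simp only: diff_0 arc_coeff_minus complex_norm_square[symmetric] Re_complex_of_real)
  ultimately show ?thesis by (auto simp: summable_on_def)
qed

text \<open>Multiplication of the coefficients by those of a third arc amounts to averaging a translation of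
  the first arc over the third one. If all these translates avoid the second arc, then the average
  vanishes.\<close>

lemma arc_coeff_triple:
  assumes ab: "\<alpha> \<le> \<beta>" "\<beta> \<le> \<alpha> + 1" and cd: "\<gamma> \<le> \<delta>" "\<delta> \<le> \<gamma> + 1" and kl: "\<kappa> \<le> \<mu>"
    and avoid: "\<And>y. y \<in> {\<kappa>..\<mu>} \<Longrightarrow>
      \<exists>m. \<delta> - of_int n * y \<le> \<alpha> + of_int m \<and> \<beta> + of_int m \<le> \<gamma> - of_int n * y + 1"
  shows "((\<lambda>l. arc_coeff \<gamma> \<delta> l * (arc_coeff \<alpha> \<beta> (i - l) * arc_coeff \<kappa> \<mu> (j - n * l))) has_sum 0) UNIV"
proof -
  define b where "b y l = arc_coeff (\<gamma> - of_int n * y) (\<delta> - of_int n * y) l" for y l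
  define z where "z y l = b y l * arc_coeff \<alpha> \<beta> (i - l)" for y l
  have b_eq: "b y l = circ (n * l) y * arc_coeff \<gamma> \<delta> l" for y l
    using arc_coeff_shift[of \<gamma> "- (of_int n * y)" \<delta> l]
    by (simp add: b_def circ_def mult_ac)
  have z_norm: "cmod (z y l) = cmod (arc_coeff \<gamma> \<delta> l * arc_coeff \<alpha> \<beta> (i - l))" for y l
    by (simp add: z_def b_eq norm_mult)
  have z_sum: "(z y has_sum 0) UNIV" if y: "y \<in> {\<kappa>..\<mu>}" for y
  proof -
    obtain m where m: "\<delta> - of_int n * y \<le> \<alpha> + of_int m" "\<beta> + of_int m \<le> \<gamma> - of_int n * y + 1"
      using avoid[OF y] by blast
    show ?thesis
      unfolding z_def b_def by (rule arc_coeff_orthogonal[OF _ ab(1) m]) (use cd in simp)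
  qed
  have abs: "(\<lambda>l. cmod (arc_coeff \<gamma> \<delta> l * arc_coeff \<alpha> \<beta> (i - l))) summable_on UNIV"
  proof (rule summable_on_comparison_test)
    have "(\<lambda>l. (cmod (arc_coeff \<alpha> \<beta> (i - l)))\<^sup>2) summable_on UNIV"
    proof -
      have bij: "bij_betw (\<lambda>l. i - l) UNIV UNIV"
        by (rule bij_betw_byWitness[where f' = "\<lambda>l. i - l"]) auto
      show ?thesis
        using summable_on_reindex_bij_betw[OF bij, of "\<lambda>l. (cmod (arc_coeff \<alpha> \<beta> l))\<^sup>2"]
          arc_coeff_sq_summable[OF ab] by simp
    qed
    then show "(\<lambda>l. (cmod (arc_coeff \<gamma> \<delta> l))\<^sup>2 + (cmod (arc_coeff \<alpha> \<beta> (i - l)))\<^sup>2) summable_on UNIV"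
      by (intro summable_on_add arc_coeff_sq_summable cd)
    fix l
    have "2 * (cmod (arc_coeff \<gamma> \<delta> l) * cmod (arc_coeff \<alpha> \<beta> (i - l))) \<le>
        (cmod (arc_coeff \<gamma> \<delta> l))\<^sup>2 + (cmod (arc_coeff \<alpha> \<beta> (i - l)))\<^sup>2"
      using sum_squares_bound[of "cmod (arc_coeff \<gamma> \<delta> l)"] by (simp add: mult.assoc)
    moreover have "0 \<le> cmod (arc_coeff \<gamma> \<delta> l) * cmod (arc_coeff \<alpha> \<beta> (i - l))" by simp
    ultimately show "cmod (arc_coeff \<gamma> \<delta> l * arc_coeff \<alpha> \<beta> (i - l)) \<le>
        (cmod (arc_coeff \<gamma> \<delta> l))\<^sup>2 + (cmod (arc_coeff \<alpha> \<beta> (i - l)))\<^sup>2"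
      unfolding norm_mult by linarith
  qed auto
  define tot where "tot = (\<Sum>\<^sub>\<infinity>l. cmod (arc_coeff \<gamma> \<delta> l * arc_coeff \<alpha> \<beta> (i - l)))"
  show ?thesis
    unfolding has_sum_def tendsto_iff
  proof (intro allI impI)
    fix e :: real assume e: "e > 0"
    define e' where "e' = e / (\<mu> - \<kappa> + 1)"
    have e': "e' > 0" using e kl by (simp add: e'_def)
    have "((\<lambda>l. cmod (arc_coeff \<gamma> \<delta> l * arc_coeff \<alpha> \<beta> (i - l))) has_sum tot) UNIV"
      unfolding tot_def by (rule has_sum_infsum[OF abs])
    then have "\<forall>\<^sub>F F in finite_subsets_at_top UNIV.
        dist (\<Sum>l\<in>F. cmod (arc_coeff \<gamma> \<delta> l * arc_coeff \<alpha> \<beta> (i - l))) tot < e'"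
      unfolding has_sum_def tendsto_iff using e' by blast
    then obtain F0 where F0: "finite F0" and close': "\<forall>F. finite F \<and> F0 \<subseteq> F \<and> F \<subseteq> UNIV \<longrightarrow>
        dist (\<Sum>l\<in>F. cmod (arc_coeff \<gamma> \<delta> l * arc_coeff \<alpha> \<beta> (i - l))) tot < e'"
      unfolding eventually_finite_subsets_at_top by (elim exE conjE)
    have close: "dist (\<Sum>l\<in>F. cmod (arc_coeff \<gamma> \<delta> l * arc_coeff \<alpha> \<beta> (i - l))) tot < e'"
      if "finite F" "F0 \<subseteq> F" for F
      by (rule close'[rule_format]) (use that in simp)
    have "dist (\<Sum>l\<in>F. arc_coeff \<gamma> \<delta> l * (arc_coeff \<alpha> \<beta> (i - l) * arc_coeff \<kappa> \<mu> (j - n * l))) 0 < e"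
      if F: "finite F" "F0 \<subseteq> F" for F
    proof -
      note dist_F = close[OF F]
      \<comment> \<open>As the total is zero, partial sums are controlled by tails, uniformly in \<open>y\<close>: the norms of the terms do not depend on \<open>y\<close>.\<close>
      have tail: "cmod (\<Sum>l\<in>F. z y l) \<le> e'" if y: "y \<in> {\<kappa>..\<mu>}" for y
      proof -
        have abs_y: "(\<lambda>l. cmod (z y l)) summable_on UNIV" using abs by (simp add: z_norm)
        have "infsum (z y) (UNIV - F) = infsum (z y) UNIV - infsum (z y) F"
        proof (rule infsum_Diff)
          show "z y summable_on UNIV" using z_sum[OF y] by (rule has_sum_imp_summable)
        qed (use F(1) in simp_all)
        also have "infsum (z y) UNIV = 0" by (rule infsumI[OF z_sum[OF y]])
        also have "infsum (z y) F = (\<Sum>l\<in>F. z y l)" by (rule infsum_finite[OF F(1)])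
        finally have "infsum (z y) (UNIV - F) = - (\<Sum>l\<in>F. z y l)" by (simp only: diff_0)
        then have "cmod (\<Sum>l\<in>F. z y l) = cmod (infsum (z y) (UNIV - F))" by (simp only: norm_minus_cancel)
        also have "\<dots> \<le> infsum (\<lambda>l. cmod (z y l)) (UNIV - F)"
          by (rule norm_infsum_bound[OF summable_on_subset_banach[OF abs_y subset_UNIV]])
        also have "\<dots> = infsum (\<lambda>l. cmod (z y l)) UNIV - infsum (\<lambda>l. cmod (z y l)) F"
          by (rule infsum_Diff[OF abs_y]) (use F(1) in simp_all)
        also have "\<dots> = tot - (\<Sum>l\<in>F. cmod (arc_coeff \<gamma> \<delta> l * arc_coeff \<alpha> \<beta> (i - l)))"
          unfolding z_norm tot_def infsum_finite[OF F(1)] ..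
        also have "\<dots> \<le> e'" using dist_F unfolding dist_real_def by linarith
        finally show ?thesis .
      qed
      have "(\<Sum>l\<in>F. arc_coeff \<gamma> \<delta> l * (arc_coeff \<alpha> \<beta> (i - l) * arc_coeff \<kappa> \<mu> (j - n * l)))
          = (\<integral>y. indicator {\<kappa>..\<mu>} y *\<^sub>R (circ (- j) y * (\<Sum>l\<in>F. z y l)) \<partial>lborel)"
      proof -
        have int: "integrable lborel (\<lambda>y. indicator {\<kappa>..\<mu>} y *\<^sub>R circ l y)" for l
          by (rule borel_integrable_compact) (auto intro: continuous_circ)
        have "(\<integral>y. indicator {\<kappa>..\<mu>} y *\<^sub>R (circ (- j) y * (\<Sum>l\<in>F. z y l)) \<partial>lborel)
            = (\<integral>y. (\<Sum>l\<in>F. arc_coeff \<gamma> \<delta> l * arc_coeff \<alpha> \<beta> (i - l) * (indicator {\<kappa>..\<mu>} y *\<^sub>R circ (- (j - n * l)) y)) \<partial>lborel)"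
        proof (intro Bochner_Integration.integral_cong refl)
          fix y
          have "circ (- j) y * z y l = arc_coeff \<gamma> \<delta> l * arc_coeff \<alpha> \<beta> (i - l) * circ (- (j - n * l)) y" for l
            using circ_mult[of "- j" y "n * l"] by (simp add: z_def b_eq mult_ac)
          then show "indicator {\<kappa>..\<mu>} y *\<^sub>R (circ (- j) y * (\<Sum>l\<in>F. z y l)) =
              (\<Sum>l\<in>F. arc_coeff \<gamma> \<delta> l * arc_coeff \<alpha> \<beta> (i - l) * (indicator {\<kappa>..\<mu>} y *\<^sub>R circ (- (j - n * l)) y))"
            by (simp add: sum_distrib_left scaleR_sum_right)
        qed
        also have "\<dots> = (\<Sum>l\<in>F. arc_coeff \<gamma> \<delta> l * arc_coeff \<alpha> \<beta> (i - l) * arc_coeff \<kappa> \<mu> (j - n * l))"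
        proof (subst Bochner_Integration.integral_sum)
          show "integrable lborel (\<lambda>y. arc_coeff \<gamma> \<delta> l * arc_coeff \<alpha> \<beta> (i - l) * (indicator {\<kappa>..\<mu>} y *\<^sub>R circ (- (j - n * l)) y))" for l
            by (intro integrable_mult_right int)
        qed (simp only: integral_mult_right_zero integral_circ[OF kl])
        finally show ?thesis by (simp add: mult.assoc)
      qed
      also have "cmod \<dots> \<le> (\<integral>y. e' * indicator {\<kappa>..\<mu>} y \<partial>lborel)"
      proof (rule order_trans[OF Bochner_Integration.integral_norm_bound integral_mono])
        have "continuous_on {\<kappa>..\<mu>} (\<lambda>y. circ (- j) y * (\<Sum>l\<in>F. z y l))"
          unfolding z_def b_eq by (intro continuous_intros)
        then show "integrable lborel (\<lambda>y. cmod (indicator {\<kappa>..\<mu>} y *\<^sub>R (circ (- j) y * (\<Sum>l\<in>F. z y l))))"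
          by (intro integrable_norm borel_integrable_compact compact_Icc)
        show "integrable lborel (\<lambda>y. e' * indicator {\<kappa>..\<mu>} y)"
          by (intro integrable_mult_right integrable_real_indicator) (auto simp: emeasure_lborel_Icc_eq)
        fix y
        show "cmod (indicator {\<kappa>..\<mu>} y *\<^sub>R (circ (- j) y * (\<Sum>l\<in>F. z y l))) \<le> e' * indicator {\<kappa>..\<mu>} y"
          using tail[of y] by (auto simp: indicator_def norm_mult)
      qed
      also have "\<dots> = e' * (\<mu> - \<kappa>)" using kl by simp
      also have "\<dots> < e" using e kl by (simp add: e'_def field_simps)
      finally show "dist (\<Sum>l\<in>F. arc_coeff \<gamma> \<delta> l * (arc_coeff \<alpha> \<beta> (i - l) * arc_coeff \<kappa> \<mu> (j - n * l))) 0 < e"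
        by (simp add: dist_norm)
    qed
    then show "\<forall>\<^sub>F F in finite_subsets_at_top UNIV.
        dist (\<Sum>l\<in>F. arc_coeff \<gamma> \<delta> l * (arc_coeff \<alpha> \<beta> (i - l) * arc_coeff \<kappa> \<mu> (j - n * l))) 0 < e"
      unfolding eventually_finite_subsets_at_top using F0 by blast
  qed
qed

section \<open>Elementary matrices generate the special linear group\<close>

abbreviation elem :: "nat \<Rightarrow> nat \<Rightarrow> nat \<Rightarrow> int \<Rightarrow> int mat" where
  "elem n i j a \<equiv> addrow_mat n a i j"

lemma SL_int_simps [simp]:
  "carrier (SL_int n) = {A \<in> carrier_mat n n. Determinant.det A = 1}"
  "A \<otimes>\<^bsub>SL_int n\<^esub> B = A * B"
  "\<one>\<^bsub>SL_int n\<^esub> = 1\<^sub>m n"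
  by (simp_all add: SL_int_def)

lemma elem_SL [simp]: "i \<noteq> j \<Longrightarrow> Determinant.det (elem n i j a) = 1"
  by (rule det_addrow_mat)

lemma elem_mult: "A \<in> carrier_mat n k \<Longrightarrow> j < n \<Longrightarrow> elem n i j a * A = addrow a i j A"
  by (rule addrow_mat[symmetric])

lemma elem_mult_index:
  assumes "A \<in> carrier_mat n k" "j < n" "r < n" "s < k"
  shows "(elem n i j a * A) $$ (r, s) = (if r = i then a * A $$ (j, s) + A $$ (r, s) else A $$ (r, s))"
  using assms by (auto simp: elem_mult)

lemma elem_index:
  assumes "r < n" "s < n" "i \<noteq> j"
  shows "elem n i j a $$ (r, s) = (if r = s then 1 else if r = i \<and> s = j then a else 0)"
  using assms by auto

lemma elem_mult_elem_index:
  assumes "j < n" "r < n" "s < n" "k \<noteq> l"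
  shows "(elem n i j a * elem n k l b) $$ (r, s) =
    (if r = i then a * (if j = s then 1 else if j = k \<and> s = l then b else 0) else 0) +
    (if r = s then 1 else if r = k \<and> s = l then b else 0)"
  unfolding elem_mult_index[OF addrow_mat_carrier assms(1-3)] elem_index[OF assms(1,3,4)]
    elem_index[OF assms(2,3,4)] by simp

lemma elem_add: "i \<noteq> j \<Longrightarrow> j < n \<Longrightarrow> elem n i j a * elem n i j b = elem n i j (a + b)"
  by (rule eq_matI) (auto simp: elem_mult_elem_index elem_index simp del: index_mult_mat(1) index_mat_addrow_mat(1))

lemma elem_zero: "i \<noteq> j \<Longrightarrow> elem n i j 0 = 1\<^sub>m n"
  by (rule eq_matI) (auto simp: elem_index simp del: index_mat_addrow_mat(1))

lemma elem_commute:
  assumes "i \<noteq> j" "k \<noteq> l" "j < n" "l < n" "j \<noteq> k" "l \<noteq> i"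
  shows "elem n i j a * elem n k l b = elem n k l b * elem n i j a"
proof (rule eq_matI)
  fix r s assume "r < dim_row (elem n k l b * elem n i j a)" "s < dim_col (elem n k l b * elem n i j a)"
  then have rs: "r < n" "s < n" by auto
  show "(elem n i j a * elem n k l b) $$ (r, s) = (elem n k l b * elem n i j a) $$ (r, s)"
    unfolding elem_mult_elem_index[OF assms(3) rs assms(2)] elem_mult_elem_index[OF assms(4) rs assms(1)]
    using assms(1,2,5,6) by presburger
qed auto

text \<open>The Steinberg relation, written as a rule that moves \<open>E\<^sub>j\<^sub>k\<close> to the left of \<open>E\<^sub>i\<^sub>j\<close>.\<close>

lemma elem_steinberg:
  assumes "i \<noteq> j" "j \<noteq> k" "i \<noteq> k" "j < n" "k < n"
  shows "elem n i j a * elem n j k b = elem n j k b * (elem n i j a * elem n i k (a * b))"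
proof (rule eq_matI)
  fix r s assume "r < dim_row (elem n j k b * (elem n i j a * elem n i k (a * b)))"
    "s < dim_col (elem n j k b * (elem n i j a * elem n i k (a * b)))"
  then have rs: "r < n" "s < n" by auto
  have c: "elem n i j a * elem n i k (a * b) \<in> carrier_mat n n" by (rule mult_carrier_mat) auto
  show "(elem n i j a * elem n j k b) $$ (r, s) = (elem n j k b * (elem n i j a * elem n i k (a * b))) $$ (r, s)"
    unfolding elem_mult_index[OF c assms(5) rs] elem_mult_elem_index[OF assms(4) rs assms(2)]
      elem_mult_elem_index[OF assms(4) rs assms(3)] elem_mult_elem_index[OF assms(4) assms(5) rs(2) assms(3)]
    using assms(1-3) by presburger
qed auto

lemma SL_inv_elem: "i \<noteq> j \<Longrightarrow> j < n \<Longrightarrow> inv\<^bsub>SL_int n\<^esub> (elem n i j a) = elem n i j (- a)"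
  by (rule group.inv_equality[OF group_SL_int]) (auto simp: elem_add elem_zero)

definition first_cols_id :: "nat \<Rightarrow> nat \<Rightarrow> int mat \<Rightarrow> bool" where
  "first_cols_id n k A \<longleftrightarrow> A \<in> carrier_mat n n \<and> Determinant.det A = 1 \<and>
     (\<forall>j<k. \<forall>i<n. A $$ (i, j) = (if i = j then 1 else 0))"

lemma first_cols_id_elem:
  assumes A: "first_cols_id n k A" and ij: "i \<noteq> j" "k \<le> j" "j < n" "k \<le> n"
  shows "first_cols_id n k (elem n i j a * A)"
proof -
  have c: "A \<in> carrier_mat n n" using A by (simp add: first_cols_id_def)
  have d: "Determinant.det (elem n i j a * A) = 1"
    using A ij det_mult[of "elem n i j a" n A] by (simp add: first_cols_id_def)
  have "(elem n i j a * A) $$ (r, s) = (if r = s then 1 else 0)" if "s < k" "r < n" for r s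
  proof -
    have "s < n" using that ij by simp
    then show ?thesis using A that ij unfolding elem_mult_index[OF c ij(3) that(2) \<open>s < n\<close>]
      by (auto simp: first_cols_id_def)
  qed
  then show ?thesis using c d by (auto simp: first_cols_id_def)
qed

text \<open>The inverse matrix is integral, its \<open>k\<close>-th row vanishes before the diagonal, and the pairing of this
  row with the \<open>k\<close>-th column is 1. Only the pivot contributes to this pairing, so it divides 1.\<close>

lemma column_pivot_unit:
  assumes A: "first_cols_id n k A" and k: "k < n"
    and zero: "\<And>i. k \<le> i \<Longrightarrow> i < n \<Longrightarrow> i \<noteq> r \<Longrightarrow> A $$ (i, k) = 0" and r: "k \<le> r" "r < n"
  shows "A $$ (r, k) = 1 \<or> A $$ (r, k) = - 1"
proof -
  have c: "A \<in> carrier (SL_int n)" using A by (simp add: first_cols_id_def)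
  obtain B where B: "B \<in> carrier_mat n n" "B * A = 1\<^sub>m n"
    using group.inv_closed[OF group_SL_int c] group.l_inv[OF group_SL_int c] by auto
  have idx: "(B * A) $$ (k, j) = (\<Sum>i<n. B $$ (k, i) * A $$ (i, j))" if "j < n" for j
  proof -
    have "dim_row B = n" "dim_col B = n" "dim_row A = n" "dim_col A = n" using B(1) c by auto
    then show ?thesis using k that by (simp add: scalar_prod_def lessThan_atLeast0)
  qed
  have Bk: "B $$ (k, j) = 0" if "j < k" for j
  proof -
    have "(B * A) $$ (k, j) = (\<Sum>i<n. if i = j then B $$ (k, j) else 0)"
      unfolding idx[OF less_trans[OF that k]] using A that k
      by (intro sum.cong refl) (auto simp: first_cols_id_def)
    then show ?thesis using B(2) that k by simp
  qed
  have "B $$ (k, i) * A $$ (i, k) = (if i = r then B $$ (k, r) * A $$ (r, k) else 0)" if "i < n" for i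
    using Bk[of i] zero[of i] that by (cases "i < k") auto
  then have "(B * A) $$ (k, k) = (\<Sum>i<n. if i = r then B $$ (k, r) * A $$ (r, k) else 0)"
    unfolding idx[OF k] by (intro sum.cong refl) simp
  then have "B $$ (k, r) * A $$ (r, k) = 1" using B(2) k r by simp
  then show ?thesis by (metis dvd_triv_right zdvd1_eq abs_eq_iff abs_1)
qed

text \<open>In a matrix whose first columns are those of the identity, the Euclidean
  algorithm on the entries of the next column, from the diagonal downwards, leaves a single
  nonzero entry, which is \<open>1\<close> or \<open>-1\<close>. Three row operations turn \<open>-1\<close> into \<open>1\<close> on the diagonal, with
  the help of the next row; in the last column the determinant excludes \<open>-1\<close>.\<close>

context
  fixes n :: nat and P :: "int mat \<Rightarrow> bool"
  assumes one: "P (1\<^sub>m n)"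
    and elem_step: "\<And>A i j a. A \<in> carrier_mat n n \<Longrightarrow> Determinant.det A = 1 \<Longrightarrow> i < n \<Longrightarrow> j < n \<Longrightarrow> i \<noteq> j \<Longrightarrow>
      P (elem n i j a * A) \<Longrightarrow> P A"
begin

lemma first_cols_id_step:
  assumes "first_cols_id n k A" "i \<noteq> j" "i < n" "k \<le> j" "j < n" "P (elem n i j a * A)"
  shows "P A"
  using elem_step[of A i j a] assms by (auto simp: first_cols_id_def)

lemma reduce_above:
  assumes IH: "\<And>A. first_cols_id n (Suc k) A \<Longrightarrow> P A"
    and k: "k < n" and A: "first_cols_id n k A" and kk: "A $$ (k, k) = 1"
    and below: "\<And>i. k < i \<Longrightarrow> i < n \<Longrightarrow> A $$ (i, k) = 0"
  shows "P A"
  using A kk below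
proof (induction "card {i. i < k \<and> A $$ (i, k) \<noteq> 0}" arbitrary: A rule: less_induct)
  case (less A)
  show ?case
  proof (cases "\<exists>i<k. A $$ (i, k) \<noteq> 0")
    case True
    then obtain i where i: "i < k" "A $$ (i, k) \<noteq> 0" by blast
    define B where "B = elem n i k (- A $$ (i, k)) * A"
    have c: "A \<in> carrier_mat n n" using less.prems(1) by (simp add: first_cols_id_def)
    have B_idx: "B $$ (r, k) = (if r = i then 0 else A $$ (r, k))" if "r < n" for r
      unfolding B_def elem_mult_index[OF c k that k] using less.prems(2) by simp
    have B: "first_cols_id n k B"
      unfolding B_def using less.prems(1) i k by (intro first_cols_id_elem) auto
    have "P B"
    proof (rule less.hyps[OF _ B])
      show "card {i. i < k \<and> B $$ (i, k) \<noteq> 0} < card {i. i < k \<and> A $$ (i, k) \<noteq> 0}"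
      proof (rule psubset_card_mono)
        have "{i. i < k \<and> B $$ (i, k) \<noteq> 0} \<subseteq> {i. i < k \<and> A $$ (i, k) \<noteq> 0}"
          using k B_idx by (auto split: if_splits)
        moreover have "i \<notin> {i. i < k \<and> B $$ (i, k) \<noteq> 0}" using i k B_idx[of i] by simp
        ultimately show "{i. i < k \<and> B $$ (i, k) \<noteq> 0} \<subset> {i. i < k \<and> A $$ (i, k) \<noteq> 0}"
          using i by blast
      qed simp
      show "B $$ (k, k) = 1" using B_idx[OF k] i less.prems(2) by simp
      show "B $$ (r, k) = 0" if "k < r" "r < n" for r
        using B_idx[OF that(2)] i that less.prems(3) by simp
    qed
    then show ?thesis
      using first_cols_id_step[OF less.prems(1), of i k] i k unfolding B_def by auto
  next
    case False
    have "first_cols_id n (Suc k) A"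
      using less.prems False unfolding first_cols_id_def
      by (metis less_SucE not_less_iff_gr_or_eq)
    then show ?thesis by (rule IH)
  qed
qed

lemma reduce_column:
  assumes IH: "\<And>A. first_cols_id n (Suc k) A \<Longrightarrow> P A"
    and k: "k < n" and A: "first_cols_id n k A"
  shows "P A"
  using A
proof (induction "nat (\<Sum>i\<in>{k..<n}. \<bar>A $$ (i, k)\<bar>)" arbitrary: A rule: less_induct)
  case (less A)
  note A = less.prems
  have c: "A \<in> carrier_mat n n" using A by (simp add: first_cols_id_def)
  show ?case
  proof (cases "\<exists>p q. k \<le> p \<and> p < n \<and> k \<le> q \<and> q < n \<and> p \<noteq> q \<and> A $$ (p, k) \<noteq> 0 \<and> A $$ (q, k) \<noteq> 0")
    case True
    then obtain p q where pq: "k \<le> p" "p < n" "k \<le> q" "q < n" "p \<noteq> q" "A $$ (p, k) \<noteq> 0" "A $$ (q, k) \<noteq> 0"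
      "\<bar>A $$ (p, k)\<bar> \<le> \<bar>A $$ (q, k)\<bar>" by (metis linorder_le_cases)
    define a where "a = - (sgn (A $$ (p, k)) * sgn (A $$ (q, k)))"
    define B where "B = elem n q p a * A"
    have B_idx: "B $$ (r, k) = (if r = q then a * A $$ (p, k) + A $$ (q, k) else A $$ (r, k))" if "r < n" for r
      unfolding B_def unfolding elem_mult_index[OF c pq(2) that k] by simp
    have B: "first_cols_id n k B"
      unfolding B_def using A pq k by (intro first_cols_id_elem) auto
    have smaller: "\<bar>B $$ (q, k)\<bar> < \<bar>A $$ (q, k)\<bar>"
      using pq B_idx[OF pq(4)] by (auto simp: a_def sgn_if split: if_splits)
    have "(\<Sum>i\<in>{k..<n}. \<bar>B $$ (i, k)\<bar>) < (\<Sum>i\<in>{k..<n}. \<bar>A $$ (i, k)\<bar>)"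
    proof (rule sum_strict_mono_ex1)
      show "\<forall>i\<in>{k..<n}. \<bar>B $$ (i, k)\<bar> \<le> \<bar>A $$ (i, k)\<bar>"
        using smaller B_idx by auto
      show "\<exists>i\<in>{k..<n}. \<bar>B $$ (i, k)\<bar> < \<bar>A $$ (i, k)\<bar>"
        using smaller pq by (intro bexI[of _ q]) auto
    qed simp
    then have "P B"
      by (intro less.hyps B, subst nat_less_eq_zless[OF sum_nonneg]) auto
    then show ?thesis
      using first_cols_id_step[OF A, of q p a] pq unfolding B_def by auto
  next
    case False
    have "\<exists>r. k \<le> r \<and> r < n \<and> (\<forall>i. k \<le> i \<longrightarrow> i < n \<longrightarrow> i \<noteq> r \<longrightarrow> A $$ (i, k) = 0)"
      using False k by (metis le_refl)
    then obtain r where r: "k \<le> r" "r < n" and zero: "\<And>i. k \<le> i \<Longrightarrow> i < n \<Longrightarrow> i \<noteq> r \<Longrightarrow> A $$ (i, k) = 0"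
      by blast
    define d where "d = A $$ (r, k)"
    have d: "d = 1 \<or> d = - 1"
      unfolding d_def by (rule column_pivot_unit[OF A k zero r])
    have dd: "d * d = 1" using d by auto
    note finish = reduce_above[OF IH k]
    consider "r \<noteq> k" | "r = k" "d = 1" | "r = k" "d = - 1" "Suc k < n" | "r = k" "d = - 1" "Suc k = n"
      using d k by linarith
    then show ?thesis
    proof cases
      case 1
      define B where "B = elem n k r d * A"
      define C where "C = elem n r k (- d) * B"
      have B: "first_cols_id n k B" unfolding B_def using A 1 r k by (intro first_cols_id_elem) auto
      have C: "first_cols_id n k C" unfolding C_def using B 1 r k by (intro first_cols_id_elem) auto
      have cB: "B \<in> carrier_mat n n" using B by (simp add: first_cols_id_def)
      have B_idx: "B $$ (i, k) = (if i = k then 1 else if i = r then d else A $$ (i, k))" if "i < n" for i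
        unfolding B_def elem_mult_index[OF c r(2) that k] using zero[of k] 1 k dd by (auto simp: d_def)
      have C_idx: "C $$ (i, k) = (if i = k then 1 else if i = r then 0 else A $$ (i, k))" if "i < n" for i
        unfolding C_def elem_mult_index[OF cB k that k] using B_idx[OF that] B_idx[OF k] 1 by auto
      have "P C"
        using C_idx k zero by (intro finish C) (auto simp: less_imp_le)
      then have "P B" using first_cols_id_step[OF B, of r k "- d"] 1 r k unfolding C_def by auto
      then show ?thesis using first_cols_id_step[OF A, of k r d] 1 r k unfolding B_def by auto
    next
      case 2
      then show ?thesis using zero A d_def by (intro finish) auto
    next
      case 3
      define B where "B = elem n (Suc k) k 1 * A"
      define C where "C = elem n k (Suc k) (- 2) * B"
      define D where "D = elem n (Suc k) k 1 * C"
      have B: "first_cols_id n k B" unfolding B_def using A k 3 by (intro first_cols_id_elem) auto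
      have C: "first_cols_id n k C" unfolding C_def using B k 3 by (intro first_cols_id_elem) auto
      have D: "first_cols_id n k D" unfolding D_def using C k 3 by (intro first_cols_id_elem) auto
      have cB: "B \<in> carrier_mat n n" and cC: "C \<in> carrier_mat n n"
        using B C by (simp_all add: first_cols_id_def)
      have Ak: "A $$ (k, k) = - 1" "A $$ (Suc k, k) = 0" using 3 zero[of "Suc k"] by (auto simp: d_def)
      have B_idx: "B $$ (i, k) = (if i = Suc k then - 1 else A $$ (i, k))" if "i < n" for i
        unfolding B_def elem_mult_index[OF c k that k] using Ak by auto
      have C_idx: "C $$ (i, k) = (if i = k then 1 else if i = Suc k then - 1 else A $$ (i, k))" if "i < n" for i
        unfolding C_def elem_mult_index[OF cB 3(3) that k] using B_idx[OF that] B_idx[OF k] B_idx[OF 3(3)] Ak by auto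
      have D_idx: "D $$ (i, k) = (if i = k then 1 else if i = Suc k then 0 else A $$ (i, k))" if "i < n" for i
        unfolding D_def elem_mult_index[OF cC k that k] using C_idx[OF that] C_idx[OF k] by auto
      have "P D"
        using D_idx k zero 3 by (intro finish D) (auto simp: less_imp_le)
      then have "P C" using first_cols_id_step[OF C, of "Suc k" k 1] 3 k unfolding D_def by auto
      then have "P B" using first_cols_id_step[OF B, of k "Suc k" "- 2"] 3 k unfolding C_def by auto
      then show ?thesis using first_cols_id_step[OF A, of "Suc k" k 1] 3 k unfolding B_def by auto
    next
      case 4
      have "upper_triangular A"
        using A 4 c by (auto simp: first_cols_id_def)
      then have "Determinant.det A = prod_list (diag_mat A)" by (rule det_upper_triangular[OF _ c])
      also have "diag_mat A = map (\<lambda>i. if i = k then - 1 else 1) [0..<Suc k]"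
        unfolding diag_mat_def using A 4 c d_def by (auto simp: first_cols_id_def)
      also have "map (\<lambda>i. if i = k then - 1 else 1) [0..<Suc k] = map (\<lambda>_. 1 :: int) [0..<k] @ [- 1]"
        by simp
      also have "prod_list \<dots> = - 1" by (simp add: map_replicate_const)
      finally show ?thesis using A by (simp add: first_cols_id_def)
    qed
  qed
qed

lemma SL_induct:
  assumes A: "A \<in> carrier_mat n n" "Determinant.det A = 1"
  shows "P A"
proof -
  have "P A" if "k \<le> n" "first_cols_id n k A" for k A
    using that
  proof (induction "n - k" arbitrary: k A)
    case 0
    then have "A = 1\<^sub>m n" by (intro eq_matI) (auto simp: first_cols_id_def)
    then show ?case using one by simp
  next
    case (Suc d)
    then have k: "k < n" "d = n - Suc k" by auto
    show ?case
      by (rule reduce_column[OF _ k(1) Suc.prems(2)]) (use Suc.hyps(1)[of "Suc k"] k in auto)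
  qed
  from this[of 0 A] show ?thesis using A by (simp add: first_cols_id_def)
qed

end

lemma elementary_matrices_generate_SL:
  assumes K: "subgroup K (SL_int n)"
    and elem: "\<And>i j. i < n \<Longrightarrow> j < n \<Longrightarrow> i \<noteq> j \<Longrightarrow> elem n i j 1 \<in> K"
  shows "K = carrier (SL_int n)"
proof
  show "K \<subseteq> carrier (SL_int n)" by (rule subgroup.subset[OF K])
  have mult: "A * B \<in> K" if "A \<in> K" "B \<in> K" for A B
    using subgroup.m_closed[OF K that] by simp
  have one: "1\<^sub>m n \<in> K" using subgroup.one_closed[OF K] by simp
  have elem_nat: "elem n i j (int a) \<in> K" if "i < n" "j < n" "i \<noteq> j" for i j a
  proof (induction a)
    case (Suc a)
    have "elem n i j (int (Suc a)) = elem n i j (int a) * elem n i j 1"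
      using that by (simp add: elem_add add.commute)
    then show ?case using mult[OF Suc elem[OF that]] by simp
  qed (use that one in \<open>simp add: elem_zero\<close>)
  have elem_int: "elem n i j a \<in> K" if ij: "i < n" "j < n" "i \<noteq> j" for i j a
  proof (cases a rule: int_cases2)
    case (nonneg m)
    then show ?thesis using elem_nat[OF ij] by simp
  next
    case (nonpos m)
    have "inv\<^bsub>SL_int n\<^esub> (elem n i j (int m)) \<in> K"
      by (rule subgroup.m_inv_closed[OF K elem_nat[OF ij]])
    then show ?thesis using ij nonpos by (simp add: SL_inv_elem)
  qed
  show "carrier (SL_int n) \<subseteq> K"
  proof
    fix A assume "A \<in> carrier (SL_int n)"
    then have A: "A \<in> carrier_mat n n" "Determinant.det A = 1" by auto
    show "A \<in> K"
    proof (rule SL_induct[where P = "\<lambda>A. A \<in> K", OF one _ A])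
      fix A i j a
      assume A: "A \<in> carrier_mat n n" and ij: "i < n" "j < n" "i \<noteq> j" and EA: "elem n i j a * A \<in> K"
      have "elem n i j (- a) * (elem n i j a * A) = (elem n i j (- a) * elem n i j a) * A"
        using A by (intro assoc_mult_mat[symmetric]) auto
      also have "\<dots> = A" using A ij by (simp add: elem_add elem_zero)
      finally show "A \<in> K" using mult[OF elem_int[OF ij] EA, of "- a"] by simp
    qed
  qed
qed

section \<open>Generation by a cyclic permutation and two involutions\<close>

text \<open>The permutation matrix of \<open>i \<mapsto> i + k\<close> modulo \<open>n\<close>. The exponent is an integer, so that \<open>cyc n\<close> is a
  homomorphism from the integers.\<close>

definition cyc :: "nat \<Rightarrow> int \<Rightarrow> int mat" where
  "cyc n k = Matrix.mat n n (\<lambda>(i, j). if int i = (int j + k) mod int n then 1 else 0)"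

definition dg :: "nat \<Rightarrow> (nat \<Rightarrow> int) \<Rightarrow> int mat" where
  "dg n s = Matrix.mat n n (\<lambda>(i, j). if i = j then s i else 0)"

lemma cyc_carrier [simp]: "cyc n k \<in> carrier_mat n n" and dg_carrier [simp]: "dg n s \<in> carrier_mat n n"
  by (simp_all add: cyc_def dg_def)

lemma mult_index_sum:
  assumes "A \<in> carrier_mat n k" "B \<in> carrier_mat k l" "i < n" "j < l"
  shows "(A * B) $$ (i, j) = (\<Sum>r<k. A $$ (i, r) * B $$ (r, j))"
proof -
  have "dim_row A = n" "dim_col A = k" "dim_row B = k" "dim_col B = l" using assms by auto
  then show ?thesis using assms by (simp add: scalar_prod_def lessThan_atLeast0)
qed

lemma mod_shift_less: "0 < n \<Longrightarrow> nat ((int j + k) mod int n) < n"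
  by (simp add: nat_less_iff)

lemma mult_cyc_index:
  assumes A: "A \<in> carrier_mat n n" and ij: "i < n" "j < n"
  shows "(A * cyc n k) $$ (i, j) = A $$ (i, nat ((int j + k) mod int n))"
proof -
  have n: "0 < n" using ij by simp
  have "(A * cyc n k) $$ (i, j) = (\<Sum>r<n. A $$ (i, r) * cyc n k $$ (r, j))"
    by (rule mult_index_sum[OF A cyc_carrier ij])
  also have "\<dots> = (\<Sum>r<n. if r = nat ((int j + k) mod int n) then A $$ (i, r) else 0)"
    using ij n by (intro sum.cong refl) (auto simp: cyc_def nat_eq_iff)
  also have "\<dots> = A $$ (i, nat ((int j + k) mod int n))"
    using mod_shift_less[OF n] by simp
  finally show ?thesis .
qed

lemma cyc_mult_index:
  assumes A: "A \<in> carrier_mat n n" and ij: "i < n" "j < n"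
  shows "(cyc n k * A) $$ (nat ((int i + k) mod int n), j) = A $$ (i, j)"
proof -
  have n: "0 < n" using ij by simp
  have shift: "(int i + k) mod int n = (int r + k) mod int n \<longleftrightarrow> r = i" if "r < n" for r
  proof
    assume "(int i + k) mod int n = (int r + k) mod int n"
    then have "(int i + k - k) mod int n = (int r + k - k) mod int n" by (metis mod_diff_left_eq)
    then show "r = i" using that ij by simp
  qed simp
  have "(cyc n k * A) $$ (nat ((int i + k) mod int n), j) =
      (\<Sum>r<n. cyc n k $$ (nat ((int i + k) mod int n), r) * A $$ (r, j))"
    by (rule mult_index_sum[OF cyc_carrier A mod_shift_less[OF n] ij(2)])
  also have "\<dots> = (\<Sum>r<n. if r = i then A $$ (r, j) else 0)"
    using shift mod_shift_less[OF n, of i k] n by (intro sum.cong refl) (auto simp: cyc_def)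
  also have "\<dots> = A $$ (i, j)" using ij by simp
  finally show ?thesis .
qed

lemma cyc_add: "cyc n k * cyc n l = cyc n (k + l)"
proof (rule eq_matI)
  fix i j assume "i < dim_row (cyc n (k + l))" "j < dim_col (cyc n (k + l))"
  then have ij: "i < n" "j < n" by (auto simp: cyc_def)
  then have n: "0 < n" by simp
  have "(int (nat ((int j + l) mod int n)) + k) mod int n = (int j + (k + l)) mod int n"
    using n by (simp add: mod_add_right_eq add_ac)
  then show "(cyc n k * cyc n l) $$ (i, j) = cyc n (k + l) $$ (i, j)"
    unfolding mult_cyc_index[OF cyc_carrier ij] using ij mod_shift_less[OF n] by (simp add: cyc_def)
qed (simp_all add: cyc_def)

lemma cyc_zero: "cyc n 0 = 1\<^sub>m n"
  by (rule eq_matI) (auto simp: cyc_def)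

lemma cyc_full: "cyc n (int n) = 1\<^sub>m n"
  by (rule eq_matI) (auto simp: cyc_def)

text \<open>The determinant of the cyclic permutation matrix is an \<open>n\<close>-th root of unity in the integers.\<close>

lemma det_cyc_one:
  assumes "odd n" shows "Determinant.det (cyc n 1) = 1"
proof -
  have pow: "Determinant.det (cyc n (int k)) = Determinant.det (cyc n 1) ^ k" for k
  proof (induction k)
    case (Suc k)
    have "cyc n (int (Suc k)) = cyc n (int k) * cyc n 1" by (simp add: cyc_add add.commute)
    then show ?case using Suc det_mult[of "cyc n (int k)" n "cyc n 1"] by simp
  qed (simp add: cyc_zero)
  have "Determinant.det (cyc n 1) ^ n = 1" using pow[of n] by (simp add: cyc_full)
  moreover have "0 < n" using assms by (metis even_zero gr0I)
  ultimately have "Determinant.det (cyc n 1) dvd 1"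
    using dvd_power[of n "Determinant.det (cyc n 1)"] by simp
  then have "\<bar>Determinant.det (cyc n 1)\<bar> = 1" by simp
  then show ?thesis
    using \<open>Determinant.det (cyc n 1) ^ n = 1\<close> assms by (auto simp: abs_if split: if_splits)
qed

lemma det_cyc:
  assumes "odd n" shows "Determinant.det (cyc n k) = 1"
proof -
  have n: "0 < n" using assms by (metis even_zero gr0I)
  have pow: "Determinant.det (cyc n (int k)) = 1" for k
  proof (induction k)
    case (Suc k)
    have "cyc n (int (Suc k)) = cyc n (int k) * cyc n 1" by (simp add: cyc_add add.commute)
    then show ?case using Suc det_mult[of "cyc n (int k)" n "cyc n 1"] det_cyc_one[OF assms] by simp
  qed (simp add: cyc_zero)
  have "cyc n k = cyc n (int (nat (k mod int n)))"
    using n by (simp add: cyc_def mod_add_right_eq)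
  then show ?thesis using pow by metis
qed

lemma cyc_one_param: "odd n \<Longrightarrow> group.one_param (SL_int n) (cyc n)"
  by (simp add: group.one_param_def[OF group_SL_int] det_cyc cyc_add)

lemma dg_mult_index:
  assumes A: "A \<in> carrier_mat n n" and ij: "i < n" "j < n"
  shows "(dg n s * A) $$ (i, j) = s i * A $$ (i, j)" "(A * dg n s) $$ (i, j) = A $$ (i, j) * s j"
proof -
  have "(dg n s * A) $$ (i, j) = (\<Sum>r<n. if r = i then s i * A $$ (r, j) else 0)"
    unfolding mult_index_sum[OF dg_carrier A ij] using ij by (intro sum.cong refl) (auto simp: dg_def)
  then show "(dg n s * A) $$ (i, j) = s i * A $$ (i, j)" using ij by simp
  have "(A * dg n s) $$ (i, j) = (\<Sum>r<n. if r = j then A $$ (i, r) * s j else 0)"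
    unfolding mult_index_sum[OF A dg_carrier ij] using ij by (intro sum.cong refl) (auto simp: dg_def)
  then show "(A * dg n s) $$ (i, j) = A $$ (i, j) * s j" using ij by simp
qed

lemma dg_mult: "dg n s * dg n t = dg n (\<lambda>i. s i * t i)"
proof (rule eq_matI)
  fix i j assume "i < dim_row (dg n (\<lambda>i. s i * t i))" "j < dim_col (dg n (\<lambda>i. s i * t i))"
  then have ij: "i < n" "j < n" by (auto simp: dg_def)
  show "(dg n s * dg n t) $$ (i, j) = dg n (\<lambda>i. s i * t i) $$ (i, j)"
    unfolding dg_mult_index[OF dg_carrier ij] using ij by (simp add: dg_def)
qed (simp_all add: dg_def)

lemma dg_one: "dg n (\<lambda>i. 1) = 1\<^sub>m n"
  by (rule eq_matI) (auto simp: dg_def)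

lemma dg_elem:
  assumes ij: "i \<noteq> j" and s: "\<And>r. s r * s r = 1"
  shows "dg n s * elem n i j a = elem n i j (s i * s j * a) * dg n s"
proof (rule eq_matI)
  fix r q assume "r < dim_row (elem n i j (s i * s j * a) * dg n s)" "q < dim_col (elem n i j (s i * s j * a) * dg n s)"
  then have rq: "r < n" "q < n" by (auto simp: dg_def)
  have "s i * s j * a * s j = s i * a" using s[of j] by (metis mult.assoc mult.commute mult_1)
  then show "(dg n s * elem n i j a) $$ (r, q) = (elem n i j (s i * s j * a) * dg n s) $$ (r, q)"
    unfolding dg_mult_index(1)[OF addrow_mat_carrier rq] dg_mult_index(2)[OF addrow_mat_carrier rq]
      elem_index[OF rq ij] by auto
qed (simp_all add: dg_def)

lemma suc_mod_inj: "p < n \<Longrightarrow> q < n \<Longrightarrow> Suc p mod n = Suc q mod n \<longleftrightarrow> p = q"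
  by (auto simp: mod_Suc split: if_splits)

lemma nat_suc_mod: "nat ((int p + 1) mod int n) = Suc p mod n"
  by (metis nat_int of_nat_Suc zmod_int add.commute)

lemma ex_suc_mod: "r < n \<Longrightarrow> \<exists>p<n. r = Suc p mod n"
proof (cases r)
  case 0
  assume "r < n"
  then show ?thesis using 0 by (intro exI[of _ "n - 1"]) auto
next
  case (Suc m)
  assume "r < n"
  then show ?thesis using Suc by (intro exI[of _ m]) auto
qed

lemma cyc_elem:
  assumes ij: "i \<noteq> j" "i < n" "j < n"
  shows "cyc n 1 * elem n i j a = elem n (Suc i mod n) (Suc j mod n) a * cyc n 1"
proof (rule eq_matI)
  fix r q assume "r < dim_row (elem n (Suc i mod n) (Suc j mod n) a * cyc n 1)"
    "q < dim_col (elem n (Suc i mod n) (Suc j mod n) a * cyc n 1)"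
  then have rq: "r < n" "q < n" by (auto simp: cyc_def)
  obtain p where p: "p < n" "r = Suc p mod n" using ex_suc_mod[OF rq(1)] by blast
  have q': "Suc q mod n < n" using rq by simp
  have ij': "Suc i mod n \<noteq> Suc j mod n" using ij by (simp add: suc_mod_inj)
  have "(cyc n 1 * elem n i j a) $$ (r, q) = elem n i j a $$ (p, q)"
    using cyc_mult_index[OF addrow_mat_carrier p(1) rq(2), of 1] unfolding nat_suc_mod p(2) .
  also have "\<dots> = elem n (Suc i mod n) (Suc j mod n) a $$ (r, Suc q mod n)"
    unfolding elem_index[OF p(1) rq(2) ij(1)] elem_index[OF rq(1) q' ij']
    using p rq ij by (simp add: suc_mod_inj)
  also have "\<dots> = (elem n (Suc i mod n) (Suc j mod n) a * cyc n 1) $$ (r, q)"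
    unfolding mult_cyc_index[OF addrow_mat_carrier rq] nat_suc_mod ..
  finally show "(cyc n 1 * elem n i j a) $$ (r, q) = (elem n (Suc i mod n) (Suc j mod n) a * cyc n 1) $$ (r, q)" .
qed (simp_all add: cyc_def)

lemma cyc_dg:
  assumes s: "\<And>p. p < n \<Longrightarrow> t (Suc p mod n) = s p"
  shows "cyc n 1 * dg n s = dg n t * cyc n 1"
proof (rule eq_matI)
  fix r q assume "r < dim_row (dg n t * cyc n 1)" "q < dim_col (dg n t * cyc n 1)"
  then have rq: "r < n" "q < n" by (auto simp: cyc_def dg_def)
  obtain p where p: "p < n" "r = Suc p mod n" using ex_suc_mod[OF rq(1)] by blast
  have q': "Suc q mod n < n" using rq by simp
  have "(cyc n 1 * dg n s) $$ (r, q) = dg n s $$ (p, q)"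
    using cyc_mult_index[OF dg_carrier p(1) rq(2), of 1] unfolding nat_suc_mod p(2) .
  also have "\<dots> = dg n t $$ (r, Suc q mod n)"
    using p rq q' s[OF p(1)] by (auto simp: dg_def suc_mod_inj)
  also have "\<dots> = (dg n t * cyc n 1) $$ (r, q)"
    unfolding mult_cyc_index[OF dg_carrier rq] nat_suc_mod ..
  finally show "(cyc n 1 * dg n s) $$ (r, q) = (dg n t * cyc n 1) $$ (r, q)" .
qed (simp_all add: cyc_def dg_def)

lemma subgroup_SL_elem_steinberg:
  assumes K: "subgroup K (SL_int n)" and ijk: "i \<noteq> j" "j \<noteq> k" "i \<noteq> k" "j < n" "k < n"
    and mem: "elem n i j 1 \<in> K" "elem n j k 1 \<in> K"
  shows "elem n i k 1 \<in> K"
proof -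
  interpret group "SL_int n" by (rule group_SL_int)
  let ?p = "elem n i j 1" and ?q = "elem n j k 1" and ?z = "elem n i k 1"
  have c: "?p \<in> carrier (SL_int n)" "?q \<in> carrier (SL_int n)" "?z \<in> carrier (SL_int n)"
    using ijk by simp_all
  have "?p \<otimes>\<^bsub>SL_int n\<^esub> ?q = ?q \<otimes>\<^bsub>SL_int n\<^esub> (?p \<otimes>\<^bsub>SL_int n\<^esub> ?z)"
    using elem_steinberg[OF ijk, of 1 1] by simp
  then have "?z = inv\<^bsub>SL_int n\<^esub> ?p \<otimes>\<^bsub>SL_int n\<^esub> (inv\<^bsub>SL_int n\<^esub> ?q \<otimes>\<^bsub>SL_int n\<^esub> (?p \<otimes>\<^bsub>SL_int n\<^esub> ?q))"
    using c by (metis inv_closed inv_solve_left m_closed)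
  then show ?thesis
    using mem K by (metis subgroup.m_closed subgroup.m_inv_closed)
qed

text \<open>The involution \<open>x\<close> changes the signs of the coordinates \<open>0\<close> and \<open>1\<close>, and \<open>x'\<close> is its conjugate by the cycle,
  with the signs at \<open>1\<close> and \<open>2\<close>. The product \<open>x x'\<close> inverts \<open>E\<^sub>0\<^sub>1\<close> under conjugation, which makes \<open>y = E\<^sub>0\<^sub>1 x x'\<close>
  an involution; \<open>x\<close> fixes \<open>E\<^sub>0\<^sub>1\<close>, which makes it commute with \<open>y\<close>. Conversely, the cycle and \<open>x\<close> give \<open>x'\<close>, then \<open>y\<close>
  gives \<open>E\<^sub>0\<^sub>1\<close>, its conjugates by the cycle are the \<open>E\<^sub>i\<^sub>j\<close> with \<open>j = i + 1\<close> modulo \<open>n\<close>, and commutators of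
  these are the other ones.\<close>

lemma SL_singly_generated:
  assumes n: "3 \<le> n" "odd n"
  shows "singly_generated (carrier (SL_int n)) (group_vna (SL_int n))"
proof -
  interpret G: group "SL_int n" by (rule group_SL_int)
  define s where "s i = (if i < (2 :: nat) then - 1 else 1 :: int)" for i
  define t where "t i = (if i = 1 \<or> i = (2 :: nat) then - 1 else 1 :: int)" for i
  define x where "x = dg n s"
  define x' where "x' = dg n t"
  define y where "y = elem n 0 1 1 * (x * x')"
  have c [simp]: "x \<in> carrier_mat n n" "x' \<in> carrier_mat n n" by (simp_all add: x_def x'_def)
  have conj: "cyc n 1 * x = x' * cyc n 1"
    unfolding x_def x'_def
  proof (rule cyc_dg)
    fix p assume "p < n"
    then consider "Suc p < n" | "Suc p = n" by linarith
    then show "t (Suc p mod n) = s p" using n by cases (auto simp: s_def t_def)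
  qed
  have det_x: "Determinant.det x = 1"
  proof -
    have "Determinant.det x = prod_list (diag_mat x)"
      by (rule det_upper_triangular[of _ n]) (auto simp: x_def dg_def)
    also have "diag_mat x = map s [0..<n]" by (auto simp: diag_mat_def x_def dg_def)
    also have "[0..<n] = [0, 1] @ [2..<n]"
      using n upt_conv_Cons[of 0 n] upt_conv_Cons[of 1 n] by (simp add: numeral_2_eq_2)
    also have "prod_list (map s ([0, 1] @ [2..<n])) = 1"
    proof -
      have "map s [2..<n] = map (\<lambda>_. 1) [2..<n]" by (rule map_cong) (auto simp: s_def)
      then have "prod_list (map s [2..<n]) = 1" by (simp only: map_replicate_const prod_list_replicate power_one)
      moreover have "s 0 = - 1" "s 1 = - 1" by (simp_all add: s_def)
      ultimately show ?thesis by simp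
    qed
    finally show ?thesis .
  qed
  have det_x': "Determinant.det x' = 1"
    using arg_cong[OF conj, of Determinant.det] det_mult[of "cyc n 1" n x] det_mult[of x' n "cyc n 1"] det_x det_cyc_one[OF n(2)]
    by simp
  have xx: "x * x = 1\<^sub>m n" "x' * x' = 1\<^sub>m n"
    unfolding x_def x'_def dg_mult dg_one[symmetric]
    by (rule arg_cong[of _ _ "dg n"]; auto simp: s_def t_def)+
  have xs: "x * x' = dg n (\<lambda>i. s i * t i)" "x' * x = x * x'"
    by (simp_all add: x_def x'_def dg_mult mult.commute)
  have SL: "x \<in> carrier (SL_int n)" "x' \<in> carrier (SL_int n)" "elem n 0 1 a \<in> carrier (SL_int n)"
    "cyc n k \<in> carrier (SL_int n)" for a k
    using det_x det_x' det_cyc[OF n(2)] by simp_all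
  have y_SL: "y \<in> carrier (SL_int n)"
    using G.m_closed[OF SL(3) G.m_closed[OF SL(1,2)], of 1] by (simp add: y_def)
  have flip: "(x * x') * elem n 0 1 a = elem n 0 1 (- a) * (x * x')" for a
    unfolding xs(1) by (subst dg_elem) (auto simp: s_def t_def)
  have x_elem: "x * elem n 0 1 a = elem n 0 1 a * x" for a
    unfolding x_def by (subst dg_elem) (auto simp: s_def)
  have sig: "(x * x') * (x * x') = 1\<^sub>m n"
    unfolding xs(1) dg_mult dg_one[symmetric] by (rule arg_cong[of _ _ "dg n"]) (auto simp: s_def t_def)
  have sig_SL: "x * x' \<in> carrier (SL_int n)" using G.m_closed[OF SL(1,2)] by simp
  have yy: "y * y = 1\<^sub>m n"
  proof -
    let ?e = "elem n 0 1 1" and ?g = "x * x'"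
    have "y * y = ?e * ((?g * ?e) * ?g)"
      using G.m_assoc[of ?e ?g "?e * ?g"] G.m_assoc[of ?g ?e ?g] SL(3)[of 1] sig_SL G.m_closed[OF SL(3)[of 1] sig_SL]
      by (simp add: y_def)
    also have "\<dots> = ?e * (elem n 0 1 (- 1) * (?g * ?g))"
      unfolding flip using G.m_assoc[OF SL(3)[of "- 1"] sig_SL sig_SL] by simp
    also have "\<dots> = 1\<^sub>m n" unfolding sig using n by (simp add: elem_add elem_zero)
    finally show ?thesis .
  qed
  have xy: "x * y = y * x"
  proof -
    let ?e = "elem n 0 1 1" and ?g = "x * x'"
    have "x * y = (x * ?e) * ?g"
      using G.m_assoc[OF SL(1) SL(3)[of 1] sig_SL] by (simp add: y_def)
    also have "\<dots> = ?e * (x * ?g)"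
      unfolding x_elem using G.m_assoc[OF SL(3)[of 1] SL(1) sig_SL] by simp
    also have "x * ?g = ?g * x"
      using G.m_assoc[OF SL(1) SL(2) SL(1)] xs(2) by simp
    also have "?e * (?g * x) = y * x"
      using G.m_assoc[OF SL(3)[of 1] sig_SL SL(1)] by (simp add: y_def)
    finally show ?thesis .
  qed
  show ?thesis
  proof (rule G.singly_generated_by_odd_cycle_and_involutions[OF cyc_one_param[OF n(2)] _ n(2), of x y])
    fix K assume K: "subgroup K (SL_int n)" and cK: "cyc n 1 \<in> K" and xK: "x \<in> K" and yK: "y \<in> K"
    have mult: "A * B \<in> K" if "A \<in> K" "B \<in> K" for A B using subgroup.m_closed[OF K that] by simp
    have inv_cyc: "cyc n (- 1) \<in> K"
      using subgroup.m_inv_closed[OF K cK] G.one_param_minus[OF cyc_one_param[OF n(2)], of 1] by simp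
    have conjK: "B \<in> K" if AK: "A \<in> K" and B: "B \<in> carrier_mat n n" and eq: "cyc n 1 * A = B * cyc n 1" for A B
    proof -
      have "B = (B * cyc n 1) * cyc n (- 1)"
        using B assoc_mult_mat[OF B cyc_carrier[of n 1] cyc_carrier[of n "- 1"]] by (simp add: cyc_add cyc_zero)
      then show ?thesis using mult[OF mult[OF cK AK] inv_cyc] unfolding eq by simp
    qed
    have x'K: "x' \<in> K" by (rule conjK[OF xK _ conj]) simp
    have "elem n 0 1 1 = y * (x * x')"
      using G.m_assoc[OF SL(3)[of 1] sig_SL sig_SL] sig by (simp add: y_def)
    then have e01: "elem n 0 1 1 \<in> K" using mult[OF yK mult[OF xK x'K]] by simp
    have next_elem: "elem n i (Suc i mod n) 1 \<in> K" if "i < n" for i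
      using that
    proof (induction i)
      case 0
      then show ?case using e01 n by simp
    next
      case (Suc i)
      have "i \<noteq> Suc i mod n" using Suc.prems by simp
      then show ?case
        using conjK[OF _ addrow_mat_carrier cyc_elem[of i "Suc i mod n" n 1]] Suc n by simp
    qed
    have shift_elem: "elem n i ((i + d) mod n) 1 \<in> K" if "i < n" "0 < d" "d < n" for i d
      using that(2,3)
    proof (induction d)
      case (Suc d)
      show ?case
      proof (cases "d = 0")
        case True
        then show ?thesis using next_elem[OF that(1)] by simp
      next
        case False
        define j where "j = (i + d) mod n"
        have neq: "(i + e) mod n \<noteq> i" if "0 < e" "e < n" for e
          using \<open>i < n\<close> that by (simp add: mod_if) arith
        have "elem n i j 1 \<in> K" using Suc False by (simp add: j_def)
        moreover have j: "j < n" using that by (simp add: j_def)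
        moreover have "(i + Suc d) mod n = Suc j mod n" by (simp add: j_def mod_Suc_eq)
        moreover have "i \<noteq> j" "i \<noteq> Suc j mod n"
          using neq[of d] neq[of "Suc d"] False Suc.prems \<open>(i + Suc d) mod n = Suc j mod n\<close> by (auto simp: j_def)
        moreover have "j \<noteq> Suc j mod n" using j n by (simp add: mod_Suc)
        ultimately show ?thesis
          using subgroup_SL_elem_steinberg[OF K, of i j "Suc j mod n"] next_elem[OF j] n by simp
      qed
    qed simp
    show "K = carrier (SL_int n)"
    proof (rule elementary_matrices_generate_SL[OF K])
      fix i j assume ij: "i < n" "j < n" "i \<noteq> j"
      define d where "d = (if i < j then j - i else n + j - i)"
      have "(i + d) mod n = j" "0 < d" "d < n" using ij by (auto simp: d_def)
      then show "elem n i j 1 \<in> K" using shift_elem[of i d] ij by simp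
    qed
  qed (use SL y_SL xx yy xy cyc_full in simp_all)
qed

section \<open>Counting nonzero blocks\<close>

lemma I_elem_le:
  assumes "finite Z" "card Z \<le> N"
    and "\<And>i j. i \<in> {1..k} \<Longrightarrow> j \<in> {1..k} \<Longrightarrow> (i, j) \<notin> Z \<Longrightarrow>
      compose (ell2 S) (p i) (compose (ell2 S) x (p j)) = zero_op S"
  shows "I_elem S x p k \<le> real N / (real k)\<^sup>2"
proof -
  have "card {(i, j). i \<in> {1..k} \<and> j \<in> {1..k} \<and> compose (ell2 S) (p i) (compose (ell2 S) x (p j)) \<noteq> zero_op S} \<le> card Z"
    by (rule card_mono[OF assms(1)]) (use assms(3) in blast)
  then show ?thesis unfolding I_elem_def using assms(2) by (intro divide_right_mono) auto
qed

lemma I_fam_nonneg: "0 \<le> I_fam S xs p k"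
  unfolding I_fam_def by (intro sum_list_nonneg) (auto simp: I_elem_def)

context
  fixes S :: "'a set" and p :: "nat \<Rightarrow> 'a operator" and k :: nat
  assumes p_bops: "\<And>j. p j \<in> bounded_ops S"
    and p_orth: "\<And>i j. i \<in> {1..k} \<Longrightarrow> j \<in> {1..k} \<Longrightarrow> i \<noteq> j \<Longrightarrow> compose (ell2 S) (p i) (p j) = zero_op S"
begin

lemma p_orth_apply:
  assumes "i \<in> {1..k}" "j \<in> {1..k}" "i \<noteq> j" "f \<in> ell2 S"
  shows "p i (p j f) = (\<lambda>x. 0)"
  using fun_cong[OF p_orth[OF assms(1-3)], of f] assms(4) by (simp add: compose_def zero_op_def)

lemma I_elem_commuting:
  assumes x: "x \<in> bounded_ops S" and comm: "\<And>j. commutes S x (p j)"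
  shows "I_elem S x p k \<le> real k / (real k)\<^sup>2"
proof (rule I_elem_le[where Z = "(\<lambda>i. (i, i)) ` {1..k}"])
  show "card ((\<lambda>i. (i, i)) ` {1..k}) \<le> k" using card_image_le[of "{1..k}"] by simp
  fix i j assume ij: "i \<in> {1..k}" "j \<in> {1..k}" "(i, j) \<notin> (\<lambda>i. (i, i)) ` {1..k}"
  then have neq: "i \<noteq> j" by auto
  have "p i (x (p j f)) = (\<lambda>x. 0)" if f: "f \<in> ell2 S" for f
  proof -
    have "p i (x (p j f)) = x (p i (p j f))"
      using commutesD[OF comm bops_ell2[OF p_bops f]] by simp
    then show ?thesis using p_orth_apply[OF ij(1,2) neq f] bops_zero[OF x] by simp
  qed
  then show "compose (ell2 S) (p i) (compose (ell2 S) x (p j)) = zero_op S"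
    unfolding compose_def zero_op_def by (intro restrict_ext) simp
qed simp

lemma I_elem_corner:
  assumes x: "x \<in> bounded_ops S" and k: "k > 0"
  shows "I_elem S (compose (ell2 S) x (p 1)) p k \<le> real k / (real k)\<^sup>2"
proof (rule I_elem_le[where Z = "(\<lambda>i. (i, 1)) ` {1..k}"])
  show "card ((\<lambda>i. (i, 1 :: nat)) ` {1..k}) \<le> k" using card_image_le[of "{1..k}"] by simp
  fix i j assume ij: "i \<in> {1..k}" "j \<in> {1..k}" "(i, j) \<notin> (\<lambda>i. (i, 1)) ` {1..k}"
  then have neq: "1 \<noteq> j" by auto
  have "p i (x (p 1 (p j f))) = (\<lambda>x. 0)" if f: "f \<in> ell2 S" for f
    using p_orth_apply[OF _ ij(2) neq f] k bops_zero[OF x] bops_zero[OF p_bops] by simp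
  then show "compose (ell2 S) (p i) (compose (ell2 S) (compose (ell2 S) x (p 1)) (p j)) = zero_op S"
    unfolding compose_def zero_op_def by (intro restrict_ext) (simp add: bops_ell2[OF p_bops])
qed simp

end

section \<open>Propagation in groups\<close>

context group
begin

text \<open>It is enough to compare the subgroup \<open>U\<close> with its conjugates under positive powers of \<open>F\<close>.\<close>

lemma conjugates_disjoint:
  assumes U: "one_param U" and F: "one_param F"
    and free: "\<And>d l l'. 0 < d \<Longrightarrow> U l \<otimes> F d = F d \<otimes> U l' \<Longrightarrow> l' = 0"
    and r: "0 < r" and mm: "(m :: nat) < m'"
    and eq: "F (r * int (Suc m)) \<otimes> U l \<otimes> inv (F (r * int (Suc m))) =
      F (r * int (Suc m')) \<otimes> U l' \<otimes> inv (F (r * int (Suc m')))"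
  shows "l' = 0"
proof -
  define A where "A = F (r * int (Suc m))"
  define d where "d = r * (int m' - int m)"
  have [simp]: "A \<in> carrier G" "F d \<in> carrier G" "U l \<in> carrier G" "U l' \<in> carrier G"
    using U F by (simp_all add: A_def)
  have B: "F (r * int (Suc m')) = A \<otimes> F d"
    unfolding A_def one_param_add[OF F, symmetric] by (rule arg_cong[of _ _ F]) (simp add: d_def algebra_simps)
  have "A \<otimes> (U l \<otimes> inv A) = A \<otimes> (F d \<otimes> U l' \<otimes> inv (F d) \<otimes> inv A)"
    using eq unfolding B A_def[symmetric] by (simp add: inv_mult_group m_assoc)
  then have "U l \<otimes> inv A = F d \<otimes> U l' \<otimes> inv (F d) \<otimes> inv A" by simp
  then have "U l = F d \<otimes> U l' \<otimes> inv (F d)" by simp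
  then have "U l \<otimes> F d = F d \<otimes> U l'" by (simp add: m_assoc)
  moreover have "0 < d" using r mm by (simp add: d_def)
  ultimately show ?thesis using free by blast
qed

text \<open>The case of the positive powers of one group element \<open>F 1\<close>, with which \<open>T\<close> is already known to commute.\<close>

lemma commutes_along_pair:
  assumes U: "one_param U" and inj_U: "inj U" and c: "proj_seq c" and c0: "c 0 \<noteq> 0"
    and F: "one_param F"
    and free: "\<And>d l l'. 0 < d \<Longrightarrow> U l \<otimes> F d = F d \<otimes> U l' \<Longrightarrow> l' = 0"
    and g: "g \<in> carrier G" and gF: "\<And>m. g \<otimes> F m = F m \<otimes> g"
    and T: "T \<in> bounded_ops (carrier G)"
    and TP: "commutes (carrier G) T (conv_op U c)"
    and TgP: "commutes (carrier G) T (compose (ell2 (carrier G)) (left_regular G g) (conv_op U c))"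
    and TF: "commutes (carrier G) T (left_regular G (F 1))"
  shows "commutes (carrier G) T (left_regular G g)"
  unfolding commutes_def
proof
  let ?S = "carrier G"
  fix f assume f: "f \<in> ell2 ?S"
  have "T (left_regular G g (left_regular G \<one> f)) = left_regular G g (T (left_regular G \<one> f))"
  proof (rule commutes_from_corner[OF U inj_U c c0 _ _ g _ _ _ T TP TgP _ f, where f = "\<lambda>m. F (1 * int (Suc m))"])
    show "F (1 * int (Suc m)) \<in> ?S" for m using F by simp
    show "l' = 0" if "m < m'" "F (1 * int (Suc m)) \<otimes> U l \<otimes> inv (F (1 * int (Suc m))) =
      F (1 * int (Suc m')) \<otimes> U l' \<otimes> inv (F (1 * int (Suc m')))" for m m' l l'
      by (rule conjugates_disjoint[OF U F free _ that]) simp_all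
    show "g \<otimes> F (1 * int (Suc m)) = F (1 * int (Suc m)) \<otimes> g" for m by (rule gF)
    show "left_regular G \<one> \<in> bounded_ops ?S" by simp
    show "commutes ?S (left_regular G \<one>) (left_regular G g)"
      unfolding commutes_def using g by (simp add: left_regular_one left_regular_ell2)
    show "commutes ?S T (compose (ell2 ?S) (left_regular G \<one>) (left_regular G (F (1 * int (Suc m)))))" for m
      by (intro commutes_compose T left_regular_bops one_closed one_param_closed[OF F]
          commutes_left_regular_one commutes_one_param[OF T F TF])
  qed
  then show "T (left_regular G g f) = left_regular G g (T f)"
    by (simp add: left_regular_one[OF f])
qed

text \<open>Here \<open>e\<close> is a sum of pieces \<open>Q\<^sub>i F(r\<^sub>i)\<close> cut out by a partition of unity \<open>Q\<close> that commutes with the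
  one-parameter subgroup \<open>F\<close>. The element \<open>F(1)\<close> commutes with every piece, and the powers of each
  piece translate a projection of \<open>U\<close> around.\<close>

lemma commutes_from_pieces:
  assumes U: "one_param U" and inj_U: "inj U" and c: "proj_seq c" and c0: "c 0 \<noteq> 0"
    and F: "one_param F"
    and free: "\<And>d l l'. 0 < d \<Longrightarrow> U l \<otimes> F d = F d \<otimes> U l' \<Longrightarrow> l' = 0"
    and I: "finite I" and r: "\<And>i. i \<in> I \<Longrightarrow> 0 < r i"
    and Q: "\<And>i. i \<in> I \<Longrightarrow> Q i \<in> bounded_ops (carrier G)"
    and QF: "\<And>i m. i \<in> I \<Longrightarrow> commutes (carrier G) (Q i) (left_regular G (F m))"
    and Q_idem: "\<And>i f. i \<in> I \<Longrightarrow> f \<in> ell2 (carrier G) \<Longrightarrow> Q i (Q i f) = Q i f"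
    and Q_orth: "\<And>i j f. i \<in> I \<Longrightarrow> j \<in> I \<Longrightarrow> i \<noteq> j \<Longrightarrow> f \<in> ell2 (carrier G) \<Longrightarrow> Q i (Q j f) = (\<lambda>x. 0)"
    and Q_sum: "\<And>f. f \<in> ell2 (carrier G) \<Longrightarrow> (\<lambda>x. \<Sum>i\<in>I. Q i f x) = f"
    and e: "e = op_sum (carrier G) I (\<lambda>_. 1) (\<lambda>i. compose (ell2 (carrier G)) (Q i) (left_regular G (F (r i))))"
    and T: "T \<in> bounded_ops (carrier G)"
    and TQ: "\<And>i. i \<in> I \<Longrightarrow> commutes (carrier G) T (Q i)"
    and Te: "commutes (carrier G) T e"
    and TP: "commutes (carrier G) T (conv_op U c)"
    and TFP: "commutes (carrier G) T (compose (ell2 (carrier G)) (left_regular G (F 1)) (conv_op U c))"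
  shows "commutes (carrier G) T (left_regular G (F 1))"
proof -
  let ?S = "carrier G" and ?l = "\<lambda>m. left_regular G (F m)"
  have cF [simp]: "F m \<in> ?S" for m using F by simp
  have l_ell2: "?l m f \<in> ell2 ?S" if "f \<in> ell2 ?S" for m f by (rule left_regular_ell2[OF cF that])
  have Q_ell2: "Q i f \<in> ell2 ?S" if "i \<in> I" "f \<in> ell2 ?S" for i f by (rule bops_ell2[OF Q[OF that(1)] that(2)])
  have e_ell2: "e f \<in> ell2 ?S" if "f \<in> ell2 ?S" for f
    unfolding e by (intro bops_ell2[OF _ that] op_sum_bops compose_bops Q left_regular_bops cF)
  have piece: "Q i (e f) = Q i (?l (r i) f)" if i: "i \<in> I" and f: "f \<in> ell2 ?S" for i f
  proof -
    have ef: "e f = (\<lambda>x. \<Sum>j\<in>I. Q j (?l (r j) f) x)"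
      using f by (simp add: e op_sum_apply compose_def)
    have "Q i (e f) = (\<lambda>x. \<Sum>j\<in>I. Q i (Q j (?l (r j) f)) x)"
      unfolding ef by (rule bops_sum[OF Q[OF i]]) (intro Q_ell2 l_ell2 f)
    also have "\<dots> = (\<lambda>x. \<Sum>j\<in>I. if j = i then Q i (?l (r i) f) x else 0)"
      by (intro ext sum.cong refl) (use i f Q_idem Q_orth l_ell2 in auto)
    also have "\<dots> = Q i (?l (r i) f)" using I i by simp
    finally show ?thesis .
  qed
  have step: "T (Q i (?l (r i) f)) = Q i (?l (r i) (T f))" if i: "i \<in> I" and f: "f \<in> ell2 ?S" for i f
  proof -
    have "T (Q i (?l (r i) f)) = T (Q i (e f))" by (simp only: piece[OF i f])
    also have "\<dots> = Q i (T (e f))" by (rule commutesD[OF TQ[OF i] e_ell2[OF f]])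
    also have "\<dots> = Q i (e (T f))" by (simp only: commutesD[OF Te f])
    also have "\<dots> = Q i (?l (r i) (T f))" by (rule piece[OF i bops_ell2[OF T f]])
    finally show ?thesis .
  qed
  have pow: "T (Q i (?l (r i * int (Suc m)) f)) = Q i (?l (r i * int (Suc m)) (T f))"
    if i: "i \<in> I" and f: "f \<in> ell2 ?S" for i m f
    using f
  proof (induction m arbitrary: f)
    case 0
    then show ?case using step[OF i] by simp
  next
    case (Suc m)
    have split: "Q i (?l (r i * int (Suc (Suc m))) g) = Q i (?l (r i) (Q i (?l (r i * int (Suc m)) g)))"
      if g: "g \<in> ell2 ?S" for g
    proof -
      have "r i * int (Suc (Suc m)) = r i + r i * int (Suc m)" by (simp add: algebra_simps)
      then have "?l (r i * int (Suc (Suc m))) g = ?l (r i) (?l (r i * int (Suc m)) g)"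
        using g by (simp add: left_regular_mult one_param_add[OF F])
      moreover have "Q i (?l (r i) (Q i (?l (r i * int (Suc m)) g))) = Q i (Q i (?l (r i) (?l (r i * int (Suc m)) g)))"
        using commutesD[OF QF[OF i] l_ell2[OF g]] by simp
      moreover have "\<dots> = Q i (?l (r i) (?l (r i * int (Suc m)) g))"
        by (rule Q_idem[OF i]) (intro l_ell2 g)
      ultimately show ?thesis by simp
    qed
    have "T (Q i (?l (r i * int (Suc (Suc m))) f)) = T (Q i (?l (r i) (Q i (?l (r i * int (Suc m)) f))))"
      by (simp only: split[OF Suc.prems])
    also have "\<dots> = Q i (?l (r i) (T (Q i (?l (r i * int (Suc m)) f))))"
      by (rule step[OF i]) (intro Q_ell2 i l_ell2 Suc.prems)
    also have "\<dots> = Q i (?l (r i) (Q i (?l (r i * int (Suc m)) (T f))))"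
      by (simp only: Suc.IH[OF Suc.prems])
    also have "\<dots> = Q i (?l (r i * int (Suc (Suc m))) (T f))"
      by (simp only: split[OF bops_ell2[OF T Suc.prems]])
    finally show ?case .
  qed
  have corner: "T (?l 1 (Q i f)) = ?l 1 (T (Q i f))" if i: "i \<in> I" and f: "f \<in> ell2 ?S" for i f
  proof (rule commutes_from_corner[OF U inj_U c c0 _ _ cF _ Q[OF i] QF[OF i] T TP TFP _ f,
        where f = "\<lambda>m. F (r i * int (Suc m))"])
    show "F (r i * int (Suc m)) \<in> ?S" for m by simp
    show "l' = 0" if "m < m'" "F (r i * int (Suc m)) \<otimes> U l \<otimes> inv (F (r i * int (Suc m))) =
      F (r i * int (Suc m')) \<otimes> U l' \<otimes> inv (F (r i * int (Suc m')))" for m m' l l'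
      by (rule conjugates_disjoint[OF U F free r[OF i] that])
    show "F 1 \<otimes> F (r i * int (Suc m)) = F (r i * int (Suc m)) \<otimes> F 1" for m
      unfolding one_param_add[OF F, symmetric] by (simp add: add.commute)
    show "commutes ?S T (compose (ell2 ?S) (Q i) (left_regular G (F (r i * int (Suc m)))))" for m
      unfolding commutes_def
    proof
      fix f assume f: "f \<in> ell2 ?S"
      show "T (compose (ell2 ?S) (Q i) (?l (r i * int (Suc m))) f) = compose (ell2 ?S) (Q i) (?l (r i * int (Suc m))) (T f)"
        using pow[OF i f, of m] f bops_ell2[OF T f] by (simp add: compose_def)
    qed
  qed
  show ?thesis
    unfolding commutes_def
  proof
    fix f assume f: "f \<in> ell2 ?S"
    have l_sum: "?l 1 g = (\<lambda>x. \<Sum>i\<in>I. ?l 1 (Q i g) x)" if g: "g \<in> ell2 ?S" for g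
    proof -
      have "?l 1 g = ?l 1 (\<lambda>x. \<Sum>i\<in>I. Q i g x)" by (simp only: Q_sum[OF g])
      also have "\<dots> = (\<lambda>x. \<Sum>i\<in>I. ?l 1 (Q i g) x)"
        by (rule bops_sum[OF left_regular_bops[OF cF]]) (intro Q_ell2 g)
      finally show ?thesis .
    qed
    have "T (?l 1 f) = T (\<lambda>x. \<Sum>i\<in>I. ?l 1 (Q i f) x)" by (simp only: l_sum[OF f])
    also have "\<dots> = (\<lambda>x. \<Sum>i\<in>I. T (?l 1 (Q i f)) x)"
      by (rule bops_sum[OF T]) (intro l_ell2 Q_ell2 f)
    also have "\<dots> = (\<lambda>x. \<Sum>i\<in>I. ?l 1 (Q i (T f)) x)"
      by (intro ext sum.cong refl) (simp only: corner[OF _ f] commutesD[OF TQ f])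
    also have "\<dots> = ?l 1 (T f)" by (rule l_sum[OF bops_ell2[OF T f], symmetric])
    finally show "T (?l 1 f) = ?l 1 (T f)" .
  qed
qed

end

section \<open>The invariant of the special linear group\<close>

lemma elem_one_param:
  assumes "i \<noteq> j" "i < n" "j < n"
  shows "group.one_param (SL_int n) (elem n i j)"
  using assms by (simp add: group.one_param_def[OF group_SL_int] elem_add)

lemma elem_inj:
  assumes "i \<noteq> j" "i < n" "j < n"
  shows "inj (elem n i j)"
proof (rule injI)
  fix a b assume "elem n i j a = elem n i j b"
  then have "elem n i j a $$ (i, j) = elem n i j b $$ (i, j)" by simp
  then show "a = b" using assms unfolding elem_index[OF assms(2,3,1)] by simp
qed

text \<open>Conjugates of \<open>E\<^sub>0\<^sub>1\<close> by different powers of \<open>E\<^sub>1\<^sub>2\<close>, or of \<open>E\<^sub>1\<^sub>0\<close>, generate subgroups with trivial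
  intersection. The entries in the first row show this.\<close>

lemma elem_free_upper:
  assumes n: "3 \<le> n" and d: "0 < d" and eq: "elem n 0 1 l * elem n 1 2 d = elem n 1 2 d * elem n 0 1 l'"
  shows "l' = 0"
proof -
  have "(elem n 0 1 l * elem n 1 2 d) $$ (0, s) = (elem n 1 2 d * elem n 0 1 l') $$ (0, s)" for s
    by (simp only: eq)
  from this[of 1] this[of 2] show ?thesis
    using n d by (simp add: elem_mult_elem_index del: index_mult_mat(1) index_mat_addrow_mat(1))
qed

lemma elem_free_opposite:
  assumes n: "3 \<le> n" and d: "0 < d" and eq: "elem n 0 1 l * elem n 1 0 d = elem n 1 0 d * elem n 0 1 l'"
  shows "l' = 0"
proof -
  have "(elem n 0 1 l * elem n 1 0 d) $$ (0, s) = (elem n 1 0 d * elem n 0 1 l') $$ (0, s)" for s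
    by (simp only: eq)
  from this[of 0] this[of 1] show ?thesis
    using n d by (simp add: elem_mult_elem_index del: index_mult_mat(1) index_mat_addrow_mat(1))
qed

lemma elem_pair_inj:
  assumes n: "3 \<le> n" and eq: "elem n 0 2 j * elem n 0 1 i = elem n 0 2 j' * elem n 0 1 i'"
  shows "j = j' \<and> i = i'"
proof -
  have "(elem n 0 2 j * elem n 0 1 i) $$ (0, s) = (elem n 0 2 j' * elem n 0 1 i') $$ (0, s)" for s
    by (simp only: eq)
  from this[of 1] this[of 2] show ?thesis
    using n by (simp add: elem_mult_elem_index del: index_mult_mat(1) index_mat_addrow_mat(1))
qed

text \<open>These are the pairs of arcs of length \<open>1/k\<close> that are at most two steps apart on the circle. The difference
  of the indices lies in one of three intervals, with \<open>5\<close>, \<open>3\<close> and \<open>3\<close> elements.\<close>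

lemma card_close_pairs:
  "card {(b, a). b \<in> {1..k} \<and> a \<in> {1..k} \<and> (\<bar>int a - int b\<bar> \<le> 2 \<or> int k - 2 \<le> \<bar>int a - int b\<bar>)} \<le> 11 * k"
    (is "card ?Z \<le> _")
  and finite_close_pairs:
  "finite {(b, a). b \<in> {1..k} \<and> a \<in> {1..k} \<and> (\<bar>int a - int b\<bar> \<le> 2 \<or> int k - 2 \<le> \<bar>int a - int b\<bar>)}"
proof -
  let ?D = "{- 2..2} \<union> {int k - 2..int k} \<union> {- int k..2 - int k}"
  have sub: "?Z \<subseteq> (\<lambda>(b, d). (b, nat (int b + d))) ` ({1..k} \<times> ?D)"
  proof
    fix z assume "z \<in> ?Z"
    then obtain b a where z: "z = (b, a)" "b \<in> {1..k}" "a \<in> {1..k}"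
      "\<bar>int a - int b\<bar> \<le> 2 \<or> int k - 2 \<le> \<bar>int a - int b\<bar>" by auto
    then have "int a - int b \<in> ?D" by auto
    then show "z \<in> (\<lambda>(b, d). (b, nat (int b + d))) ` ({1..k} \<times> ?D)"
      using z by (intro image_eqI[of _ _ "(b, int a - int b)"]) auto
  qed
  have fin: "finite ({1..k} \<times> ?D)" by simp
  show "finite ?Z" by (rule finite_subset[OF sub finite_imageI[OF fin]])
  have "card ?D \<le> card {- 2..2 :: int} + card {int k - 2..int k} + card {- int k..2 - int k}"
    by (meson add_right_mono card_Un_le order_trans)
  then have D: "card ?D \<le> 11" by simp
  have "card ?Z \<le> card ((\<lambda>(b, d). (b, nat (int b + d))) ` ({1..k} \<times> ?D))"
    by (rule card_mono[OF finite_imageI[OF fin] sub])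
  also have "\<dots> \<le> card ({1..k} \<times> ?D)" by (rule card_image_le[OF fin])
  also have "\<dots> = k * card ?D" by (simp add: card_cartesian_product)
  also have "\<dots> \<le> 11 * k" using D by simp
  finally show "card ?Z \<le> 11 * k" .
qed

text \<open>Modulo an integer, the translation distance \<open>r y\<close> is at most \<open>2/k\<close>: the point \<open>r i/k\<^sup>2\<close> contributes \<open>1/k\<close>, and
  so does the position of \<open>y\<close> in the \<open>i\<close>-th arc of length \<open>1/k\<^sup>2\<close>, because \<open>r \<le> k\<close>.\<close>

lemma translated_arc_avoids:
  fixes k :: nat and a b :: nat and i r h :: int and y :: real
  assumes k: "0 < k" and r: "0 < r" "r \<le> int k" and h: "\<bar>of_int r * (real_of_int i / (real k)\<^sup>2) - of_int h\<bar> < 1 / real k"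
    and y: "real_of_int i / (real k)\<^sup>2 \<le> y" "y \<le> (real_of_int i + 1) / (real k)\<^sup>2"
    and ab: "a \<in> {1..k}" "b \<in> {1..k}" "2 < \<bar>int a - int b\<bar>" "\<bar>int a - int b\<bar> < int k - 2"
  shows "\<exists>m. real b / real k - of_int r * y \<le> (real a - 1) / real k + of_int m \<and>
    real a / real k + of_int m \<le> (real b - 1) / real k - of_int r * y + 1"
proof -
  define \<theta> where "\<theta> = of_int r * y - of_int h"
  have y': "0 \<le> y - real_of_int i / (real k)\<^sup>2" "y - real_of_int i / (real k)\<^sup>2 \<le> 1 / (real k)\<^sup>2"
    using y by (simp_all add: add_divide_distrib)
  have "real_of_int r * (y - real_of_int i / (real k)\<^sup>2) \<le> real k * (1 / (real k)\<^sup>2)"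
    using r y' by (intro mult_mono) auto
  then have "real_of_int r * (y - real_of_int i / (real k)\<^sup>2) \<le> 1 / real k"
    using k by (simp add: power2_eq_square)
  moreover have "0 \<le> real_of_int r * (y - real_of_int i / (real k)\<^sup>2)" using r y' by simp
  ultimately have "\<bar>\<theta>\<bar> \<le> 2 / real k"
    using h by (simp add: \<theta>_def abs_if right_diff_distrib split: if_splits)
  then have th: "\<bar>real k * \<theta>\<bar> \<le> 2" using k by (simp add: abs_mult field_simps)
  \<comment> \<open>One full turn puts the \<open>a\<close>-th arc behind the \<open>b\<close>-th one.\<close>
  define s :: int where "s = (if 0 < int a - int b then 0 else 1)"
  have s: "3 \<le> int a - int b + s * int k" "int a - int b + s * int k \<le> int k - 3"
    using ab by (auto simp: s_def)
  have s': "3 \<le> real a - real b + of_int s * real k" "real a - real b + of_int s * real k \<le> real k - 3"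
    using of_int_le_iff[where 'a = real, THEN iffD2, OF s(1)] of_int_le_iff[where 'a = real, THEN iffD2, OF s(2)] by simp_all
  have 1: "real b - real k * \<theta> \<le> real a - 1 + of_int s * real k"
    and 2: "real a + of_int s * real k \<le> real b - 1 - real k * \<theta> + real k"
    using s' th by linarith+
  have "(real b - real k * \<theta>) / real k \<le> (real a - 1 + of_int s * real k) / real k"
    "(real a + of_int s * real k) / real k \<le> (real b - 1 - real k * \<theta> + real k) / real k"
    using 1 2 k by (intro divide_right_mono; simp)+
  then have "real b / real k - \<theta> \<le> (real a - 1) / real k + of_int s"
    "real a / real k + of_int s \<le> (real b - 1) / real k - \<theta> + 1"
    using k by (simp_all add: add_divide_distrib diff_divide_distrib)
  then show ?thesis
    by (intro exI[of _ "s - h"]) (simp add: \<theta>_def)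
qed

text \<open>The generating family consists of the elementary matrices that commute with \<open>E\<^sub>0\<^sub>1\<close>, of the corners of the other
  ones, and of the operator \<open>e\<close>. The bound is the sum of \<open>11/k\<close> for \<open>e\<close> and of \<open>1/k\<close> for each of at most \<open>n\<^sup>2\<close>
  elementary matrices.\<close>

lemma SL_G_at_le:
  assumes n: "3 \<le> n" and k: "0 < k"
  shows "G_at (carrier (SL_int n)) (group_vna (SL_int n)) (canonical_trace (SL_int n)) k
    \<le> ereal ((11 + (real n)\<^sup>2) / real k)"
proof -
  interpret G: group "SL_int n" by (rule group_SL_int)
  let ?S = "carrier (SL_int n)" and ?l = "left_regular (SL_int n)"
  define U where "U = elem n 0 1"
  define V where "V = elem n 0 2"
  define F where "F = elem n 1 2"
  define H where "H = elem n 1 0"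
  have U: "G.one_param U" and V: "G.one_param V" and F: "G.one_param F" and H: "G.one_param H"
    unfolding U_def V_def F_def H_def using n by (simp_all add: elem_one_param)
  have inj_U: "inj U" and inj_V: "inj V" unfolding U_def V_def using n by (simp_all add: elem_inj)
  have elem_in [simp]: "elem n i j a \<in> ?S" if "i \<noteq> j" for i j a using that by simp
  define arc where "arc i = arc_coeff ((real i - 1) / real k) (real i / real k)" for i :: nat
  define arcV where "arcV i = arc_coeff (real i / (real k)\<^sup>2) (real (Suc i) / (real k)\<^sup>2)" for i :: nat
  have k1: "1 / real k \<le> 1" "1 / (real k)\<^sup>2 \<le> 1" using k by simp_all
  have arc: "proj_seq (arc i)" for i
    unfolding arc_def by (rule arc_proj_seq) (use k1 in \<open>simp_all add: diff_divide_distrib divide_right_mono\<close>)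
  have arcV: "proj_seq (arcV i)" for i
    unfolding arcV_def by (rule arc_proj_seq) (use k1 in \<open>simp_all add: add_divide_distrib divide_right_mono\<close>)
  define p where "p i = G.conv_op U (arc i)" for i
  define Q where "Q i = G.conv_op V (arcV i)" for i
  have p_bops: "p i \<in> bounded_ops ?S" for i unfolding p_def by (rule G.conv_op_bops[OF U inj_U arc])
  have Q_bops: "Q i \<in> bounded_ops ?S" for i unfolding Q_def by (rule G.conv_op_bops[OF V inj_V arcV])
  have p_orth: "compose (ell2 ?S) (p i) (p j) = zero_op ?S" if ij: "i \<in> {1..k}" "j \<in> {1..k}" "i \<noteq> j" for i j
    unfolding p_def
  proof (rule G.conv_op_mult_zero[OF U inj_U arc arc])
    fix m
    define s :: int where "s = (if i < j then 0 else 1)"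
    have 1: "real i \<le> real j - 1 + of_int s * real k" "real j + of_int s * real k \<le> real i - 1 + real k"
      using ij by (auto simp: s_def)
    have "real i / real k \<le> (real j - 1 + of_int s * real k) / real k"
      "(real j + of_int s * real k) / real k \<le> (real i - 1 + real k) / real k"
      using 1 by (intro divide_right_mono; simp)+
    then have 2: "real i / real k \<le> (real j - 1) / real k + of_int s" "real j / real k + of_int s \<le> (real i - 1) / real k + 1"
      using k by (simp_all add: add_divide_distrib)
    show "((\<lambda>l. arc i l * arc j (m - l)) has_sum 0) UNIV"
      unfolding arc_def
      by (rule arc_coeff_orthogonal[OF _ _ 2]) (simp_all add: divide_right_mono)
  qed
  \<comment> \<open>Dirichlet approximation of \<open>i/k\<^sup>2\<close>, the left end of the \<open>i\<close>-th arc.\<close>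
  define r where "r i = (SOME r :: int. 0 < r \<and> r \<le> int k \<and>
    (\<exists>h :: int. \<bar>of_int r * (real i / (real k)\<^sup>2) - of_int h\<bar> < 1 / real k))" for i :: nat
  have r: "0 < r i" "r i \<le> int k" "\<exists>h :: int. \<bar>of_int (r i) * (real i / (real k)\<^sup>2) - of_int h\<bar> < 1 / real k" for i
  proof -
    obtain h r0 where "0 < r0" "r0 \<le> int k" "\<bar>of_int r0 * (real i / (real k)\<^sup>2) - of_int h\<bar> < 1 / real k"
      using Dirichlet_approx[OF k] by metis
    then have "\<exists>r :: int. 0 < r \<and> r \<le> int k \<and> (\<exists>h :: int. \<bar>of_int r * (real i / (real k)\<^sup>2) - of_int h\<bar> < 1 / real k)"
      by blast
    from someI_ex[OF this] show "0 < r i" "r i \<le> int k"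
      "\<exists>h :: int. \<bar>of_int (r i) * (real i / (real k)\<^sup>2) - of_int h\<bar> < 1 / real k"
      unfolding r_def by blast+
  qed
  define I where "I = {..<k\<^sup>2}"
  define e where "e = op_sum ?S I (\<lambda>_. 1) (\<lambda>i. compose (ell2 ?S) (Q i) (?l (F (r i))))"
  have F_in [simp]: "F m \<in> ?S" for m using F G.one_param_closed by blast
  have piece_bops: "compose (ell2 ?S) (Q i) (?l (F m)) \<in> bounded_ops ?S" for i m
    by (intro compose_bops Q_bops G.left_regular_bops F_in)
  have e_bops: "e \<in> bounded_ops ?S" unfolding e_def by (intro op_sum_bops piece_bops)
  define X where "X = (\<lambda>(i, j). if i \<noteq> 1 \<and> j \<noteq> 0 then ?l (elem n i j 1) else compose (ell2 ?S) (?l (elem n i j 1)) (p 1))"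
  define prs where "prs = filter (\<lambda>(i, j). i \<noteq> j) (List.product [0..<n] [0..<n])"
  define xs where "xs = e # map X prs"
  have prs: "(i, j) \<in> set prs \<longleftrightarrow> i < n \<and> j < n \<and> i \<noteq> j" for i j by (auto simp: prs_def)
  have prsE: thesis if "ij \<in> set prs" "\<And>i j. ij = (i, j) \<Longrightarrow> i < n \<Longrightarrow> j < n \<Longrightarrow> i \<noteq> j \<Longrightarrow> thesis" for ij thesis
    using that prs by (metis surj_pair)
  have X_easy: "X (i, j) = ?l (elem n i j 1)" if "i \<noteq> 1" "j \<noteq> 0" for i j
    using that by (simp add: X_def)
  have X_corner: "X (i, j) = compose (ell2 ?S) (?l (elem n i j 1)) (p 1)" if "i = 1 \<or> j = 0" for i j
    using that unfolding X_def by (auto simp del: SL_int_simps)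
  have X_bops: "X ij \<in> bounded_ops ?S" if ij: "ij \<in> set prs" for ij
  proof (rule prsE[OF ij])
    fix i j assume ij: "ij = (i, j)" "i \<noteq> j"
    show ?thesis
    proof (cases "i = 1 \<or> j = 0")
      case True
      then show ?thesis
        unfolding ij(1) X_corner[OF True] by (intro compose_bops G.left_regular_bops p_bops elem_in ij)
    next
      case False
      then show ?thesis
        unfolding ij(1) using ij(2) by (subst X_easy) (auto intro!: G.left_regular_bops elem_in simp del: SL_int_simps)
    qed
  qed
  have p_comm: "commutes ?S T (p i)" if "T \<in> bounded_ops ?S" "\<And>l. commutes ?S T (?l (U l))" for T i
    unfolding p_def by (rule G.commutes_conv_op[OF U inj_U that(1) arc that(2)])
  have Q_comm: "commutes ?S T (Q i)" if "T \<in> bounded_ops ?S" "\<And>l. commutes ?S T (?l (V l))" for T i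
    unfolding Q_def by (rule G.commutes_conv_op[OF V inj_V that(1) arcV that(2)])
  have l_comm: "commutes ?S (?l g) (?l h)" if "g \<in> ?S" "h \<in> ?S" "g * h = h * g" for g h
    unfolding commutes_def using that by (simp add: G.left_regular_mult del: SL_int_simps(1))
  have U_in: "U m \<in> ?S" for m using U G.one_param_closed by blast
  have V_in: "V m \<in> ?S" for m using V G.one_param_closed by blast
  have H_in: "H m \<in> ?S" for m using H G.one_param_closed by blast

  have p_in: "p i \<in> group_vna (SL_int n)" for i
  proof (rule G.in_group_vnaI[OF p_bops])
    fix T assume T: "T \<in> bounded_ops ?S" and Tl: "\<And>g. g \<in> ?S \<Longrightarrow> commutes ?S T (?l g)"
    show "commutes ?S T (p i)" by (intro p_comm T Tl U_in)
  qed
  have e_in: "e \<in> group_vna (SL_int n)"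
  proof (rule G.in_group_vnaI[OF e_bops])
    fix T assume T: "T \<in> bounded_ops ?S" and Tl: "\<And>g. g \<in> ?S \<Longrightarrow> commutes ?S T (?l g)"
    show "commutes ?S T e"
      unfolding e_def
      by (intro commutes_op_sum T piece_bops commutes_compose Q_bops G.left_regular_bops F_in Q_comm Tl V_in)
  qed
  have X_in: "X ij \<in> group_vna (SL_int n)" if ij: "ij \<in> set prs" for ij
  proof (rule G.in_group_vnaI[OF X_bops[OF ij]])
    fix T assume T: "T \<in> bounded_ops ?S" and Tl: "\<And>g. g \<in> ?S \<Longrightarrow> commutes ?S T (?l g)"
    show "commutes ?S T (X ij)"
    proof (rule prsE[OF ij])
      fix i j assume ij: "ij = (i, j)" "i \<noteq> j"
      show ?thesis
      proof (cases "i = 1 \<or> j = 0")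
        case True
        show ?thesis
          unfolding ij(1) X_corner[OF True]
          by (intro commutes_compose T G.left_regular_bops p_bops p_comm Tl U_in elem_in ij)
      next
        case False
        then show ?thesis
          unfolding ij(1) using ij(2) by (subst X_easy) (auto intro!: Tl elem_in simp del: SL_int_simps)
      qed
    qed
  qed
  have xs_in: "set xs \<subseteq> group_vna (SL_int n)" using e_in X_in by (auto simp: xs_def)

  have gen: "vN_generated ?S (set xs) = group_vna (SL_int n)"
  proof (rule G.group_vna_generatedI[OF xs_in])
    fix T g assume T: "T \<in> bounded_ops ?S" and comm: "\<And>X. X \<in> set xs \<Longrightarrow> commutes ?S T X" and g: "g \<in> ?S"
    have Te: "commutes ?S T e" by (rule comm) (simp add: xs_def)
    have TX: "commutes ?S T (X (i, j))" if "i < n" "j < n" "i \<noteq> j" for i j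
      by (rule comm) (use that prs in \<open>auto simp: xs_def\<close>)
    have T_easy: "commutes ?S T (?l (elem n i j 1))" if "i < n" "j < n" "i \<noteq> j" "i \<noteq> 1" "j \<noteq> 0" for i j
      using TX[OF that(1-3)] X_easy[OF that(4,5)] by simp
    have T_corner: "commutes ?S T (compose (ell2 ?S) (?l (elem n i j 1)) (p 1))"
      if "i < n" "j < n" "i \<noteq> j" "i = 1 \<or> j = 0" for i j
      using TX[OF that(1-3)] X_corner[OF that(4)] by simp
    have TU: "commutes ?S T (?l (U l))" for l
      by (rule G.commutes_one_param[OF T U]) (use T_easy[of 0 1] n in \<open>simp add: U_def\<close>)
    have TV: "commutes ?S T (?l (V l))" for l
      by (rule G.commutes_one_param[OF T V]) (use T_easy[of 0 2] n in \<open>simp add: V_def\<close>)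
    have TP: "commutes ?S T (G.conv_op U (arc 1))" using p_comm[OF T TU, of 1] by (simp add: p_def)
    have arc0: "arc 1 0 \<noteq> 0" using k by (simp add: arc_def)
    have free_F: "l' = 0" if "0 < d" "U l \<otimes>\<^bsub>SL_int n\<^esub> F d = F d \<otimes>\<^bsub>SL_int n\<^esub> U l'" for d l l'
      using elem_free_upper[OF n that(1)] that(2) by (simp add: U_def F_def)
    have free_H: "l' = 0" if "0 < d" "U l \<otimes>\<^bsub>SL_int n\<^esub> H d = H d \<otimes>\<^bsub>SL_int n\<^esub> U l'" for d l l'
      using elem_free_opposite[OF n that(1)] that(2) by (simp add: U_def H_def)
    have TF: "commutes ?S T (?l (F 1))"
    proof (rule G.commutes_from_pieces[OF U inj_U arc arc0 F _ _ _ _ _ _ _ _ _ T _ Te TP, where I = I and r = r and Q = Q])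
      show "l' = 0" if "0 < d" "U l \<otimes>\<^bsub>SL_int n\<^esub> F d = F d \<otimes>\<^bsub>SL_int n\<^esub> U l'" for d l l'
        by (rule free_F[OF that])
      show "finite I" by (simp add: I_def)
      show "0 < r i" for i by (rule r(1))
      show "Q i \<in> bounded_ops ?S" for i by (rule Q_bops)
      show "commutes ?S (Q i) (?l (F m))" for i m
      proof -
        have "commutes ?S (?l (F m)) (Q i)"
        proof (rule Q_comm[OF G.left_regular_bops[OF F_in]], rule l_comm[OF F_in V_in])
          show "F m * V l = V l * F m" for l
            unfolding F_def V_def using n by (intro elem_commute) auto
        qed
        then show ?thesis unfolding commutes_def by simp
      qed
      show "Q i (Q i f) = Q i f" if "f \<in> ell2 ?S" for i f
        using G.conv_op_projection[OF V inj_V arcV, of i] that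
        by (metis Q_def compose_eq is_projection_def)
      show "Q i (Q j f) = (\<lambda>x. 0)" if "i \<in> I" "j \<in> I" "i \<noteq> j" and f: "f \<in> ell2 ?S" for i j f
      proof -
        have k2: "0 < (real k)\<^sup>2" using k by simp
        define s :: int where "s = (if i < j then 0 else 1)"
        have ik: "real i + 1 \<le> (real k)\<^sup>2" "real j + 1 \<le> (real k)\<^sup>2"
          using that by (simp_all add: I_def Suc_le_eq flip: of_nat_power of_nat_Suc)
        have 1: "real (Suc i) \<le> real j + of_int s * (real k)\<^sup>2" "real (Suc j) + of_int s * (real k)\<^sup>2 \<le> real i + (real k)\<^sup>2"
          using that ik by (auto simp: s_def)
        have "real (Suc i) / (real k)\<^sup>2 \<le> (real j + of_int s * (real k)\<^sup>2) / (real k)\<^sup>2"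
          "(real (Suc j) + of_int s * (real k)\<^sup>2) / (real k)\<^sup>2 \<le> (real i + (real k)\<^sup>2) / (real k)\<^sup>2"
          using 1 by (intro divide_right_mono; simp)+
        then have 2: "real (Suc i) / (real k)\<^sup>2 \<le> real j / (real k)\<^sup>2 + of_int s"
          "real (Suc j) / (real k)\<^sup>2 + of_int s \<le> real i / (real k)\<^sup>2 + 1"
          using k2 by (simp_all add: add_divide_distrib)
        have "compose (ell2 ?S) (Q i) (Q j) = zero_op ?S"
          unfolding Q_def
        proof (rule G.conv_op_mult_zero[OF V inj_V arcV arcV])
          show "((\<lambda>l. arcV i l * arcV j (m - l)) has_sum 0) UNIV" for m
            unfolding arcV_def by (rule arc_coeff_orthogonal[OF _ _ 2]) (simp_all add: divide_right_mono)
        qed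
        from fun_cong[OF this, of f] show ?thesis using f by (simp add: compose_def zero_op_def)
      qed
      show "(\<lambda>x. \<Sum>i\<in>I. Q i f x) = f" if "f \<in> ell2 ?S" for f
        unfolding Q_def
      proof (rule G.conv_op_sum_eq_id[OF V inj_V arcV _ that])
        show "(\<Sum>i\<in>I. arcV i l) = (if l = 0 then 1 else 0)" for l
          using arc_coeff_sum[of "\<lambda>i. real i / (real k)\<^sup>2" l "k\<^sup>2"] k
          by (simp add: I_def arcV_def arc_coeff_full)
      qed
      show "e = op_sum ?S I (\<lambda>_. 1) (\<lambda>i. compose (ell2 ?S) (Q i) (?l (F (r i))))" by (rule e_def)
      show "commutes ?S T (Q i)" for i by (rule Q_comm[OF T TV])
      show "commutes ?S T (compose (ell2 ?S) (?l (F 1)) (G.conv_op U (arc 1)))"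
        using T_corner[of 1 2] n by (simp add: F_def p_def)
    qed
    have T_row: "commutes ?S T (?l (elem n 1 j 1))" if j: "j < n" "j \<noteq> 1" for j
    proof (rule G.commutes_along_pair[OF U inj_U arc arc0 F _ _ _ T TP _ TF])
      show "l' = 0" if "0 < d" "U l \<otimes>\<^bsub>SL_int n\<^esub> F d = F d \<otimes>\<^bsub>SL_int n\<^esub> U l'" for d l l'
        by (rule free_F[OF that])
      show "elem n 1 j 1 \<in> ?S" using j by (intro elem_in) simp
      show "elem n 1 j 1 \<otimes>\<^bsub>SL_int n\<^esub> F m = F m \<otimes>\<^bsub>SL_int n\<^esub> elem n 1 j 1" for m
        unfolding F_def SL_int_simps using n j by (intro elem_commute) auto
      show "commutes ?S T (compose (ell2 ?S) (?l (elem n 1 j 1)) (G.conv_op U (arc 1)))"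
        using T_corner[of 1 j] n j by (simp add: p_def)
    qed
    have TH: "commutes ?S T (?l (H 1))" using T_row[of 0] n by (simp add: H_def)
    have T_col: "commutes ?S T (?l (elem n i 0 1))" if i: "i < n" "i \<noteq> 0" for i
    proof (rule G.commutes_along_pair[OF U inj_U arc arc0 H _ _ _ T TP _ TH])
      show "l' = 0" if "0 < d" "U l \<otimes>\<^bsub>SL_int n\<^esub> H d = H d \<otimes>\<^bsub>SL_int n\<^esub> U l'" for d l l'
        by (rule free_H[OF that])
      show "elem n i 0 1 \<in> ?S" using i by (intro elem_in) simp
      show "elem n i 0 1 \<otimes>\<^bsub>SL_int n\<^esub> H m = H m \<otimes>\<^bsub>SL_int n\<^esub> elem n i 0 1" for m
        unfolding H_def SL_int_simps using n i by (intro elem_commute) auto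
      show "commutes ?S T (compose (ell2 ?S) (?l (elem n i 0 1)) (G.conv_op U (arc 1)))"
        using T_corner[of i 0] n i by (simp add: p_def)
    qed
    have "{g \<in> ?S. commutes ?S T (?l g)} = ?S"
    proof (rule elementary_matrices_generate_SL[OF G.commuting_subgroup[OF T]])
      fix i j assume ij: "i < n" "j < n" "i \<noteq> j"
      then have "commutes ?S T (?l (elem n i j 1))"
        using T_easy[of i j] T_row[of j] T_col[of i] by (cases "i = 1"; cases "j = 0") auto
      then show "elem n i j 1 \<in> {g \<in> ?S. commutes ?S T (?l g)}" using ij by simp
    qed
    then show "commutes ?S T (?l g)" using g by blast
  qed

  have family: "p \<in> proj_families ?S (group_vna (SL_int n)) (canonical_trace (SL_int n)) k"
  proof -
    have "canonical_trace (SL_int n) (p j) = 1 / of_nat k" for j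
      unfolding p_def G.conv_op_trace[OF U inj_U arc] by (simp add: arc_def diff_divide_distrib)
    moreover have "is_projection ?S (p j)" for j
      unfolding p_def by (rule G.conv_op_projection[OF U inj_U arc])
    ultimately show ?thesis unfolding proj_families_def using p_in p_orth by blast
  qed

  have I_X: "I_elem ?S (X ij) p k \<le> real k / (real k)\<^sup>2" if ij_in: "ij \<in> set prs" for ij
  proof -
    obtain i j where ij: "ij = (i, j)" "i < n" "j < n" "i \<noteq> j" by (rule prsE[OF ij_in])
    show ?thesis
    proof (cases "i \<noteq> 1 \<and> j \<noteq> 0")
      case True
      have "commutes ?S (?l (elem n i j 1)) (p m)" for m
      proof (rule p_comm[OF G.left_regular_bops[OF elem_in[OF ij(4)]]], rule l_comm[OF elem_in[OF ij(4)] U_in])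
        show "elem n i j 1 * U l = U l * elem n i j 1" for l
          unfolding U_def using True ij n by (intro elem_commute) auto
      qed
      then show ?thesis
        using I_elem_commuting[OF p_bops p_orth G.left_regular_bops[OF elem_in[OF ij(4)]]] True ij
        by (simp add: X_easy del: SL_int_simps)
    next
      case False
      then have "X ij = compose (ell2 ?S) (?l (elem n i j 1)) (p 1)"
        unfolding ij(1) by (intro X_corner) auto
      then show ?thesis
        using I_elem_corner[OF p_bops p_orth G.left_regular_bops[OF elem_in[OF ij(4)]] k] by simp
    qed
  qed
  have I_e: "I_elem ?S e p k \<le> real (11 * k) / (real k)\<^sup>2"
  proof (rule I_elem_le[OF finite_close_pairs[of k] card_close_pairs])
    fix b a
    assume ba: "b \<in> {1..k}" "a \<in> {1..k}"
      "(b, a) \<notin> {(b, a). b \<in> {1..k} \<and> a \<in> {1..k} \<and> (\<bar>int a - int b\<bar> \<le> 2 \<or> int k - 2 \<le> \<bar>int a - int b\<bar>)}"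
    then have far: "2 < \<bar>int a - int b\<bar>" "\<bar>int a - int b\<bar> < int k - 2" by auto
    \<comment> \<open>Away from the diagonal, the block vanishes already for every single piece of \<open>e\<close>.\<close>
    have zero: "p b (Q i (?l (F (r i)) (p a f))) = (\<lambda>x. 0)" if f: "f \<in> ell2 ?S" for i f
      unfolding p_def Q_def
    proof (rule G.conv_op_triple_product_zero[OF U V F_in _ _ _ _ arc arc arcV _ f])
      show "U j \<otimes>\<^bsub>SL_int n\<^esub> V j' = V j' \<otimes>\<^bsub>SL_int n\<^esub> U j" for j j'
        unfolding U_def V_def SL_int_simps using n by (intro elem_commute) auto
      show "V j \<otimes>\<^bsub>SL_int n\<^esub> F (r i) = F (r i) \<otimes>\<^bsub>SL_int n\<^esub> V j" for j
        unfolding F_def V_def SL_int_simps using n by (intro elem_commute) auto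
      show "U l \<otimes>\<^bsub>SL_int n\<^esub> F (r i) = F (r i) \<otimes>\<^bsub>SL_int n\<^esub> U l \<otimes>\<^bsub>SL_int n\<^esub> V (r i * l)" for l
      proof -
        have "U l * F (r i) = F (r i) * (U l * V (l * r i))"
          unfolding U_def F_def V_def using n by (intro elem_steinberg) auto
        then show ?thesis using G.m_assoc[OF F_in U_in V_in] by (simp add: mult.commute)
      qed
      show "j = j' \<and> i = i'" if "V j \<otimes>\<^bsub>SL_int n\<^esub> U i = V j' \<otimes>\<^bsub>SL_int n\<^esub> U i'" for i j i' j'
        using elem_pair_inj[OF n] that by (simp add: U_def V_def)
      obtain h :: int where h: "\<bar>of_int (r i) * (real i / (real k)\<^sup>2) - of_int h\<bar> < 1 / real k" using r(3) by blast
      show "((\<lambda>l. arc b l * (arc a (i' - l) * arcV i (j - r i * l))) has_sum 0) UNIV" for i' j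
        unfolding arc_def arcV_def
      proof (rule arc_coeff_triple)
        fix y assume y: "y \<in> {real i / (real k)\<^sup>2..real (Suc i) / (real k)\<^sup>2}"
        show "\<exists>m. real b / real k - of_int (r i) * y \<le> (real a - 1) / real k + of_int m \<and>
          real a / real k + of_int m \<le> (real b - 1) / real k - of_int (r i) * y + 1"
          by (rule translated_arc_avoids[OF k r(1,2), where i = "int i" and h = h])
            (use h y ba far in \<open>simp_all add: add.commute\<close>)
      qed (use k1 in \<open>simp_all add: diff_divide_distrib divide_right_mono\<close>)
    qed
    have "p b (e (p a f)) = (\<lambda>x. 0)" if f: "f \<in> ell2 ?S" for f
    proof -
      have pf: "p a f \<in> ell2 ?S" by (rule bops_ell2[OF p_bops f])
      have "e (p a f) = (\<lambda>x. \<Sum>i\<in>I. Q i (?l (F (r i)) (p a f)) x)"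
        unfolding e_def op_sum_apply[OF pf] compose_eq[OF pf] by simp
      moreover have "p b (\<lambda>x. \<Sum>i\<in>I. Q i (?l (F (r i)) (p a f)) x) = (\<lambda>x. \<Sum>i\<in>I. p b (Q i (?l (F (r i)) (p a f))) x)"
        by (rule bops_sum[OF p_bops]) (intro bops_ell2[OF Q_bops] G.left_regular_ell2 F_in pf)
      ultimately show ?thesis by (simp add: zero[OF f])
    qed
    then show "compose (ell2 ?S) (p b) (compose (ell2 ?S) e (p a)) = zero_op ?S"
      unfolding compose_def zero_op_def by (intro restrict_ext) simp
  qed
  have "I_fam ?S xs p k \<le> real (11 * k) / (real k)\<^sup>2 + (real n)\<^sup>2 * (real k / (real k)\<^sup>2)"
  proof -
    have "(\<Sum>x\<leftarrow>map X prs. I_elem ?S x p k) = (\<Sum>ij\<leftarrow>prs. I_elem ?S (X ij) p k)"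
      by (simp add: o_def)
    also have "\<dots> \<le> (\<Sum>ij\<leftarrow>prs. real k / (real k)\<^sup>2)"
      by (rule sum_list_mono) (rule I_X)
    also have "\<dots> = real (length prs) * (real k / (real k)\<^sup>2)" by (simp add: sum_list_triv)
    also have "\<dots> \<le> (real n)\<^sup>2 * (real k / (real k)\<^sup>2)"
    proof (rule mult_right_mono)
      have "length prs \<le> n * n"
        unfolding prs_def using length_filter_le[of _ "List.product [0..<n] [0..<n]"] by simp
      then show "real (length prs) \<le> (real n)\<^sup>2"
        by (simp add: power2_eq_square flip: of_nat_mult)
    qed simp
    finally show ?thesis using I_e by (simp add: I_fam_def xs_def)
  qed
  also have "\<dots> = (11 + (real n)\<^sup>2) / real k"
    using k by (simp add: power2_eq_square add_divide_distrib)
  finally have fam: "I_fam ?S xs p k \<le> (11 + (real n)\<^sup>2) / real k" .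
  have "G_at ?S (group_vna (SL_int n)) (canonical_trace (SL_int n)) k
      \<le> I_inf ?S (group_vna (SL_int n)) (canonical_trace (SL_int n)) xs k"
    unfolding G_at_def by (rule INF_lower) (use xs_in gen in \<open>simp add: xs_def\<close>)
  also have "\<dots> \<le> ereal (I_fam ?S xs p k)"
    unfolding I_inf_def by (rule INF_lower[OF family])
  also have "\<dots> \<le> ereal ((11 + (real n)\<^sup>2) / real k)" using fam by simp
  finally show ?thesis .
qed

lemma G_inv_nonneg: "0 \<le> G_inv S M \<tau>"
proof -
  have "0 \<le> G_at S M \<tau> k" for k
    unfolding G_at_def I_inf_def by (intro INF_greatest) (simp add: I_fam_nonneg)
  then show ?thesis unfolding G_inv_def by (intro Liminf_bounded) simp
qed

theorem corollary6p3:
  fixes m :: nat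
  assumes "m \<ge> 1"
  shows "G_inv (carrier (SL_int (2 * m + 1)))
           (group_vna (SL_int (2 * m + 1))) (canonical_trace (SL_int (2 * m + 1))) = 0
         \<and> singly_generated (carrier (SL_int (2 * m + 1))) (group_vna (SL_int (2 * m + 1)))"
proof
  define n where "n = 2 * m + 1"
  have n: "3 \<le> n" "odd n" using assms by (simp_all add: n_def)
  define C where "C = 11 + (real n)\<^sup>2"
  have "G_inv (carrier (SL_int n)) (group_vna (SL_int n)) (canonical_trace (SL_int n))
      \<le> liminf (\<lambda>k. ereal (C / real k))"
    unfolding G_inv_def
  proof (rule Liminf_mono)
    show "\<forall>\<^sub>F k in sequentially. G_at (carrier (SL_int n)) (group_vna (SL_int n)) (canonical_trace (SL_int n)) k
        \<le> ereal (C / real k)"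
      using eventually_gt_at_top[of 0] by eventually_elim (simp only: C_def SL_G_at_le[OF n(1)])
  qed
  also have "\<dots> = 0"
  proof (rule lim_imp_Liminf)
    have "(\<lambda>k. C / real k) \<longlonglongrightarrow> 0" by (rule lim_const_over_n)
    then show "(\<lambda>k. ereal (C / real k)) \<longlonglongrightarrow> 0" by (simp add: zero_ereal_def)
  qed simp
  finally have "G_inv (carrier (SL_int n)) (group_vna (SL_int n)) (canonical_trace (SL_int n)) = 0"
    using G_inv_nonneg by (intro antisym)
  then show "G_inv (carrier (SL_int (2 * m + 1)))
      (group_vna (SL_int (2 * m + 1))) (canonical_trace (SL_int (2 * m + 1))) = 0" by (simp only: n_def)
  show "singly_generated (carrier (SL_int (2 * m + 1))) (group_vna (SL_int (2 * m + 1)))"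
    using SL_singly_generated[OF n] by (simp only: n_def)
qed

end
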